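(* Let $K$ be an algebraically closed field of characteristic $0$ and let $\mathcal C$ be a Frobenius, 2-Calabi-Yau, strongly almost finite $K$-category. Assume that $\mathcal C$ is an extension closed subcategory of an abelian category $\mathcal D$. Let $\mathcal T$ be a functorially finite subcategory of $\mathcal C$. If $\mathcal T$ is a rigid subcategory of $\mathcal C$ such that $\mathrm{gl.dim}(\mathcal T)\le 3$, and $\mathcal T$ contains all projective-injective objects of $\mathcal C$, then $\mathcal T$ is a cluster tilting subcategory of $\mathcal C$.
   Context: All subcategories are full; subcategories $\mathcal T$ are additive and closed under isomorphisms and direct summands. $\mathcal C$ carries the exact structure given by short exact sequences of $\mathcal D$ with terms in $\mathcal C$. An exact category is Frobenius if it has enough projectives and enough injectives and these classes of objects coincide. A Hom-finite exact $K$-linear category $\mathcal C$ is 2-Calabi-Yau if $\mathrm{Ext}^1_{\mathcal C}(X,Y)\cong D\,\mathrm{Ext}^1_{\mathcal C}(Y,X)$ naturally in $X,Y$, where $D$ is the $K$-dual. A $K$-linear Krull-Schmidt category is strongly almost finite if it is Hom-finite and for every indecomposable $X$ there are, up to isomorphism, only finitely many indecomposables $Y$ with $\mathrm{Hom}(X,Y)\neq0$ or $\mathrm{Hom}(Y,X)\ne0$. $\mathcal T$ is functorially finite if each object $Y$ of $\mathcal C$ has a right $\mathcal T$-approximation ($f:T\to Y$ with $T\in\mathcal T$ such that every morphism from an object of $\mathcal T$ to $Y$ factors through $f$) and, dually, a left $\mathcal T$-approximation. $\mathcal T$ is rigid if $\mathrm{Ext}^1_{\mathcal C}(T,T')=0$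 for all $T,T'\in\mathcal T$. $\mathcal T$ is cluster tilting if it is functorially finite and $\mathcal T=\{X\in\mathcal C\mid \mathrm{Ext}^1_{\mathcal C}(T,X)=0\ \forall T\in\mathcal T\}=\{X\in\mathcal C\mid \mathrm{Ext}^1_{\mathcal C}(X,T)=0\ \forall T\in\mathcal T\}$. $\mathrm{mod}\,\mathcal T$ is the abelian category of finitely presented covariant functors $F:\mathcal T\to\mathrm{mod}\,K$ (cokernels of maps $\mathrm{Hom}_{\mathcal T}(X,-)\to\mathrm{Hom}_{\mathcal T}(Y,-)$ with $X,Y\in\mathcal T$); its projectives are the representable functors. For indecomposable $X\in\mathcal T$ put $S_X=\mathrm{Hom}_{\mathcal T}(X,-)/\mathrm{rad}(X,-)$. $\mathrm{gl.dim}(\mathcal T)$ is the supremum, over indecomposable $X\in\mathcal T$, of the projective dimension of $S_X$ in $\mathrm{mod}\,\mathcal T$. *)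

theory Defs
  imports
    "Jordan_Normal_Form.Missing_VectorSpace"
    "HOL-Algebra.AbelCoset"
    "HOL-Algebra.Algebraic_Closure"
    "HOL-Library.Extended_Nat"
begin

(* frees X for use as a variable *)
no_notation var (\<open>X\<index>\<close>)

section \<open>Preadditive, abelian and linear categories\<close>

text \<open>
  Hom-sets are records of type \<^typ>\<open>('k, 'm) module\<close>, so that the same type serves
  preadditive categories, for which only carrier, addition and zero are relevant, and
  linear categories, for which the scalar multiplication is relevant too.
  The ring multiplication and unit of these records are never used.
  Nothing is required of \<open>Hom D X Y\<close> unless \<open>X\<close> and \<open>Y\<close> are objects, and Hom-sets need not be
  disjoint: all predicates on morphisms mention the domain and the codomain.
\<close>

record ('k, 'o, 'm) kcat =
  Obj :: "'o set"
  Hom :: "'o \<Rightarrow> 'o \<Rightarrow> ('k, 'm) module"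
  Idn :: "'o \<Rightarrow> 'm"
  Comp :: "'m \<Rightarrow> 'm \<Rightarrow> 'm" (infixl \<open>\<cdot>\<index>\<close> 70)

abbreviation Mor :: "('k, 'o, 'm) kcat \<Rightarrow> 'o \<Rightarrow> 'o \<Rightarrow> 'm set" where
  "Mor D X Y \<equiv> carrier (Hom D X Y)"

locale category =
  fixes D :: "('k, 'o, 'm) kcat" (structure)
  assumes id_closed: "X \<in> Obj D \<Longrightarrow> Idn D X \<in> Mor D X X"
    and comp_closed: "\<lbrakk>X \<in> Obj D; Y \<in> Obj D; Z \<in> Obj D; f \<in> Mor D X Y; g \<in> Mor D Y Z\<rbrakk>
          \<Longrightarrow> g \<cdot> f \<in> Mor D X Z"
    and comp_assoc: "\<lbrakk>W \<in> Obj D; X \<in> Obj D; Y \<in> Obj D; Z \<in> Obj D;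
            f \<in> Mor D W X; g \<in> Mor D X Y; h \<in> Mor D Y Z\<rbrakk>
          \<Longrightarrow> h \<cdot> (g \<cdot> f) = (h \<cdot> g) \<cdot> f"
    and id_left: "\<lbrakk>X \<in> Obj D; Y \<in> Obj D; f \<in> Mor D X Y\<rbrakk> \<Longrightarrow> Idn D Y \<cdot> f = f"
    and id_right: "\<lbrakk>X \<in> Obj D; Y \<in> Obj D; f \<in> Mor D X Y\<rbrakk> \<Longrightarrow> f \<cdot> Idn D X = f"

locale preadditive_category = category +
  assumes hom_abelian_group: "\<lbrakk>X \<in> Obj D; Y \<in> Obj D\<rbrakk> \<Longrightarrow> abelian_group (Hom D X Y)"
    and comp_distrib_right:
      "\<lbrakk>X \<in> Obj D; Y \<in> Obj D; Z \<in> Obj D; f \<in> Mor D X Y; f' \<in> Mor D X Y; g \<in> Mor D Y Z\<rbrakk>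
        \<Longrightarrow> g \<cdot> (f \<oplus>\<^bsub>Hom D X Y\<^esub> f') = g \<cdot> f \<oplus>\<^bsub>Hom D X Z\<^esub> g \<cdot> f'"
    and comp_distrib_left:
      "\<lbrakk>X \<in> Obj D; Y \<in> Obj D; Z \<in> Obj D; f \<in> Mor D X Y; g \<in> Mor D Y Z; g' \<in> Mor D Y Z\<rbrakk>
        \<Longrightarrow> (g \<oplus>\<^bsub>Hom D Y Z\<^esub> g') \<cdot> f = g \<cdot> f \<oplus>\<^bsub>Hom D X Z\<^esub> g' \<cdot> f"

definition isomorphic :: "('k, 'o, 'm) kcat \<Rightarrow> 'o \<Rightarrow> 'o \<Rightarrow> bool" where
  "isomorphic D X Y \<longleftrightarrow> (\<exists>f \<in> Mor D X Y. \<exists>g \<in> Mor D Y X.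
      g \<cdot>\<^bsub>D\<^esub> f = Idn D X \<and> f \<cdot>\<^bsub>D\<^esub> g = Idn D Y)"

definition is_mono :: "('k, 'o, 'm) kcat \<Rightarrow> 'o \<Rightarrow> 'o \<Rightarrow> 'm \<Rightarrow> bool" where
  "is_mono D X Y f \<longleftrightarrow> X \<in> Obj D \<and> Y \<in> Obj D \<and> f \<in> Mor D X Y \<and>
     (\<forall>W \<in> Obj D. \<forall>u \<in> Mor D W X. \<forall>v \<in> Mor D W X. f \<cdot>\<^bsub>D\<^esub> u = f \<cdot>\<^bsub>D\<^esub> v \<longrightarrow> u = v)"

definition is_epi :: "('k, 'o, 'm) kcat \<Rightarrow> 'o \<Rightarrow> 'o \<Rightarrow> 'm \<Rightarrow> bool" where
  "is_epi D X Y f \<longleftrightarrow> X \<in> Obj D \<and> Y \<in> Obj D \<and> f \<in> Mor D X Y \<and>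
     (\<forall>W \<in> Obj D. \<forall>u \<in> Mor D Y W. \<forall>v \<in> Mor D Y W. u \<cdot>\<^bsub>D\<^esub> f = v \<cdot>\<^bsub>D\<^esub> f \<longrightarrow> u = v)"

definition zero_object :: "('k, 'o, 'm) kcat \<Rightarrow> 'o \<Rightarrow> bool" where
  "zero_object D Z \<longleftrightarrow> Z \<in> Obj D \<and>
     (\<forall>X \<in> Obj D. (\<exists>!f. f \<in> Mor D X Z) \<and> (\<exists>!f. f \<in> Mor D Z X))"

definition biproduct ::
    "('k, 'o, 'm) kcat \<Rightarrow> 'o \<Rightarrow> 'o \<Rightarrow> 'o \<Rightarrow> 'm \<Rightarrow> 'm \<Rightarrow> 'm \<Rightarrow> 'm \<Rightarrow> bool" where
  "biproduct D X A B i j p q \<longleftrightarrow> X \<in> Obj D \<and> A \<in> Obj D \<and> B \<in> Obj D \<and>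
     i \<in> Mor D A X \<and> j \<in> Mor D B X \<and> p \<in> Mor D X A \<and> q \<in> Mor D X B \<and>
     p \<cdot>\<^bsub>D\<^esub> i = Idn D A \<and> q \<cdot>\<^bsub>D\<^esub> j = Idn D B \<and>
     q \<cdot>\<^bsub>D\<^esub> i = \<zero>\<^bsub>Hom D A B\<^esub> \<and> p \<cdot>\<^bsub>D\<^esub> j = \<zero>\<^bsub>Hom D B A\<^esub> \<and>
     (i \<cdot>\<^bsub>D\<^esub> p) \<oplus>\<^bsub>Hom D X X\<^esub> (j \<cdot>\<^bsub>D\<^esub> q) = Idn D X"

definition is_direct_sum :: "('k, 'o, 'm) kcat \<Rightarrow> 'o \<Rightarrow> 'o \<Rightarrow> 'o \<Rightarrow> bool" where
  "is_direct_sum D X A B \<longleftrightarrow> (\<exists>i j p q. biproduct D X A B i j p q)"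

locale additive_category = preadditive_category +
  assumes has_zero_object: "\<exists>Z. zero_object D Z"
    and has_direct_sums: "\<lbrakk>A \<in> Obj D; B \<in> Obj D\<rbrakk> \<Longrightarrow> \<exists>X. is_direct_sum D X A B"

definition is_kernel :: "('k, 'o, 'm) kcat \<Rightarrow> 'o \<Rightarrow> 'o \<Rightarrow> 'o \<Rightarrow> 'm \<Rightarrow> 'm \<Rightarrow> bool" where
  "is_kernel D X Y Z f g \<longleftrightarrow> X \<in> Obj D \<and> Y \<in> Obj D \<and> Z \<in> Obj D \<and>
     f \<in> Mor D X Y \<and> g \<in> Mor D Y Z \<and> g \<cdot>\<^bsub>D\<^esub> f = \<zero>\<^bsub>Hom D X Z\<^esub> \<and>
     (\<forall>W \<in> Obj D. \<forall>h \<in> Mor D W Y. g \<cdot>\<^bsub>D\<^esub> h = \<zero>\<^bsub>Hom D W Z\<^esub> \<longrightarrow>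
        (\<exists>!h'. h' \<in> Mor D W X \<and> f \<cdot>\<^bsub>D\<^esub> h' = h))"

definition is_cokernel :: "('k, 'o, 'm) kcat \<Rightarrow> 'o \<Rightarrow> 'o \<Rightarrow> 'o \<Rightarrow> 'm \<Rightarrow> 'm \<Rightarrow> bool" where
  "is_cokernel D X Y Z f g \<longleftrightarrow> X \<in> Obj D \<and> Y \<in> Obj D \<and> Z \<in> Obj D \<and>
     f \<in> Mor D X Y \<and> g \<in> Mor D Y Z \<and> g \<cdot>\<^bsub>D\<^esub> f = \<zero>\<^bsub>Hom D X Z\<^esub> \<and>
     (\<forall>W \<in> Obj D. \<forall>h \<in> Mor D Y W. h \<cdot>\<^bsub>D\<^esub> f = \<zero>\<^bsub>Hom D X W\<^esub> \<longrightarrow>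
        (\<exists>!h'. h' \<in> Mor D Z W \<and> h' \<cdot>\<^bsub>D\<^esub> g = h))"

locale abelian_category = additive_category +
  assumes has_kernels: "\<lbrakk>Y \<in> Obj D; Z \<in> Obj D; g \<in> Mor D Y Z\<rbrakk> \<Longrightarrow> \<exists>X f. is_kernel D X Y Z f g"
    and has_cokernels: "\<lbrakk>X \<in> Obj D; Y \<in> Obj D; f \<in> Mor D X Y\<rbrakk> \<Longrightarrow> \<exists>Z g. is_cokernel D X Y Z f g"
    and mono_normal: "is_mono D X Y f \<Longrightarrow> \<exists>Z g. is_kernel D X Y Z f g"
    and epi_normal: "is_epi D Y Z g \<Longrightarrow> \<exists>X f. is_cokernel D X Y Z f g"

text \<open>The sequence \<open>0 \<rightarrow> X \<rightarrow> Y \<rightarrow> Z \<rightarrow> 0\<close> is exact.\<close>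

definition short_exact :: "('k, 'o, 'm) kcat \<Rightarrow> 'o \<Rightarrow> 'o \<Rightarrow> 'o \<Rightarrow> 'm \<Rightarrow> 'm \<Rightarrow> bool" where
  "short_exact D X Y Z f g \<longleftrightarrow> is_kernel D X Y Z f g \<and> is_cokernel D X Y Z f g"

definition full_subcat :: "('k, 'o, 'm) kcat \<Rightarrow> 'o set \<Rightarrow> ('k, 'o, 'm) kcat" where
  "full_subcat D S = D\<lparr>Obj := S\<rparr>"

locale K_linear_category = preadditive_category D
  for K :: "('k, 'c) ring_scheme" and D :: "('k, 'o, 'm) kcat" (structure) +
  assumes hom_vectorspace: "\<lbrakk>X \<in> Obj D; Y \<in> Obj D\<rbrakk> \<Longrightarrow> vectorspace K (Hom D X Y)"
    and comp_smult_right: "\<lbrakk>X \<in> Obj D; Y \<in> Obj D; Z \<in> Obj D; c \<in> carrier K;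
            f \<in> Mor D X Y; g \<in> Mor D Y Z\<rbrakk>
          \<Longrightarrow> g \<cdot> (c \<odot>\<^bsub>Hom D X Y\<^esub> f) = c \<odot>\<^bsub>Hom D X Z\<^esub> (g \<cdot> f)"
    and comp_smult_left: "\<lbrakk>X \<in> Obj D; Y \<in> Obj D; Z \<in> Obj D; c \<in> carrier K;
            f \<in> Mor D X Y; g \<in> Mor D Y Z\<rbrakk>
          \<Longrightarrow> (c \<odot>\<^bsub>Hom D Y Z\<^esub> g) \<cdot> f = c \<odot>\<^bsub>Hom D X Z\<^esub> (g \<cdot> f)"

definition hom_finite :: "('k, 'c) ring_scheme \<Rightarrow> ('k, 'o, 'm) kcat \<Rightarrow> bool" where
  "hom_finite K D \<longleftrightarrow> (\<forall>X \<in> Obj D. \<forall>Y \<in> Obj D. vectorspace.fin_dim K (Hom D X Y))"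

definition char_zero :: "('k, 'c) ring_scheme \<Rightarrow> bool" where
  "char_zero K \<longleftrightarrow> (\<forall>n::nat. n > 0 \<longrightarrow> add_pow K n \<one>\<^bsub>K\<^esub> \<noteq> \<zero>\<^bsub>K\<^esub>)"


section \<open>Krull-Schmidt and strongly almost finite categories\<close>

definition End_ring :: "('k, 'o, 'm) kcat \<Rightarrow> 'o \<Rightarrow> 'm ring" where
  "End_ring D X = \<lparr>carrier = Mor D X X, monoid.mult = Comp D, one = Idn D X,
     zero = \<zero>\<^bsub>Hom D X X\<^esub>, add = add (Hom D X X)\<rparr>"

definition local_ring :: "'a ring \<Rightarrow> bool" where
  "local_ring R \<longleftrightarrow> ring R \<and> \<one>\<^bsub>R\<^esub> \<noteq> \<zero>\<^bsub>R\<^esub> \<and>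
     (\<forall>a \<in> carrier R. \<forall>b \<in> carrier R. a \<oplus>\<^bsub>R\<^esub> b \<in> Units R \<longrightarrow> a \<in> Units R \<or> b \<in> Units R)"

inductive finite_direct_sum :: "('k, 'o, 'm) kcat \<Rightarrow> ('o \<Rightarrow> bool) \<Rightarrow> 'o \<Rightarrow> bool"
  for D :: "('k, 'o, 'm) kcat" and P :: "'o \<Rightarrow> bool" where
  zero: "zero_object D X \<Longrightarrow> finite_direct_sum D P X"
| step: "\<lbrakk>is_direct_sum D X A B; P A; finite_direct_sum D P B\<rbrakk> \<Longrightarrow> finite_direct_sum D P X"

definition krull_schmidt :: "('k, 'o, 'm) kcat \<Rightarrow> bool" where
  "krull_schmidt D \<longleftrightarrow> additive_category D \<and>
     (\<forall>X \<in> Obj D. finite_direct_sum D (\<lambda>A. local_ring (End_ring D A)) X)"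

definition indecomposable :: "('k, 'o, 'm) kcat \<Rightarrow> 'o \<Rightarrow> bool" where
  "indecomposable D X \<longleftrightarrow> X \<in> Obj D \<and> \<not> zero_object D X \<and>
     (\<forall>A B. is_direct_sum D X A B \<longrightarrow> zero_object D A \<or> zero_object D B)"

definition strongly_almost_finite :: "('k, 'c) ring_scheme \<Rightarrow> ('k, 'o, 'm) kcat \<Rightarrow> bool" where
  "strongly_almost_finite K D \<longleftrightarrow> K_linear_category K D \<and> krull_schmidt D \<and> hom_finite K D \<and>
     (\<forall>X. indecomposable D X \<longrightarrow> (\<exists>S. finite S \<and> S \<subseteq> Obj D \<and>
        (\<forall>Y. indecomposable D Y \<and>
             (Mor D X Y \<noteq> {\<zero>\<^bsub>Hom D X Y\<^esub>} \<or> Mor D Y X \<noteq> {\<zero>\<^bsub>Hom D Y X\<^esub>})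
           \<longrightarrow> (\<exists>Z \<in> S. isomorphic D Y Z))))"


section \<open>Extension closed subcategories as exact categories\<close>

text \<open>
  Closure under isomorphisms follows from extension closure, since a zero object is present.
  A linear structure is only ever imposed on \<open>full_subcat D C\<close>; the ambient abelian category \<open>D\<close>
  is merely preadditive, and the scalar multiplication of its other Hom-records is unconstrained.
\<close>

definition extension_closed_subcat :: "('k, 'o, 'm) kcat \<Rightarrow> 'o set \<Rightarrow> bool" where
  "extension_closed_subcat D C \<longleftrightarrow> C \<subseteq> Obj D \<and> additive_category (full_subcat D C) \<and>
     (\<forall>X Y Z f g. short_exact D X Y Z f g \<and> X \<in> C \<and> Z \<in> C \<longrightarrow> Y \<in> C)"

definition conflation ::
    "('k, 'o, 'm) kcat \<Rightarrow> 'o set \<Rightarrow> 'o \<Rightarrow> 'o \<Rightarrow> 'o \<Rightarrow> 'm \<Rightarrow> 'm \<Rightarrow> bool" where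
  "conflation D C X Y Z f g \<longleftrightarrow> X \<in> C \<and> Y \<in> C \<and> Z \<in> C \<and> short_exact D X Y Z f g"

definition exact_projective :: "('k, 'o, 'm) kcat \<Rightarrow> 'o set \<Rightarrow> 'o \<Rightarrow> bool" where
  "exact_projective D C P \<longleftrightarrow> P \<in> C \<and>
     (\<forall>X Y Z f g. conflation D C X Y Z f g \<longrightarrow>
        (\<forall>h \<in> Mor D P Z. \<exists>h' \<in> Mor D P Y. g \<cdot>\<^bsub>D\<^esub> h' = h))"

definition exact_injective :: "('k, 'o, 'm) kcat \<Rightarrow> 'o set \<Rightarrow> 'o \<Rightarrow> bool" where
  "exact_injective D C I \<longleftrightarrow> I \<in> C \<and>
     (\<forall>X Y Z f g. conflation D C X Y Z f g \<longrightarrow>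
        (\<forall>h \<in> Mor D X I. \<exists>h' \<in> Mor D Y I. h' \<cdot>\<^bsub>D\<^esub> f = h))"

definition frobenius :: "('k, 'o, 'm) kcat \<Rightarrow> 'o set \<Rightarrow> bool" where
  "frobenius D C \<longleftrightarrow>
     (\<forall>Z \<in> C. \<exists>X P f g. exact_projective D C P \<and> conflation D C X P Z f g) \<and>
     (\<forall>X \<in> C. \<exists>I Z f g. exact_injective D C I \<and> conflation D C X I Z f g) \<and>
     (\<forall>P. exact_projective D C P \<longleftrightarrow> exact_injective D C P)"


section \<open>Yoneda extensions\<close>

text \<open>
  A triple \<open>(E, i, p)\<close> in \<open>extensions D C X Y\<close> is a conflation \<open>Y \<rightarrow> E \<rightarrow> X\<close>. The elements of
  \<open>Ext1 D C X Y\<close>, i.e. of \<open>Ext\<^sup>1\<^sub>C(X, Y)\<close>, are the equivalence classes of such triples.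
\<close>

definition extensions :: "('k, 'o, 'm) kcat \<Rightarrow> 'o set \<Rightarrow> 'o \<Rightarrow> 'o \<Rightarrow> ('o \<times> 'm \<times> 'm) set" where
  "extensions D C X Y = {(E, i, p). conflation D C Y E X i p}"

definition ext_equiv ::
    "('k, 'o, 'm) kcat \<Rightarrow> 'o set \<Rightarrow> 'o \<Rightarrow> 'o \<Rightarrow> (('o \<times> 'm \<times> 'm) \<times> ('o \<times> 'm \<times> 'm)) set" where
  "ext_equiv D C X Y = {((E, i, p), (E', i', p')).
     (E, i, p) \<in> extensions D C X Y \<and> (E', i', p') \<in> extensions D C X Y \<and>
     (\<exists>h \<in> Mor D E E'. \<exists>h' \<in> Mor D E' E.
        h' \<cdot>\<^bsub>D\<^esub> h = Idn D E \<and> h \<cdot>\<^bsub>D\<^esub> h' = Idn D E' \<and> h \<cdot>\<^bsub>D\<^esub> i = i' \<and> p' \<cdot>\<^bsub>D\<^esub> h = p)}"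

text \<open>
  Push-out along \<open>f : Y \<rightarrow> Y'\<close> and pull-back along \<open>g : X' \<rightarrow> X\<close>. An extension \<open>\<xi>'\<close> is obtained from
  \<open>\<xi>\<close> by push-out along \<open>f\<close> iff there is a morphism of short exact sequences \<open>(f, h, 1) : \<xi> \<rightarrow> \<xi>'\<close>,
  and dually for pull-backs. Applied to a class (or to a single representative), these yield a class.
\<close>

definition ext_push ::
    "('k, 'o, 'm) kcat \<Rightarrow> 'o set \<Rightarrow> 'o \<Rightarrow> 'o \<Rightarrow> 'm \<Rightarrow> ('o \<times> 'm \<times> 'm) set \<Rightarrow> ('o \<times> 'm \<times> 'm) set" where
  "ext_push D C X Y' f A = {(E', i', p') \<in> extensions D C X Y'.
     \<exists>(E, i, p) \<in> A. \<exists>h \<in> Mor D E E'. h \<cdot>\<^bsub>D\<^esub> i = i' \<cdot>\<^bsub>D\<^esub> f \<and> p' \<cdot>\<^bsub>D\<^esub> h = p}"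

definition ext_pull ::
    "('k, 'o, 'm) kcat \<Rightarrow> 'o set \<Rightarrow> 'o \<Rightarrow> 'o \<Rightarrow> 'm \<Rightarrow> ('o \<times> 'm \<times> 'm) set \<Rightarrow> ('o \<times> 'm \<times> 'm) set" where
  "ext_pull D C X' Y g A = {(E', i', p') \<in> extensions D C X' Y.
     \<exists>(E, i, p) \<in> A. \<exists>h \<in> Mor D E' E. h \<cdot>\<^bsub>D\<^esub> i' = i \<and> p \<cdot>\<^bsub>D\<^esub> h = g \<cdot>\<^bsub>D\<^esub> p'}"

text \<open>
  The Baer sum: form the direct sum \<open>Y \<oplus> Y \<rightarrow> E1 \<oplus> E2 \<rightarrow> X \<oplus> X\<close>, pull back along the diagonal
  \<open>u1 + u2 : X \<rightarrow> X \<oplus> X\<close> and push out along the codiagonal \<open>b1 + b2 : Y \<oplus> Y \<rightarrow> Y\<close>.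
\<close>

definition baer_sum ::
    "('k, 'o, 'm) kcat \<Rightarrow> 'o set \<Rightarrow> 'o \<Rightarrow> 'o \<Rightarrow>
      ('o \<times> 'm \<times> 'm) set \<Rightarrow> ('o \<times> 'm \<times> 'm) set \<Rightarrow> ('o \<times> 'm \<times> 'm) set" where
  "baer_sum D C X Y A B = {\<xi>.
     \<exists>(E1, i1, p1) \<in> A. \<exists>(E2, i2, p2) \<in> B.
     \<exists>YY a1 a2 b1 b2 EE e1 e2 q1 q2 XX u1 u2 v1 v2.
       biproduct (full_subcat D C) YY Y Y a1 a2 b1 b2 \<and>
       biproduct (full_subcat D C) EE E1 E2 e1 e2 q1 q2 \<and>
       biproduct (full_subcat D C) XX X X u1 u2 v1 v2 \<and>
       \<xi> \<in> ext_push D C X Y (b1 \<oplus>\<^bsub>Hom D YY Y\<^esub> b2)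
            (ext_pull D C X YY (u1 \<oplus>\<^bsub>Hom D X XX\<^esub> u2)
              {(EE,
                (e1 \<cdot>\<^bsub>D\<^esub> i1 \<cdot>\<^bsub>D\<^esub> b1) \<oplus>\<^bsub>Hom D YY EE\<^esub> (e2 \<cdot>\<^bsub>D\<^esub> i2 \<cdot>\<^bsub>D\<^esub> b2),
                (u1 \<cdot>\<^bsub>D\<^esub> p1 \<cdot>\<^bsub>D\<^esub> q1) \<oplus>\<^bsub>Hom D EE XX\<^esub> (u2 \<cdot>\<^bsub>D\<^esub> p2 \<cdot>\<^bsub>D\<^esub> q2))})}"

text \<open>The zero element is the class of the split extensions; \<open>c\<close> acts as push-out along \<open>c \<odot> 1\<^sub>Y\<close>.\<close>

definition Ext1 ::
    "('k, 'o, 'm) kcat \<Rightarrow> 'o set \<Rightarrow> 'o \<Rightarrow> 'o \<Rightarrow> ('k, ('o \<times> 'm \<times> 'm) set) module" where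
  "Ext1 D C X Y =
     (let z = {(E, i, p) \<in> extensions D C X Y. \<exists>s \<in> Mor D X E. p \<cdot>\<^bsub>D\<^esub> s = Idn D X}
      in \<lparr>carrier = extensions D C X Y // ext_equiv D C X Y,
          monoid.mult = (\<lambda>_ _. z), one = z, zero = z,
          add = baer_sum D C X Y,
          smult = (\<lambda>c. ext_push D C X Y (c \<odot>\<^bsub>Hom D Y Y\<^esub> Idn D Y))\<rparr>)"

definition dual_space :: "('k, 'c) ring_scheme \<Rightarrow> ('k, 'v) module \<Rightarrow> ('k, 'v \<Rightarrow> 'k) module" where
  "dual_space K V =
     (let z = (\<lambda>v \<in> carrier V. \<zero>\<^bsub>K\<^esub>)
      in \<lparr>carrier = {\<phi> \<in> carrier V \<rightarrow>\<^sub>E carrier K.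
            (\<forall>v \<in> carrier V. \<forall>w \<in> carrier V. \<phi> (v \<oplus>\<^bsub>V\<^esub> w) = \<phi> v \<oplus>\<^bsub>K\<^esub> \<phi> w) \<and>
            (\<forall>c \<in> carrier K. \<forall>v \<in> carrier V. \<phi> (c \<odot>\<^bsub>V\<^esub> v) = c \<otimes>\<^bsub>K\<^esub> \<phi> v)},
          monoid.mult = (\<lambda>_ _. z), one = z, zero = z,
          add = (\<lambda>\<phi> \<psi>. \<lambda>v \<in> carrier V. \<phi> v \<oplus>\<^bsub>K\<^esub> \<psi> v),
          smult = (\<lambda>c \<phi>. \<lambda>v \<in> carrier V. c \<otimes>\<^bsub>K\<^esub> \<phi> v)\<rparr>)"

text \<open>
  The last two clauses are the naturality of \<open>\<Phi> X Y : Ext\<^sup>1(X, Y) \<rightarrow> D Ext\<^sup>1(Y, X)\<close> with respect to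
  \<open>g : X' \<rightarrow> X\<close> and to \<open>f : Y \<rightarrow> Y'\<close>.
\<close>

definition two_calabi_yau ::
    "('k, 'c) ring_scheme \<Rightarrow> ('k, 'o, 'm) kcat \<Rightarrow> 'o set \<Rightarrow> bool" where
  "two_calabi_yau K D C \<longleftrightarrow> K_linear_category K (full_subcat D C) \<and> hom_finite K (full_subcat D C) \<and>
     (\<exists>\<Phi>.
       (\<forall>X \<in> C. \<forall>Y \<in> C.
          linear_map K (Ext1 D C X Y) (dual_space K (Ext1 D C Y X)) (\<Phi> X Y) \<and>
          bij_betw (\<Phi> X Y) (carrier (Ext1 D C X Y)) (carrier (dual_space K (Ext1 D C Y X)))) \<and>
       (\<forall>X \<in> C. \<forall>X' \<in> C. \<forall>Y \<in> C. \<forall>g \<in> Mor D X' X.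
          \<forall>\<xi> \<in> carrier (Ext1 D C X Y). \<forall>\<eta> \<in> carrier (Ext1 D C Y X').
            \<Phi> X' Y (ext_pull D C X' Y g \<xi>) \<eta> = \<Phi> X Y \<xi> (ext_push D C Y X g \<eta>)) \<and>
       (\<forall>X \<in> C. \<forall>Y \<in> C. \<forall>Y' \<in> C. \<forall>f \<in> Mor D Y Y'.
          \<forall>\<xi> \<in> carrier (Ext1 D C X Y). \<forall>\<eta> \<in> carrier (Ext1 D C Y' X).
            \<Phi> X Y' (ext_push D C X Y' f \<xi>) \<eta> = \<Phi> X Y \<xi> (ext_pull D C Y X f \<eta>)))"

definition Ext1_vanishes :: "('k, 'o, 'm) kcat \<Rightarrow> 'o set \<Rightarrow> 'o \<Rightarrow> 'o \<Rightarrow> bool" where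
  "Ext1_vanishes D C X Y \<longleftrightarrow> carrier (Ext1 D C X Y) = {\<zero>\<^bsub>Ext1 D C X Y\<^esub>}"


section \<open>Cluster tilting subcategories\<close>

text \<open>Full additive subcategories closed under isomorphisms and direct summands.\<close>

definition additive_subcat :: "('k, 'o, 'm) kcat \<Rightarrow> 'o set \<Rightarrow> bool" where
  "additive_subcat D T \<longleftrightarrow> T \<subseteq> Obj D \<and> (\<exists>Z \<in> T. zero_object D Z) \<and>
     (\<forall>X A B. is_direct_sum D X A B \<longrightarrow> (X \<in> T \<longleftrightarrow> A \<in> T \<and> B \<in> T)) \<and>
     (\<forall>X \<in> T. \<forall>Y \<in> Obj D. isomorphic D X Y \<longrightarrow> Y \<in> T)"

definition functorially_finite :: "('k, 'o, 'm) kcat \<Rightarrow> 'o set \<Rightarrow> bool" where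
  "functorially_finite D T \<longleftrightarrow>
     (\<forall>Y \<in> Obj D. \<exists>X \<in> T. \<exists>f \<in> Mor D X Y.
        \<forall>X' \<in> T. \<forall>h \<in> Mor D X' Y. \<exists>h' \<in> Mor D X' X. f \<cdot>\<^bsub>D\<^esub> h' = h) \<and>
     (\<forall>Y \<in> Obj D. \<exists>X \<in> T. \<exists>f \<in> Mor D Y X.
        \<forall>X' \<in> T. \<forall>h \<in> Mor D Y X'. \<exists>h' \<in> Mor D X X'. h' \<cdot>\<^bsub>D\<^esub> f = h)"

definition rigid :: "('k, 'o, 'm) kcat \<Rightarrow> 'o set \<Rightarrow> 'o set \<Rightarrow> bool" where
  "rigid D C T \<longleftrightarrow> (\<forall>X \<in> T. \<forall>Y \<in> T. Ext1_vanishes D C X Y)"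

definition cluster_tilting :: "('k, 'o, 'm) kcat \<Rightarrow> 'o set \<Rightarrow> 'o set \<Rightarrow> bool" where
  "cluster_tilting D C T \<longleftrightarrow> functorially_finite (full_subcat D C) T \<and>
     T = {X \<in> C. \<forall>Y \<in> T. Ext1_vanishes D C Y X} \<and>
     T = {X \<in> C. \<forall>Y \<in> T. Ext1_vanishes D C X Y}"


section \<open>Projective dimension in an abelian category\<close>

definition projective_object :: "('k, 'o, 'm) kcat \<Rightarrow> 'o \<Rightarrow> bool" where
  "projective_object A P \<longleftrightarrow> P \<in> Obj A \<and>
     (\<forall>X Y g. is_epi A X Y g \<longrightarrow> (\<forall>h \<in> Mor A P Y. \<exists>h' \<in> Mor A P X. g \<cdot>\<^bsub>A\<^esub> h' = h))"

text \<open>Exactness of \<open>X \<rightarrow> Y \<rightarrow> Z\<close> at \<open>Y\<close>: \<open>f\<close> factors as an epimorphism onto the kernel of \<open>g\<close>.\<close>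

definition exact_at :: "('k, 'o, 'm) kcat \<Rightarrow> 'o \<Rightarrow> 'o \<Rightarrow> 'o \<Rightarrow> 'm \<Rightarrow> 'm \<Rightarrow> bool" where
  "exact_at A X Y Z f g \<longleftrightarrow>
     (\<exists>W k e. is_kernel A W Y Z k g \<and> is_epi A X W e \<and> f = k \<cdot>\<^bsub>A\<^esub> e)"

definition projective_resolution ::
    "('k, 'o, 'm) kcat \<Rightarrow> 'o \<Rightarrow> (nat \<Rightarrow> 'o) \<Rightarrow> (nat \<Rightarrow> 'm) \<Rightarrow> 'm \<Rightarrow> bool" where
  "projective_resolution A X P d \<epsilon> \<longleftrightarrow>
     (\<forall>n. projective_object A (P n)) \<and>
     is_epi A (P 0) X \<epsilon> \<and>
     exact_at A (P (Suc 0)) (P 0) X (d 0) \<epsilon> \<and>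
     (\<forall>n. exact_at A (P (Suc (Suc n))) (P (Suc n)) (P n) (d (Suc n)) (d n))"

definition proj_dim :: "('k, 'o, 'm) kcat \<Rightarrow> 'o \<Rightarrow> enat" where
  "proj_dim A X = Inf {enat n | n. \<exists>P d \<epsilon>. projective_resolution A X P d \<epsilon> \<and>
     (\<forall>i > n. zero_object A (P i))}"


section \<open>Finitely presented functors\<close>

record ('k, 'o, 'm, 'v) kfunctor =
  FOb :: "'o \<Rightarrow> ('k, 'v) module"
  FMap :: "'o \<Rightarrow> 'o \<Rightarrow> 'm \<Rightarrow> 'v \<Rightarrow> 'v"

text \<open>Covariant \<open>K\<close>-linear functors from \<open>T\<close> to finite-dimensional vector spaces.\<close>

definition is_functor ::
    "('k, 'c) ring_scheme \<Rightarrow> ('k, 'o, 'm) kcat \<Rightarrow> ('k, 'o, 'm, 'v) kfunctor \<Rightarrow> bool" where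
  "is_functor K T F \<longleftrightarrow>
     (\<forall>X \<in> Obj T. vectorspace K (FOb F X) \<and> vectorspace.fin_dim K (FOb F X)) \<and>
     (\<forall>X \<in> Obj T. \<forall>Y \<in> Obj T. \<forall>f \<in> Mor T X Y. linear_map K (FOb F X) (FOb F Y) (FMap F X Y f)) \<and>
     (\<forall>X \<in> Obj T. \<forall>v \<in> carrier (FOb F X). FMap F X X (Idn T X) v = v) \<and>
     (\<forall>X \<in> Obj T. \<forall>Y \<in> Obj T. \<forall>Z \<in> Obj T. \<forall>f \<in> Mor T X Y. \<forall>g \<in> Mor T Y Z.
        \<forall>v \<in> carrier (FOb F X). FMap F X Z (g \<cdot>\<^bsub>T\<^esub> f) v = FMap F Y Z g (FMap F X Y f v)) \<and>
     (\<forall>X \<in> Obj T. \<forall>Y \<in> Obj T. \<forall>f \<in> Mor T X Y. \<forall>g \<in> Mor T X Y. \<forall>v \<in> carrier (FOb F X).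
        FMap F X Y (f \<oplus>\<^bsub>Hom T X Y\<^esub> g) v = FMap F X Y f v \<oplus>\<^bsub>FOb F Y\<^esub> FMap F X Y g v) \<and>
     (\<forall>X \<in> Obj T. \<forall>Y \<in> Obj T. \<forall>c \<in> carrier K. \<forall>f \<in> Mor T X Y. \<forall>v \<in> carrier (FOb F X).
        FMap F X Y (c \<odot>\<^bsub>Hom T X Y\<^esub> f) v = c \<odot>\<^bsub>FOb F Y\<^esub> FMap F X Y f v)"

definition nat_trans ::
    "('k, 'c) ring_scheme \<Rightarrow> ('k, 'o, 'm) kcat \<Rightarrow> ('k, 'o, 'm, 'v) kfunctor \<Rightarrow>
      ('k, 'o, 'm, 'w) kfunctor \<Rightarrow> ('o \<Rightarrow> 'v \<Rightarrow> 'w) \<Rightarrow> bool" where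
  "nat_trans K T F G \<eta> \<longleftrightarrow>
     (\<forall>X \<in> Obj T. linear_map K (FOb F X) (FOb G X) (\<eta> X)) \<and>
     (\<forall>X \<in> Obj T. \<forall>Y \<in> Obj T. \<forall>f \<in> Mor T X Y. \<forall>v \<in> carrier (FOb F X).
        \<eta> Y (FMap F X Y f v) = FMap G X Y f (\<eta> X v))"

definition hom_functor :: "('k, 'o, 'm) kcat \<Rightarrow> 'o \<Rightarrow> ('k, 'o, 'm, 'm) kfunctor" where
  "hom_functor T X = \<lparr>FOb = Hom T X, FMap = (\<lambda>Y Z g f. g \<cdot>\<^bsub>T\<^esub> f)\<rparr>"

text \<open>
  \<open>F\<close> is a cokernel of \<open>\<alpha> : Hom(X, -) \<rightarrow> Hom(Y, -)\<close>, with projection \<open>\<beta>\<close>; cokernels of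
  natural transformations are computed objectwise.
\<close>

definition finitely_presented ::
    "('k, 'c) ring_scheme \<Rightarrow> ('k, 'o, 'm) kcat \<Rightarrow> ('k, 'o, 'm, 'v) kfunctor \<Rightarrow> bool" where
  "finitely_presented K T F \<longleftrightarrow>
     (\<exists>X \<in> Obj T. \<exists>Y \<in> Obj T. \<exists>\<alpha> \<beta>.
        nat_trans K T (hom_functor T X) (hom_functor T Y) \<alpha> \<and>
        nat_trans K T (hom_functor T Y) F \<beta> \<and>
        (\<forall>Z \<in> Obj T. \<beta> Z ` Mor T Y Z = carrier (FOb F Z) \<and>
           {v \<in> Mor T Y Z. \<beta> Z v = \<zero>\<^bsub>FOb F Z\<^esub>} = \<alpha> Z ` Mor T X Z))"

text \<open>
  The category \<open>mod T\<close>. The values of the functors live in the type \<^typ>\<open>'m set\<close>: a cokernel of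
  \<open>Hom(X, -) \<rightarrow> Hom(Y, -)\<close> can be realised by cosets in \<open>Hom(Y, -)\<close>, so up to isomorphism
  this is no restriction (and a representable functor appears as its quotient by zero).
  A morphism is a natural transformation tagged with its domain and codomain and
  made extensional, so that equality of morphisms is equality of components.
\<close>

definition mod_hom_space ::
    "('k, 'c) ring_scheme \<Rightarrow> ('k, 'o, 'm) kcat \<Rightarrow>
      ('k, 'o, 'm, 'v) kfunctor \<Rightarrow> ('k, 'o, 'm, 'v) kfunctor \<Rightarrow>
      ('k, ('k, 'o, 'm, 'v) kfunctor \<times> ('k, 'o, 'm, 'v) kfunctor \<times> ('o \<Rightarrow> 'v \<Rightarrow> 'v)) module" where
  "mod_hom_space K T F G =
     (let z = (F, G, \<lambda>X \<in> Obj T. \<lambda>v \<in> carrier (FOb F X). \<zero>\<^bsub>FOb G X\<^esub>)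
      in \<lparr>carrier = {(F, G, \<eta>) | \<eta>. nat_trans K T F G \<eta> \<and> \<eta> \<in> extensional (Obj T) \<and>
            (\<forall>X \<in> Obj T. \<eta> X \<in> extensional (carrier (FOb F X)))},
          monoid.mult = (\<lambda>_ _. z), one = z, zero = z,
          add = (\<lambda>(_, _, \<eta>) (_, _, \<theta>). (F, G, \<lambda>X \<in> Obj T. \<lambda>v \<in> carrier (FOb F X).
            \<eta> X v \<oplus>\<^bsub>FOb G X\<^esub> \<theta> X v)),
          smult = (\<lambda>c (_, _, \<eta>). (F, G, \<lambda>X \<in> Obj T. \<lambda>v \<in> carrier (FOb F X).
            c \<odot>\<^bsub>FOb G X\<^esub> \<eta> X v))\<rparr>)"

definition mod_cat ::
    "('k, 'c) ring_scheme \<Rightarrow> ('k, 'o, 'm) kcat \<Rightarrow>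
      ('k, ('k, 'o, 'm, 'm set) kfunctor,
       ('k, 'o, 'm, 'm set) kfunctor \<times> ('k, 'o, 'm, 'm set) kfunctor \<times> ('o \<Rightarrow> 'm set \<Rightarrow> 'm set)) kcat"
  where
  "mod_cat K T =
     \<lparr>Obj = {F. is_functor K T F \<and> finitely_presented K T F},
      Hom = mod_hom_space K T,
      Idn = (\<lambda>F. (F, F, \<lambda>X \<in> Obj T. \<lambda>v \<in> carrier (FOb F X). v)),
      Comp = (\<lambda>(_, H, \<theta>) (F, _, \<eta>). (F, H, \<lambda>X \<in> Obj T. \<lambda>v \<in> carrier (FOb F X). \<theta> X (\<eta> X v)))\<rparr>"

text \<open>The (Jacobson) radical of the category \<open>T\<close>.\<close>

definition cat_radical :: "('k, 'o, 'm) kcat \<Rightarrow> 'o \<Rightarrow> 'o \<Rightarrow> 'm set" where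
  "cat_radical T X Y = {f \<in> Mor T X Y. \<forall>g \<in> Mor T Y X.
     Idn T X \<ominus>\<^bsub>Hom T X X\<^esub> (g \<cdot>\<^bsub>T\<^esub> f) \<in> Units (End_ring T X)}"

definition quot_module :: "('k, 'v) module \<Rightarrow> 'v set \<Rightarrow> ('k, 'v set) module" where
  "quot_module M N = \<lparr>carrier = a_rcosets\<^bsub>M\<^esub> N, monoid.mult = (\<lambda>_ _. N), one = N, zero = N,
     add = set_add M, smult = (\<lambda>c A. \<Union>a \<in> A. N +>\<^bsub>M\<^esub> (c \<odot>\<^bsub>M\<^esub> a))\<rparr>"

definition simple_functor :: "('k, 'o, 'm) kcat \<Rightarrow> 'o \<Rightarrow> ('k, 'o, 'm, 'm set) kfunctor" where
  "simple_functor T X =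
     \<lparr>FOb = (\<lambda>Y. quot_module (Hom T X Y) (cat_radical T X Y)),
      FMap = (\<lambda>Y Z g A. \<Union>a \<in> A. cat_radical T X Z +>\<^bsub>Hom T X Z\<^esub> (g \<cdot>\<^bsub>T\<^esub> a))\<rparr>"

definition gl_dim :: "('k, 'c) ring_scheme \<Rightarrow> ('k, 'o, 'm) kcat \<Rightarrow> enat" where
  "gl_dim K T = Sup {proj_dim (mod_cat K T) (simple_functor T X) | X. indecomposable T X}"

end

theory Submission
  imports Defs
begin

text \<open>
  For \<open>X \<in> C\<close> let \<open>R\<^sub>X\<close> be the right \<open>T\<close>-module \<open>Hom(-, X)\<close>. An injective copresentation
  \<open>0 \<rightarrow> X \<rightarrow> I \<rightarrow> J\<close> has \<open>I, J \<in> T\<close>, so \<open>R\<^sub>X\<close> is a second syzygy and \<open>Tor\<^sub>2(R\<^sub>X, S) = 0\<close> for every simple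
  functor \<open>S\<close>, as \<open>S\<close> has projective dimension at most 3. If \<open>0 \<rightarrow> L \<rightarrow> E \<rightarrow> X \<rightarrow> 0\<close> is a conflation and
  \<open>E \<rightarrow> X\<close> a right \<open>T\<close>-approximation, then \<open>Tor\<^sub>1(R\<^sub>L, S) = Tor\<^sub>2(R\<^sub>X, S) = 0\<close> for all simple \<open>S\<close>. Choosing a
  minimal approximation of \<open>L\<close>, Nakayama's lemma makes \<open>R\<^sub>L\<close> projective, that is \<open>L \<in> T\<close>. If moreover
  \<open>Ext\<^sup>1(X, T) = 0\<close>, which by the Calabi-Yau property is equivalent to \<open>Ext\<^sup>1(T, X) = 0\<close>, then the
  conflation splits and \<open>X \<in> T\<close>.

  The \<open>Tor\<close> groups are used in the form of lifting statements against a projective resolution of \<open>S\<close>, and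
  idempotents are kept unsplit, both in that resolution and in the minimal approximation.
\<close>

section \<open>Morphisms and the radical of a preadditive category\<close>

text \<open>As R_X tensored with Hom(Y, -) is Hom(Y, X), a resolution of S by summands of functors
  Hom(Y_n, -) turns Tor_n(R_X, S) into the homology at Hom(Y_n, X) of precomposition with maps u_n :
  Y_n -> Y_(n+1). Vanishing of Tor then says that a map killed by one u factors through the next,
  and no right module or tensor product has to be formed.

  The obstacle is that projective dimension is expressed by epimorphisms and kernels inside mod T,
  which say nothing about values. Kernels become objectwise by mapping representable functors into
  them, epimorphisms by realising the cokernel as a finitely presented functor.

  Nakayama's lemma concerns the kernel of an approximation E' -> L. If nu : V -> E' generates it and
  e cuts out the minimal part of E', the vanishing of Tor_1 at all simple functors gives e nu = (e
  nu) r with r in the radical of End(V), and 1 - r is invertible, so e nu = 0. The Krull-Schmidt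
  property reduces maps out of V to maps out of objects with local endomorphism ring, to which the
  simple functors belong.\<close>

definition arr :: "('k, 'o, 'm) kcat \<Rightarrow> 'o \<Rightarrow> 'o \<Rightarrow> 'm \<Rightarrow> bool" where
  "arr D X Y f \<longleftrightarrow> X \<in> Obj D \<and> Y \<in> Obj D \<and> f \<in> Mor D X Y"

text \<open>Phrased through \<open>arr\<close> rather than the ring record, so that invertibility
  can be handled with the composition laws; \<open>cat_radical\<close> and \<open>local_ring\<close>
  speak of \<open>Units\<close>, and \<open>Units_End_ring\<close> is the bridge.\<close>

definition endo_unit :: "('k, 'o, 'm) kcat \<Rightarrow> 'o \<Rightarrow> 'm \<Rightarrow> bool" where
  "endo_unit D X f \<longleftrightarrow> arr D X X f \<and>
     (\<exists>g. arr D X X g \<and> g \<cdot>\<^bsub>D\<^esub> f = Idn D X \<and> f \<cdot>\<^bsub>D\<^esub> g = Idn D X)"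

lemma Obj_full_subcat [simp]: "Obj (full_subcat D S) = S"
  and Hom_full_subcat [simp]: "Hom (full_subcat D S) = Hom D"
  and Idn_full_subcat [simp]: "Idn (full_subcat D S) = Idn D"
  and Comp_full_subcat [simp]: "Comp (full_subcat D S) = Comp D"
  by (simp_all add: full_subcat_def)

lemma full_subcat_full_subcat [simp]: "full_subcat (full_subcat D S) T = full_subcat D T"
  by (simp add: full_subcat_def)

lemma End_ring_full_subcat [simp]: "End_ring (full_subcat D S) = End_ring D"
  by (simp add: End_ring_def fun_eq_iff)

lemma cat_radical_full_subcat [simp]: "cat_radical (full_subcat D S) = cat_radical D"
  by (simp add: cat_radical_def fun_eq_iff)

lemma arrI: "\<lbrakk>f \<in> Mor D X Y; X \<in> Obj D; Y \<in> Obj D\<rbrakk> \<Longrightarrow> arr D X Y f"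
  by (simp add: arr_def)

lemma End_ring_simps [simp]:
  "carrier (End_ring D X) = Mor D X X"
  "monoid.mult (End_ring D X) = Comp D"
  "one (End_ring D X) = Idn D X"
  "zero (End_ring D X) = zero (Hom D X X)"
  "add (End_ring D X) = add (Hom D X X)"
  by (simp_all add: End_ring_def)

lemma Units_End_ring:
  "X \<in> Obj D \<Longrightarrow> f \<in> Units (End_ring D X) \<longleftrightarrow> endo_unit D X f"
  by (auto simp: Units_def endo_unit_def arr_def)

section \<open>Calculus of composition, sums and differences of morphisms\<close>

context preadditive_category
begin

lemma arr_objs: "arr D X Y f \<Longrightarrow> X \<in> Obj D" "arr D X Y f \<Longrightarrow> Y \<in> Obj D"
  by (simp_all add: arr_def)

lemma arr_mem: "arr D X Y f \<Longrightarrow> f \<in> Mor D X Y"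
  by (simp add: arr_def)

lemma arr_id: "X \<in> Obj D \<Longrightarrow> arr D X X (Idn D X)"
  by (simp add: arr_def id_closed)

lemma arr_comp: "\<lbrakk>arr D X Y f; arr D Y Z g\<rbrakk> \<Longrightarrow> arr D X Z (g \<cdot> f)"
  by (auto simp: arr_def intro: comp_closed)

lemma assoc: "\<lbrakk>arr D W X f; arr D X Y g; arr D Y Z h\<rbrakk> \<Longrightarrow> (h \<cdot> g) \<cdot> f = h \<cdot> (g \<cdot> f)"
  unfolding arr_def by (metis comp_assoc)

lemma idl: "arr D X Y f \<Longrightarrow> Idn D Y \<cdot> f = f"
  unfolding arr_def using id_left by blast

lemma idr: "arr D X Y f \<Longrightarrow> f \<cdot> Idn D X = f"
  unfolding arr_def using id_right by blast

lemma hom_ag: "arr D X Y f \<Longrightarrow> abelian_group (Hom D X Y)"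
  by (simp add: arr_def hom_abelian_group)

lemma arr_add: "\<lbrakk>arr D X Y f; arr D X Y g\<rbrakk> \<Longrightarrow> arr D X Y (f \<oplus>\<^bsub>Hom D X Y\<^esub> g)"
  using abelian_monoid.a_closed[OF abelian_group.axioms(1)[OF hom_ag]]
  by (fastforce simp: arr_def)

lemma arr_minus: "\<lbrakk>arr D X Y f; arr D X Y g\<rbrakk> \<Longrightarrow> arr D X Y (f \<ominus>\<^bsub>Hom D X Y\<^esub> g)"
  using abelian_group.minus_closed[OF hom_ag]
  by (fastforce simp: arr_def)

lemma arr_zero: "\<lbrakk>X \<in> Obj D; Y \<in> Obj D\<rbrakk> \<Longrightarrow> arr D X Y \<zero>\<^bsub>Hom D X Y\<^esub>"
  using hom_abelian_group[of X Y] by (simp add: arr_def abelian_monoid.zero_closed abelian_group_def)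

lemma comp_add_right:
  "\<lbrakk>arr D X Y f; arr D X Y f'; arr D Y Z g\<rbrakk>
    \<Longrightarrow> g \<cdot> (f \<oplus>\<^bsub>Hom D X Y\<^esub> f') = g \<cdot> f \<oplus>\<^bsub>Hom D X Z\<^esub> g \<cdot> f'"
  by (simp add: arr_def comp_distrib_right)

lemma comp_add_left:
  "\<lbrakk>arr D X Y f; arr D Y Z g; arr D Y Z g'\<rbrakk>
    \<Longrightarrow> (g \<oplus>\<^bsub>Hom D Y Z\<^esub> g') \<cdot> f = g \<cdot> f \<oplus>\<^bsub>Hom D X Z\<^esub> g' \<cdot> f"
  by (simp add: arr_def comp_distrib_left)

lemma add_zero: "arr D X Y f \<Longrightarrow> f \<oplus>\<^bsub>Hom D X Y\<^esub> \<zero>\<^bsub>Hom D X Y\<^esub> = f"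
  "arr D X Y f \<Longrightarrow> \<zero>\<^bsub>Hom D X Y\<^esub> \<oplus>\<^bsub>Hom D X Y\<^esub> f = f"
  using abelian_monoid.l_zero[OF abelian_group.axioms(1)[OF hom_ag]]
    abelian_monoid.r_zero[OF abelian_group.axioms(1)[OF hom_ag]]
  by (fastforce simp: arr_def)+

lemma add_self_imp_zero:
  assumes "arr D X Y f" "f \<oplus>\<^bsub>Hom D X Y\<^esub> f = f" shows "f = \<zero>\<^bsub>Hom D X Y\<^esub>"
proof -
  interpret H: abelian_group "Hom D X Y" using assms(1) by (rule hom_ag)
  show ?thesis using assms by (metis H.add.l_cancel_one arr_mem)
qed

lemma comp_zero_right:
  assumes X: "X \<in> Obj D" and g: "arr D Y Z g"
  shows "g \<cdot> \<zero>\<^bsub>Hom D X Y\<^esub> = \<zero>\<^bsub>Hom D X Z\<^esub>"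
proof -
  have z: "arr D X Y \<zero>\<^bsub>Hom D X Y\<^esub>" using X arr_objs(1)[OF g] by (rule arr_zero)
  show ?thesis
    using comp_add_right[OF z z g] add_zero(1)[OF z] add_self_imp_zero[OF arr_comp[OF z g]] by simp
qed

lemma comp_zero_left:
  assumes Z: "Z \<in> Obj D" and f: "arr D X Y f"
  shows "\<zero>\<^bsub>Hom D Y Z\<^esub> \<cdot> f = \<zero>\<^bsub>Hom D X Z\<^esub>"
proof -
  have z: "arr D Y Z \<zero>\<^bsub>Hom D Y Z\<^esub>" using arr_objs(2)[OF f] Z by (rule arr_zero)
  show ?thesis
    using comp_add_left[OF f z z] add_zero(1)[OF z] add_self_imp_zero[OF arr_comp[OF f z]] by simp
qed

lemma diff_add: 
  assumes "arr D X Y f" "arr D X Y g"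
  shows "(f \<ominus>\<^bsub>Hom D X Y\<^esub> g) \<oplus>\<^bsub>Hom D X Y\<^esub> g = f"
proof -
  interpret H: abelian_group "Hom D X Y" using assms(1) by (rule hom_ag)
  show ?thesis using assms[THEN arr_mem] by (simp add: H.minus_eq H.a_assoc H.l_neg)
qed

lemma diff_iff:
  assumes "arr D X Y f" "arr D X Y g" "arr D X Y h"
  shows "f \<ominus>\<^bsub>Hom D X Y\<^esub> g = h \<longleftrightarrow> f = h \<oplus>\<^bsub>Hom D X Y\<^esub> g"
proof -
  interpret H: abelian_group "Hom D X Y" using assms(1) by (rule hom_ag)
  show ?thesis using assms[THEN arr_mem] diff_add[OF assms(1,2)]
    by (metis H.add.right_cancel H.minus_closed)
qed

lemma diff_eq_zero:
  assumes "arr D X Y f" "arr D X Y g"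
  shows "f \<ominus>\<^bsub>Hom D X Y\<^esub> g = \<zero>\<^bsub>Hom D X Y\<^esub> \<longleftrightarrow> f = g"
  using diff_iff[OF assms arr_zero] add_zero(2)[OF assms(2)] assms by (simp add: arr_def)

lemma diff_zero: "arr D X Y f \<Longrightarrow> f \<ominus>\<^bsub>Hom D X Y\<^esub> \<zero>\<^bsub>Hom D X Y\<^esub> = f"
  by (simp add: diff_iff arr_zero add_zero arr_objs)

lemma diff_self: "arr D X Y f \<Longrightarrow> f \<ominus>\<^bsub>Hom D X Y\<^esub> f = \<zero>\<^bsub>Hom D X Y\<^esub>"
  by (simp add: diff_eq_zero)

lemma comp_diff_right:
  assumes "arr D X Y f" "arr D X Y f'" "arr D Y Z g"
  shows "g \<cdot> (f \<ominus>\<^bsub>Hom D X Y\<^esub> f') = g \<cdot> f \<ominus>\<^bsub>Hom D X Z\<^esub> g \<cdot> f'"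
proof -
  have "g \<cdot> f = g \<cdot> (f \<ominus>\<^bsub>Hom D X Y\<^esub> f') \<oplus>\<^bsub>Hom D X Z\<^esub> g \<cdot> f'"
    using comp_add_right[OF arr_minus[OF assms(1,2)] assms(2,3)] diff_add[OF assms(1,2)] by simp
  then show ?thesis
    using diff_iff[OF arr_comp[OF assms(1,3)] arr_comp[OF assms(2,3)] arr_comp[OF arr_minus[OF assms(1,2)] assms(3)]]
    by simp
qed

lemma comp_diff_left:
  assumes "arr D X Y f" "arr D Y Z g" "arr D Y Z g'"
  shows "(g \<ominus>\<^bsub>Hom D Y Z\<^esub> g') \<cdot> f = g \<cdot> f \<ominus>\<^bsub>Hom D X Z\<^esub> g' \<cdot> f"
proof -
  have "g \<cdot> f = (g \<ominus>\<^bsub>Hom D Y Z\<^esub> g') \<cdot> f \<oplus>\<^bsub>Hom D X Z\<^esub> g' \<cdot> f"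
    using comp_add_left[OF assms(1) arr_minus[OF assms(2,3)] assms(3)] diff_add[OF assms(2,3)] by simp
  then show ?thesis
    using diff_iff[OF arr_comp[OF assms(1,2)] arr_comp[OF assms(1,3)] arr_comp[OF assms(1) arr_minus[OF assms(2,3)]]]
    by simp
qed

lemma endo_unit_id: "X \<in> Obj D \<Longrightarrow> endo_unit D X (Idn D X)"
  unfolding endo_unit_def using arr_id idl by blast

lemma endo_unit_comp:
  assumes "endo_unit D X f" "endo_unit D X g" shows "endo_unit D X (g \<cdot> f)"
proof -
  obtain f' g' where f': "arr D X X f'" "f' \<cdot> f = Idn D X" "f \<cdot> f' = Idn D X"
    and g': "arr D X X g'" "g' \<cdot> g = Idn D X" "g \<cdot> g' = Idn D X"
    using assms by (auto simp: endo_unit_def)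
  have a: "arr D X X f" "arr D X X g" using assms by (simp_all add: endo_unit_def)
  have "(f' \<cdot> g') \<cdot> (g \<cdot> f) = f' \<cdot> ((g' \<cdot> g) \<cdot> f)"
    by (simp add: assoc[OF arr_comp[OF a(1,2)] g'(1) f'(1)] assoc[OF a(1,2) g'(1)])
  also have "\<dots> = Idn D X" by (simp add: g' f' idl[OF a(1)])
  finally have 1: "(f' \<cdot> g') \<cdot> (g \<cdot> f) = Idn D X" .
  have "(g \<cdot> f) \<cdot> (f' \<cdot> g') = g \<cdot> ((f \<cdot> f') \<cdot> g')"
    by (simp add: assoc[OF arr_comp[OF g'(1) f'(1)] a(1,2)] assoc[OF g'(1) f'(1) a(1)])
  also have "\<dots> = Idn D X" by (simp add: g' f' idl[OF g'(1)])
  finally have 2: "(g \<cdot> f) \<cdot> (f' \<cdot> g') = Idn D X" .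
  show ?thesis unfolding endo_unit_def using 1 2 arr_comp[OF a] arr_comp[OF g'(1) f'(1)] by blast
qed

text \<open>If \<open>v\<close> inverts \<open>1 - q a\<close>, then \<open>1 + a v q\<close> inverts \<open>1 - a q\<close>.\<close>

lemma endo_unit_one_minus_swap:
  assumes a: "arr D X W a" and q: "arr D W X q"
    and u: "endo_unit D X (Idn D X \<ominus>\<^bsub>Hom D X X\<^esub> q \<cdot> a)"
  shows "endo_unit D W (Idn D W \<ominus>\<^bsub>Hom D W W\<^esub> a \<cdot> q)"
proof -
  have X: "X \<in> Obj D" and W: "W \<in> Obj D" using a by (auto simp: arr_def)
  obtain v where v: "arr D X X v" "v \<cdot> (Idn D X \<ominus>\<^bsub>Hom D X X\<^esub> q \<cdot> a) = Idn D X"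
    "(Idn D X \<ominus>\<^bsub>Hom D X X\<^esub> q \<cdot> a) \<cdot> v = Idn D X"
    using u by (auto simp: endo_unit_def)
  have qa: "arr D X X (q \<cdot> a)" and aq: "arr D W W (a \<cdot> q)" using a q arr_comp by blast+
  have iX: "arr D X X (Idn D X)" and iW: "arr D W W (Idn D W)" using X W arr_id by blast+
  have vq: "arr D W X (v \<cdot> q)" and av: "arr D X W (a \<cdot> v)" using v a q arr_comp by blast+
  let ?w = "a \<cdot> (v \<cdot> q)"
  have w: "arr D W W ?w" using vq a arr_comp by blast
  interpret H: abelian_group "Hom D W W" using iW by (rule hom_ag)
  have "v = Idn D X \<oplus>\<^bsub>Hom D X X\<^esub> (q \<cdot> a) \<cdot> v"
    using v(3) comp_diff_left[OF v(1) iX qa] idl[OF v(1)] diff_iff[OF v(1) arr_comp[OF v(1) qa] iX] by simp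
  then have "?w = a \<cdot> ((Idn D X \<oplus>\<^bsub>Hom D X X\<^esub> (q \<cdot> a) \<cdot> v) \<cdot> q)" by simp
  also have "\<dots> = a \<cdot> (q \<oplus>\<^bsub>Hom D W X\<^esub> ((q \<cdot> a) \<cdot> v) \<cdot> q)"
    using comp_add_left[OF q iX arr_comp[OF v(1) qa]] idl[OF q] by simp
  also have "\<dots> = a \<cdot> q \<oplus>\<^bsub>Hom D W W\<^esub> a \<cdot> (((q \<cdot> a) \<cdot> v) \<cdot> q)"
    using comp_add_right[OF q _ a] arr_comp v(1) qa q by blast
  also have "a \<cdot> (((q \<cdot> a) \<cdot> v) \<cdot> q) = (a \<cdot> q) \<cdot> ?w"
    by (simp add: assoc[OF q v(1) qa] assoc[OF vq a q] assoc[OF w q a])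
  finally have e1: "?w = a \<cdot> q \<oplus>\<^bsub>Hom D W W\<^esub> (a \<cdot> q) \<cdot> ?w" .
  have "v = Idn D X \<oplus>\<^bsub>Hom D X X\<^esub> v \<cdot> (q \<cdot> a)"
    using v(2) comp_diff_right[OF iX qa v(1)] idr[OF v(1)] diff_iff[OF v(1) arr_comp[OF qa v(1)] iX] by simp
  then have "?w = a \<cdot> ((Idn D X \<oplus>\<^bsub>Hom D X X\<^esub> v \<cdot> (q \<cdot> a)) \<cdot> q)" by simp
  also have "\<dots> = a \<cdot> (q \<oplus>\<^bsub>Hom D W X\<^esub> (v \<cdot> (q \<cdot> a)) \<cdot> q)"
    using comp_add_left[OF q iX arr_comp[OF qa v(1)]] idl[OF q] by simp
  also have "\<dots> = a \<cdot> q \<oplus>\<^bsub>Hom D W W\<^esub> a \<cdot> ((v \<cdot> (q \<cdot> a)) \<cdot> q)"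
    using comp_add_right[OF q _ a] arr_comp v(1) qa q by blast
  also have "a \<cdot> ((v \<cdot> (q \<cdot> a)) \<cdot> q) = ?w \<cdot> (a \<cdot> q)"
    by (simp add: assoc[OF q qa v(1)] assoc[OF arr_comp[OF q a] vq a] assoc[OF aq q v(1)] assoc[OF q a q])
  finally have e2: "?w = a \<cdot> q \<oplus>\<^bsub>Hom D W W\<^esub> ?w \<cdot> (a \<cdot> q)" .
  let ?b = "Idn D W \<oplus>\<^bsub>Hom D W W\<^esub> ?w" and ?c = "Idn D W \<ominus>\<^bsub>Hom D W W\<^esub> a \<cdot> q"
  have b: "arr D W W ?b" and c: "arr D W W ?c" using w iW aq arr_add arr_minus by blast+
  have aqw: "arr D W W ((a \<cdot> q) \<cdot> ?w)" "arr D W W (?w \<cdot> (a \<cdot> q))" using aq w arr_comp by blast+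
  have "?c \<cdot> ?b = ?b \<ominus>\<^bsub>Hom D W W\<^esub> (a \<cdot> q) \<cdot> ?b"
    using comp_diff_left[OF b iW aq] idl[OF b] by simp
  also have "(a \<cdot> q) \<cdot> ?b = ?w"
    using comp_add_right[OF iW w aq] idr[OF aq] e1 by simp
  also have "?b \<ominus>\<^bsub>Hom D W W\<^esub> ?w = Idn D W" using diff_iff[OF b w iW] by simp
  finally have 1: "?c \<cdot> ?b = Idn D W" .
  have "?b \<cdot> ?c = ?b \<ominus>\<^bsub>Hom D W W\<^esub> ?b \<cdot> (a \<cdot> q)"
    using comp_diff_right[OF iW aq b] idr[OF b] by simp
  also have "?b \<cdot> (a \<cdot> q) = ?w"
    using comp_add_left[OF aq iW w] idl[OF aq] e2 by simp
  also have "?b \<ominus>\<^bsub>Hom D W W\<^esub> ?w = Idn D W" using diff_iff[OF b w iW] by simp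
  finally show ?thesis unfolding endo_unit_def using 1 b c by blast
qed

section \<open>The radical as a two-sided ideal\<close>

lemma mem_cat_radical:
  "\<lbrakk>X \<in> Obj D; Y \<in> Obj D\<rbrakk> \<Longrightarrow> f \<in> cat_radical D X Y \<longleftrightarrow>
     arr D X Y f \<and> (\<forall>g. arr D Y X g \<longrightarrow> endo_unit D X (Idn D X \<ominus>\<^bsub>Hom D X X\<^esub> g \<cdot> f))"
  by (auto simp: cat_radical_def arr_def Units_End_ring)

lemma radical_arr: "\<lbrakk>f \<in> cat_radical D X Y; X \<in> Obj D; Y \<in> Obj D\<rbrakk> \<Longrightarrow> arr D X Y f"
  by (simp add: mem_cat_radical)

text \<open>Testing \<open>h f\<close> against \<open>g\<close> amounts to testing \<open>f\<close>
  against \<open>g h\<close>.\<close>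

lemma radical_comp_left:
  assumes "f \<in> cat_radical D X Y" "arr D Y Z h" "X \<in> Obj D"
  shows "h \<cdot> f \<in> cat_radical D X Z"
proof -
  have o: "Y \<in> Obj D" "Z \<in> Obj D" using assms(2) by (auto simp: arr_def)
  have f: "arr D X Y f" using assms(1,3) o radical_arr by blast
  show ?thesis
    unfolding mem_cat_radical[OF assms(3) o(2)]
  proof (intro conjI allI impI)
    show "arr D X Z (h \<cdot> f)" using f assms(2) arr_comp by blast
    fix g assume g: "arr D Z X g"
    then have "endo_unit D X (Idn D X \<ominus>\<^bsub>Hom D X X\<^esub> (g \<cdot> h) \<cdot> f)"
      using assms o mem_cat_radical arr_comp by blast
    then show "endo_unit D X (Idn D X \<ominus>\<^bsub>Hom D X X\<^esub> g \<cdot> (h \<cdot> f))"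
      using assoc[OF f assms(2) g] by simp
  qed
qed

text \<open>The radical is defined by units at the source, and composition on the right changes the
  source from \<open>X\<close> to \<open>W\<close>. The swap between \<open>1 - q a\<close> and
  \<open>1 - a q\<close> carries the unit from one endomorphism ring to the other.\<close>

lemma radical_comp_right:
  assumes "f \<in> cat_radical D X Y" "arr D W X q" "Y \<in> Obj D"
  shows "f \<cdot> q \<in> cat_radical D W Y"
proof -
  have o: "X \<in> Obj D" "W \<in> Obj D" using assms(2) by (auto simp: arr_def)
  have f: "arr D X Y f" using assms(1,3) o radical_arr by blast
  show ?thesis
    unfolding mem_cat_radical[OF o(2) assms(3)]
  proof (intro conjI allI impI)
    show "arr D W Y (f \<cdot> q)" using f assms(2) arr_comp by blast
    fix g assume g: "arr D Y W g"
    have "endo_unit D X (Idn D X \<ominus>\<^bsub>Hom D X X\<^esub> (q \<cdot> g) \<cdot> f)"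
      using assms o g mem_cat_radical arr_comp by blast
    then have "endo_unit D X (Idn D X \<ominus>\<^bsub>Hom D X X\<^esub> q \<cdot> (g \<cdot> f))"
      using assoc[OF f g assms(2)] by simp
    then have "endo_unit D W (Idn D W \<ominus>\<^bsub>Hom D W W\<^esub> (g \<cdot> f) \<cdot> q)"
      using endo_unit_one_minus_swap arr_comp f g assms(2) by blast
    then show "endo_unit D W (Idn D W \<ominus>\<^bsub>Hom D W W\<^esub> g \<cdot> (f \<cdot> q))"
      using assoc[OF assms(2) f g] by simp
  qed
qed

lemma radical_zero:
  assumes "X \<in> Obj D" "Y \<in> Obj D" shows "\<zero>\<^bsub>Hom D X Y\<^esub> \<in> cat_radical D X Y"
  unfolding mem_cat_radical[OF assms]
  using assms by (simp add: arr_zero comp_zero_right diff_zero arr_id endo_unit_id)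

text \<open>With \<open>u = 1 - g f\<close> invertible and inverse \<open>v\<close>, the element
  \<open>1 - g (f + f')\<close> factors as \<open>u (1 - (v g) f')\<close>, a product of two
  units.\<close>

lemma radical_add:
  assumes f: "f \<in> cat_radical D X Y" and f': "f' \<in> cat_radical D X Y"
    and o: "X \<in> Obj D" "Y \<in> Obj D"
  shows "f \<oplus>\<^bsub>Hom D X Y\<^esub> f' \<in> cat_radical D X Y"
  unfolding mem_cat_radical[OF o]
proof (intro conjI allI impI)
  have a: "arr D X Y f" "arr D X Y f'" using f f' o radical_arr by blast+
  show "arr D X Y (f \<oplus>\<^bsub>Hom D X Y\<^esub> f')" using a arr_add by blast
  fix g assume g: "arr D Y X g"
  have gf: "arr D X X (g \<cdot> f)" "arr D X X (g \<cdot> f')" and i: "arr D X X (Idn D X)"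
    using g a o arr_comp arr_id by blast+
  interpret H: abelian_group "Hom D X X" using i by (rule hom_ag)
  let ?u = "Idn D X \<ominus>\<^bsub>Hom D X X\<^esub> g \<cdot> f"
  have u: "endo_unit D X ?u" using f g o mem_cat_radical by blast
  then obtain v where v: "arr D X X v" "v \<cdot> ?u = Idn D X" "?u \<cdot> v = Idn D X"
    by (auto simp: endo_unit_def)
  have ua: "arr D X X ?u" using u by (simp add: endo_unit_def)
  have u': "endo_unit D X (Idn D X \<ominus>\<^bsub>Hom D X X\<^esub> (v \<cdot> g) \<cdot> f')"
    using f' g v(1) o mem_cat_radical arr_comp by blast
  have vgf: "arr D X X ((v \<cdot> g) \<cdot> f')" using v(1) g a arr_comp by blast
  have "endo_unit D X (?u \<cdot> (Idn D X \<ominus>\<^bsub>Hom D X X\<^esub> (v \<cdot> g) \<cdot> f'))"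
    using endo_unit_comp u u' by blast
  also have "?u \<cdot> (Idn D X \<ominus>\<^bsub>Hom D X X\<^esub> (v \<cdot> g) \<cdot> f') = ?u \<ominus>\<^bsub>Hom D X X\<^esub> ?u \<cdot> ((v \<cdot> g) \<cdot> f')"
    using comp_diff_right[OF i vgf ua] idr[OF ua] by simp
  also have "?u \<cdot> ((v \<cdot> g) \<cdot> f') = g \<cdot> f'"
    by (simp add: assoc[OF a(2) g v(1)] assoc[OF gf(2) v(1) ua, symmetric] v(3) idl[OF gf(2)])
  also have "?u \<ominus>\<^bsub>Hom D X X\<^esub> g \<cdot> f' = Idn D X \<ominus>\<^bsub>Hom D X X\<^esub> (g \<cdot> f \<oplus>\<^bsub>Hom D X X\<^esub> g \<cdot> f')"
    using i gf by (simp add: H.minus_eq arr_def H.minus_add H.a_assoc)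
  also have "g \<cdot> f \<oplus>\<^bsub>Hom D X X\<^esub> g \<cdot> f' = g \<cdot> (f \<oplus>\<^bsub>Hom D X Y\<^esub> f')"
    using comp_add_right[OF a g] by simp
  finally show "endo_unit D X (Idn D X \<ominus>\<^bsub>Hom D X X\<^esub> g \<cdot> (f \<oplus>\<^bsub>Hom D X Y\<^esub> f'))" .
qed

text \<open>The algebraic core of Nakayama's lemma: \<open>n (1 - r) = 0\<close>, and
  \<open>1 - r\<close> is invertible because \<open>r\<close> may be tested against the
  identity.\<close>

lemma radical_endo_cancel:
  assumes r: "r \<in> cat_radical D V V" and V: "V \<in> Obj D" and n: "arr D V W n" and e: "n = n \<cdot> r"
  shows "n = \<zero>\<^bsub>Hom D V W\<^esub>"
proof -
  have i: "arr D V V (Idn D V)" using V arr_id by blast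
  have ra: "arr D V V r" using r V radical_arr by blast
  have W: "W \<in> Obj D" using n by (simp add: arr_def)
  let ?u = "Idn D V \<ominus>\<^bsub>Hom D V V\<^esub> r"
  have "endo_unit D V (Idn D V \<ominus>\<^bsub>Hom D V V\<^esub> Idn D V \<cdot> r)"
    using r i V mem_cat_radical by blast
  then obtain v where ua: "arr D V V ?u" and v: "arr D V V v" "?u \<cdot> v = Idn D V"
    using idl[OF ra] by (auto simp: endo_unit_def)
  have "n \<cdot> ?u = \<zero>\<^bsub>Hom D V W\<^esub>"
    using comp_diff_right[OF i ra n] idr[OF n] e diff_self[OF n] by simp
  then show ?thesis
    using assoc[OF v(1) ua n] v idr[OF n] comp_zero_left[OF W v(1)] by simp
qed

end

section \<open>Quotients of vector spaces\<close>

locale quotient_space = vectorspace K V for K (structure) and V :: "('k, 'v) module" +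
  fixes N :: "'v set"
  assumes submod: "submodule K N V"
begin

lemma N_carrier: "a \<in> N \<Longrightarrow> a \<in> carrier V"
  using submodule.subset[OF submod] by blast

lemma N_add: "\<lbrakk>a \<in> N; b \<in> N\<rbrakk> \<Longrightarrow> a \<oplus>\<^bsub>V\<^esub> b \<in> N"
  using submodule.m_closed[OF submod] by blast

lemma N_zero: "\<zero>\<^bsub>V\<^esub> \<in> N"
  using submodule.zero_closed[OF submod] .

lemma N_smult: "\<lbrakk>c \<in> carrier K; a \<in> N\<rbrakk> \<Longrightarrow> c \<odot>\<^bsub>V\<^esub> a \<in> N"
  using submodule.smult_closed[OF submod] by blast

lemma N_inv: "a \<in> N \<Longrightarrow> \<ominus>\<^bsub>V\<^esub> a \<in> N"
  using N_smult[of "\<ominus>\<^bsub>K\<^esub> \<one>\<^bsub>K\<^esub>" a] N_carrier[of a]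
  by (metis R.add.inv_closed R.one_closed smult_l_minus smult_one)

sublocale N: abelian_subgroup N V
  by (rule abelian_subgroupI3, rule additive_subgroup.intro, rule subgroup.intro)
    (use N_carrier N_add N_zero N_inv in \<open>auto simp: a_inv_def[symmetric] intro: M.abelian_group_axioms\<close>)

abbreviation coset :: "'v \<Rightarrow> 'v set" where "coset a \<equiv> N +>\<^bsub>V\<^esub> a"

lemma coset_eq_iff:
  assumes "a \<in> carrier V" "b \<in> carrier V"
  shows "coset a = coset b \<longleftrightarrow> a \<ominus>\<^bsub>V\<^esub> b \<in> N"
  by (metis M.a_repr_independence N.a_rcos_self N.a_rcos_module N.a_subgroup assms M.minus_eq)

lemma coset_zero: "coset \<zero>\<^bsub>V\<^esub> = N"
  by (meson M.a_coset_join2 N.a_subgroup N_zero M.zero_closed)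

lemma coset_eq_N: "a \<in> carrier V \<Longrightarrow> coset a = N \<longleftrightarrow> a \<in> N"
  by (metis M.a_coset_join1 M.a_coset_join2 N.a_subgroup)

lemma coset_mem: "\<lbrakk>a \<in> carrier V; x \<in> coset a\<rbrakk> \<Longrightarrow> x \<in> carrier V \<and> coset x = coset a"
  by (metis N.a_elemrcos_carrier M.a_repr_independence N.a_subgroup)

lemma self_in_coset: "a \<in> carrier V \<Longrightarrow> a \<in> coset a"
  by (rule N.a_rcos_self)

lemma quot_carrier: "carrier (quot_module V N) = coset ` carrier V"
  by (auto simp: quot_module_def A_RCOSETS_def')

lemma quot_zero: "\<zero>\<^bsub>quot_module V N\<^esub> = coset \<zero>\<^bsub>V\<^esub>"
  by (simp add: quot_module_def coset_zero)

lemma quot_add: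
  "\<lbrakk>a \<in> carrier V; b \<in> carrier V\<rbrakk> \<Longrightarrow> coset a \<oplus>\<^bsub>quot_module V N\<^esub> coset b = coset (a \<oplus>\<^bsub>V\<^esub> b)"
  by (simp add: quot_module_def N.a_rcos_sum)

text \<open>The scalar action of \<open>quot_module\<close> and the map part of
  \<open>quotient_functor\<close> take a union over all representatives of a coset. Once the family
  is constant on the coset, which is nonempty, the union collapses to the common value.\<close>

lemma coset_UN:
  assumes a: "a \<in> carrier V" and f: "\<And>x. \<lbrakk>x \<in> carrier V; coset x = coset a\<rbrakk> \<Longrightarrow> F x = F a"
  shows "(\<Union>x \<in> coset a. F x) = F a"
  using coset_mem[OF a] self_in_coset[OF a] f by blast

lemma quot_smult:
  assumes "c \<in> carrier K" "a \<in> carrier V"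
  shows "c \<odot>\<^bsub>quot_module V N\<^esub> coset a = coset (c \<odot>\<^bsub>V\<^esub> a)"
proof -
  have "coset (c \<odot>\<^bsub>V\<^esub> x) = coset (c \<odot>\<^bsub>V\<^esub> a)" if x: "x \<in> carrier V" "coset x = coset a" for x
  proof -
    have "x \<ominus>\<^bsub>V\<^esub> a \<in> N" using x assms coset_eq_iff by blast
    then have "c \<odot>\<^bsub>V\<^esub> (x \<ominus>\<^bsub>V\<^esub> a) \<in> N" using assms N_smult by blast
    also have "c \<odot>\<^bsub>V\<^esub> (x \<ominus>\<^bsub>V\<^esub> a) = c \<odot>\<^bsub>V\<^esub> x \<ominus>\<^bsub>V\<^esub> c \<odot>\<^bsub>V\<^esub> a"
      using x assms by (simp add: M.minus_eq smult_r_distr smult_r_minus)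
    finally show ?thesis using x assms coset_eq_iff by simp
  qed
  then show ?thesis using coset_UN[OF assms(2), of "\<lambda>x. coset (c \<odot>\<^bsub>V\<^esub> x)"]
    by (simp add: quot_module_def)
qed

lemma quot_vectorspace: "vectorspace K (quot_module V N)"
proof -
  let ?Q = "quot_module V N"
  have ag: "abelian_group ?Q"
  proof (rule abelian_groupI)
    fix A B C assume ABC: "A \<in> carrier ?Q" "B \<in> carrier ?Q" "C \<in> carrier ?Q"
    then obtain a b c where "A = coset a" "B = coset b" "C = coset c"
      "a \<in> carrier V" "b \<in> carrier V" "c \<in> carrier V" by (auto simp: quot_carrier)
    then show "A \<oplus>\<^bsub>?Q\<^esub> B \<oplus>\<^bsub>?Q\<^esub> C = A \<oplus>\<^bsub>?Q\<^esub> (B \<oplus>\<^bsub>?Q\<^esub> C)"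
      by (simp add: quot_add M.a_assoc)
  next
    fix A B assume "A \<in> carrier ?Q" "B \<in> carrier ?Q"
    then obtain a b where "A = coset a" "B = coset b" "a \<in> carrier V" "b \<in> carrier V"
      by (auto simp: quot_carrier)
    then show "A \<oplus>\<^bsub>?Q\<^esub> B \<in> carrier ?Q" "A \<oplus>\<^bsub>?Q\<^esub> B = B \<oplus>\<^bsub>?Q\<^esub> A"
      by (auto simp: quot_add quot_carrier M.a_comm)
  next
    show "\<zero>\<^bsub>?Q\<^esub> \<in> carrier ?Q" by (auto simp: quot_carrier quot_zero)
  next
    fix A assume "A \<in> carrier ?Q"
    then obtain a where a: "A = coset a" "a \<in> carrier V" by (auto simp: quot_carrier)
    then show "\<zero>\<^bsub>?Q\<^esub> \<oplus>\<^bsub>?Q\<^esub> A = A" by (simp add: quot_zero quot_add)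
    have "coset (\<ominus>\<^bsub>V\<^esub> a) \<oplus>\<^bsub>?Q\<^esub> A = \<zero>\<^bsub>?Q\<^esub>" using a by (simp add: quot_zero quot_add M.l_neg)
    then show "\<exists>y\<in>carrier ?Q. y \<oplus>\<^bsub>?Q\<^esub> A = \<zero>\<^bsub>?Q\<^esub>" using a by (auto simp: quot_carrier)
  qed
  have "Module.module K ?Q"
  proof (rule Module.module.intro[OF R.is_cring ag], unfold_locales)
    fix c d A B
    assume "c \<in> carrier K" "d \<in> carrier K" "A \<in> carrier ?Q" "B \<in> carrier ?Q"
    then obtain a b where "c \<in> carrier K" "d \<in> carrier K" "A = coset a" "B = coset b"
      "a \<in> carrier V" "b \<in> carrier V" by (auto simp: quot_carrier)
    then show "c \<odot>\<^bsub>?Q\<^esub> A \<in> carrier ?Q" "(c \<oplus> d) \<odot>\<^bsub>?Q\<^esub> A = c \<odot>\<^bsub>?Q\<^esub> A \<oplus>\<^bsub>?Q\<^esub> d \<odot>\<^bsub>?Q\<^esub> A"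
      "c \<odot>\<^bsub>?Q\<^esub> (A \<oplus>\<^bsub>?Q\<^esub> B) = c \<odot>\<^bsub>?Q\<^esub> A \<oplus>\<^bsub>?Q\<^esub> c \<odot>\<^bsub>?Q\<^esub> B"
      "(c \<otimes> d) \<odot>\<^bsub>?Q\<^esub> A = c \<odot>\<^bsub>?Q\<^esub> (d \<odot>\<^bsub>?Q\<^esub> A)"
      by (auto simp: quot_smult quot_add quot_carrier smult_l_distr smult_r_distr smult_assoc1)
  next
    fix A assume "A \<in> carrier ?Q"
    then show "\<one> \<odot>\<^bsub>?Q\<^esub> A = A" by (auto simp: quot_carrier quot_smult)
  qed
  then show ?thesis by (simp add: vectorspace_def field_axioms)
qed

lemma coset_linear: "linear_map K V (quot_module V N) coset"
  unfolding linear_map_def mod_hom_def mod_hom_axioms_def LinearCombinations.module_hom_def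
  using quot_vectorspace vectorspace_axioms
  by (auto simp: vectorspace_def quot_carrier quot_add quot_smult)

lemma quot_fin_dim:
  assumes "fin_dim" shows "vectorspace.fin_dim K (quot_module V N)"
  using linear_map.surj_fin_dim[OF coset_linear assms] by (simp add: quot_carrier)

end

lemma linear_mapI:
  assumes "vectorspace K V" "vectorspace K W"
    and "\<And>v. v \<in> carrier V \<Longrightarrow> f v \<in> carrier W"
    and "\<And>v w. \<lbrakk>v \<in> carrier V; w \<in> carrier V\<rbrakk> \<Longrightarrow> f (v \<oplus>\<^bsub>V\<^esub> w) = f v \<oplus>\<^bsub>W\<^esub> f w"
    and "\<And>c v. \<lbrakk>c \<in> carrier K; v \<in> carrier V\<rbrakk> \<Longrightarrow> f (c \<odot>\<^bsub>V\<^esub> v) = c \<odot>\<^bsub>W\<^esub> f v"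
  shows "linear_map K V W f"
  using assms unfolding linear_map_def mod_hom_def mod_hom_axioms_def LinearCombinations.module_hom_def
  by (auto simp: vectorspace_def)

lemma linear_mapD:
  assumes "linear_map K V W f"
  shows "v \<in> carrier V \<Longrightarrow> f v \<in> carrier W"
    and "\<lbrakk>v \<in> carrier V; w \<in> carrier V\<rbrakk> \<Longrightarrow> f (v \<oplus>\<^bsub>V\<^esub> w) = f v \<oplus>\<^bsub>W\<^esub> f w"
    and "\<lbrakk>c \<in> carrier K; v \<in> carrier V\<rbrakk> \<Longrightarrow> f (c \<odot>\<^bsub>V\<^esub> v) = c \<odot>\<^bsub>W\<^esub> f v"
    and "f \<zero>\<^bsub>V\<^esub> = \<zero>\<^bsub>W\<^esub>"
    and "vectorspace K V" and "vectorspace K W"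
  using assms mod_hom.f0_is_0[of K V W f]
  unfolding linear_map_def mod_hom_def mod_hom_axioms_def LinearCombinations.module_hom_def
  by (auto simp: vectorspace_def)

text \<open>The growth step of the counting argument in \<open>minimal_idempotent\<close>.\<close>

lemma (in vectorspace) insert_lin_indpt:
  assumes "S \<subseteq> carrier V" "lin_indpt S" "x \<in> carrier V" "x \<notin> span S"
  shows "lin_indpt (insert x S)"
  using assms lin_dep_iff_in_span by (metis Un_insert_right sup_bot_right span_mem)

section \<open>Functors on a Hom-finite category\<close>

definition app :: "'f \<times> 'g \<times> ('o \<Rightarrow> 'v \<Rightarrow> 'w) \<Rightarrow> 'o \<Rightarrow> 'v \<Rightarrow> 'w" where
  "app m = snd (snd m)"

text \<open>Components are cut off outside the objects and the carriers, since
  \<open>mod_hom_space\<close> admits only extensional families.\<close>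

definition mk_mor :: "('k, 'o, 'm) kcat \<Rightarrow> ('k, 'o, 'm, 'v) kfunctor \<Rightarrow> ('k, 'o, 'm, 'v) kfunctor \<Rightarrow>
    ('o \<Rightarrow> 'v \<Rightarrow> 'v) \<Rightarrow> ('k, 'o, 'm, 'v) kfunctor \<times> ('k, 'o, 'm, 'v) kfunctor \<times> ('o \<Rightarrow> 'v \<Rightarrow> 'v)" where
  "mk_mor A F G \<eta> = (F, G, \<lambda>X \<in> Obj A. \<lambda>v \<in> carrier (FOb F X). \<eta> X v)"

text \<open>One construction for all functors of interest: \<open>N\<close> is the radical for
  simple functors, zero for representables, and the image of a map of representables for
  cokernels.\<close>

definition quotient_functor ::
    "('k, 'o, 'm) kcat \<Rightarrow> 'o \<Rightarrow> ('o \<Rightarrow> 'm set) \<Rightarrow> ('k, 'o, 'm, 'm set) kfunctor" where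
  "quotient_functor A Y N =
     \<lparr>FOb = (\<lambda>V. quot_module (Hom A Y V) (N V)),
      FMap = (\<lambda>V W g S. \<Union>a \<in> S. N W +>\<^bsub>Hom A Y W\<^esub> (g \<cdot>\<^bsub>A\<^esub> a))\<rparr>"

lemma simple_functor_eq: "simple_functor A X = quotient_functor A X (cat_radical A X)"
  by (simp add: simple_functor_def quotient_functor_def)

text \<open>Hom(V, -) with each morphism replaced by its coset modulo zero, because the functors in
  \<open>mod_cat\<close> take values in sets of morphisms.\<close>

abbreviation representable :: "('k, 'o, 'm) kcat \<Rightarrow> 'o \<Rightarrow> ('k, 'o, 'm, 'm set) kfunctor" where
  "representable A V \<equiv> quotient_functor A V (\<lambda>W. {\<zero>\<^bsub>Hom A V W\<^esub>})"

locale hom_finite_category = K_linear_category +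
  assumes hom_finite: "hom_finite K D"

lemma is_functorD:
  assumes "is_functor K A F"
  shows functor_vs: "X \<in> Obj A \<Longrightarrow> vectorspace K (FOb F X)"
    and functor_lin: "arr A X Y f \<Longrightarrow> linear_map K (FOb F X) (FOb F Y) (FMap F X Y f)"
    and functor_id: "\<lbrakk>X \<in> Obj A; v \<in> carrier (FOb F X)\<rbrakk> \<Longrightarrow> FMap F X X (Idn A X) v = v"
    and functor_comp: "\<lbrakk>arr A X Y f; arr A Y Z g; v \<in> carrier (FOb F X)\<rbrakk>
        \<Longrightarrow> FMap F X Z (g \<cdot>\<^bsub>A\<^esub> f) v = FMap F Y Z g (FMap F X Y f v)"
    and functor_add: "\<lbrakk>arr A X Y f; arr A X Y g; v \<in> carrier (FOb F X)\<rbrakk>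
        \<Longrightarrow> FMap F X Y (f \<oplus>\<^bsub>Hom A X Y\<^esub> g) v = FMap F X Y f v \<oplus>\<^bsub>FOb F Y\<^esub> FMap F X Y g v"
    and functor_smult: "\<lbrakk>c \<in> carrier K; arr A X Y f; v \<in> carrier (FOb F X)\<rbrakk>
        \<Longrightarrow> FMap F X Y (c \<odot>\<^bsub>Hom A X Y\<^esub> f) v = c \<odot>\<^bsub>FOb F Y\<^esub> FMap F X Y f v"
  using assms by (unfold is_functor_def arr_def; elim conjE; simp)+

lemma functor_closed:
  "\<lbrakk>is_functor K A F; arr A X Y f; v \<in> carrier (FOb F X)\<rbrakk> \<Longrightarrow> FMap F X Y f v \<in> carrier (FOb F Y)"
  using linear_mapD(1)[OF functor_lin] by fast

lemma nat_transD:
  assumes "nat_trans K A F G \<eta>"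
  shows nat_trans_lin: "X \<in> Obj A \<Longrightarrow> linear_map K (FOb F X) (FOb G X) (\<eta> X)"
    and nat_trans_natural: "\<lbrakk>arr A X Y f; v \<in> carrier (FOb F X)\<rbrakk>
        \<Longrightarrow> \<eta> Y (FMap F X Y f v) = FMap G X Y f (\<eta> X v)"
  using assms unfolding nat_trans_def arr_def by blast+

lemma vectorspace_add_zero:
  assumes "vectorspace K V"
  shows "\<zero>\<^bsub>V\<^esub> \<in> carrier V"
    and "v \<in> carrier V \<Longrightarrow> \<zero>\<^bsub>V\<^esub> \<oplus>\<^bsub>V\<^esub> v = v"
    and "v \<in> carrier V \<Longrightarrow> v \<oplus>\<^bsub>V\<^esub> \<zero>\<^bsub>V\<^esub> = v"
    and "c \<in> carrier K \<Longrightarrow> c \<odot>\<^bsub>V\<^esub> \<zero>\<^bsub>V\<^esub> = \<zero>\<^bsub>V\<^esub>"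
proof -
  interpret vectorspace K V by fact
  show "\<zero>\<^bsub>V\<^esub> \<in> carrier V" "v \<in> carrier V \<Longrightarrow> \<zero>\<^bsub>V\<^esub> \<oplus>\<^bsub>V\<^esub> v = v"
    "v \<in> carrier V \<Longrightarrow> v \<oplus>\<^bsub>V\<^esub> \<zero>\<^bsub>V\<^esub> = v" "c \<in> carrier K \<Longrightarrow> c \<odot>\<^bsub>V\<^esub> \<zero>\<^bsub>V\<^esub> = \<zero>\<^bsub>V\<^esub>"
    by simp_all
qed

lemma zero_linear_map:
  assumes "vectorspace K V" "vectorspace K W"
  shows "linear_map K V W (\<lambda>_. \<zero>\<^bsub>W\<^esub>)"
  by (rule linear_mapI)
    (simp_all add: assms vectorspace_add_zero[OF assms(2)] vectorspace_add_zero(2)[OF assms(2) vectorspace_add_zero(1)[OF assms(2)]])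

lemma mor_mod_catE:
  assumes "m \<in> Mor (mod_cat K A) F G"
  shows "m = (F, G, app m)" "nat_trans K A F G (app m)" "app m \<in> extensional (Obj A)"
    and "X \<in> Obj A \<Longrightarrow> app m X \<in> extensional (carrier (FOb F X))"
  using assms by (auto simp: mod_cat_def mod_hom_space_def Let_def app_def)

lemma Obj_mod_cat: "Obj (mod_cat K A) = {F. is_functor K A F \<and> finitely_presented K A F}"
  by (simp add: mod_cat_def)

lemma mor_mod_cat_eqI:
  assumes "m \<in> Mor (mod_cat K A) F G" "m' \<in> Mor (mod_cat K A) F G"
    and "\<And>X v. \<lbrakk>X \<in> Obj A; v \<in> carrier (FOb F X)\<rbrakk> \<Longrightarrow> app m X v = app m' X v"
  shows "m = m'"
proof -
  note a = mor_mod_catE[OF assms(1)] and b = mor_mod_catE[OF assms(2)]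
  have "app m X = app m' X" if "X \<in> Obj A" for X
    using extensionalityI[OF a(4)[OF that] b(4)[OF that]] assms(3)[OF that] by blast
  then have "app m = app m'" using extensionalityI[OF a(3) b(3)] by blast
  then show ?thesis using a(1) b(1) by metis
qed

lemma app_comp:
  assumes "m \<in> Mor (mod_cat K A) F G" "n \<in> Mor (mod_cat K A) G H"
    and "X \<in> Obj A" "v \<in> carrier (FOb F X)"
  shows "app (n \<cdot>\<^bsub>mod_cat K A\<^esub> m) X v = app n X (app m X v)"
  using assms mor_mod_catE(1)[OF assms(1)] mor_mod_catE(1)[OF assms(2)]
  by (subst (1 2) mor_mod_catE(1)) (auto simp: mod_cat_def app_def split: prod.splits)

lemma app_zero:
  "\<lbrakk>X \<in> Obj A; v \<in> carrier (FOb F X)\<rbrakk> \<Longrightarrow> app \<zero>\<^bsub>Hom (mod_cat K A) F G\<^esub> X v = \<zero>\<^bsub>FOb G X\<^esub>"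
  by (simp add: mod_cat_def mod_hom_space_def Let_def app_def)

lemma app_id:
  "\<lbrakk>X \<in> Obj A; v \<in> carrier (FOb F X)\<rbrakk> \<Longrightarrow> app (Idn (mod_cat K A) F) X v = v"
  by (simp add: mod_cat_def app_def)

lemma app_mk_mor:
  "\<lbrakk>X \<in> Obj A; v \<in> carrier (FOb F X)\<rbrakk> \<Longrightarrow> app (mk_mor A F G \<eta>) X v = \<eta> X v"
  by (simp add: mk_mor_def app_def)

lemma linear_map_cong:
  assumes "linear_map K V W f" "\<And>v. v \<in> carrier V \<Longrightarrow> g v = f v"
  shows "linear_map K V W g"
proof (rule linear_mapI)
  note l = linear_mapD[OF assms(1)]
  interpret vectorspace K V by (rule l(5))
  show "vectorspace K V" "vectorspace K W" by (rule l)+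
  show "\<And>v. v \<in> carrier V \<Longrightarrow> g v \<in> carrier W" using l(1) assms(2) by simp
  show "\<And>v w. \<lbrakk>v \<in> carrier V; w \<in> carrier V\<rbrakk> \<Longrightarrow> g (v \<oplus>\<^bsub>V\<^esub> w) = g v \<oplus>\<^bsub>W\<^esub> g w"
    using l(2) assms(2) by simp
  show "\<And>c v. \<lbrakk>c \<in> carrier K; v \<in> carrier V\<rbrakk> \<Longrightarrow> g (c \<odot>\<^bsub>V\<^esub> v) = c \<odot>\<^bsub>W\<^esub> g v"
    using l(3) assms(2) by simp
qed

lemma mk_mor_mem:
  assumes F: "is_functor K A F" and n: "nat_trans K A F G \<eta>"
  shows "mk_mor A F G \<eta> \<in> Mor (mod_cat K A) F G"
proof -
  have "nat_trans K A F G (\<lambda>X \<in> Obj A. \<lambda>v \<in> carrier (FOb F X). \<eta> X v)"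
    unfolding nat_trans_def
  proof (intro conjI ballI)
    fix X assume X: "X \<in> Obj A"
    show "linear_map K (FOb F X) (FOb G X) ((\<lambda>X \<in> Obj A. \<lambda>v \<in> carrier (FOb F X). \<eta> X v) X)"
      by (rule linear_map_cong[OF nat_trans_lin[OF n X]]) (simp add: X)
  next
    fix X Y f v assume a: "X \<in> Obj A" "Y \<in> Obj A" "f \<in> Mor A X Y" "v \<in> carrier (FOb F X)"
    then have "arr A X Y f" by (simp add: arr_def)
    then show "(\<lambda>X \<in> Obj A. \<lambda>v \<in> carrier (FOb F X). \<eta> X v) Y (FMap F X Y f v) =
        FMap G X Y f ((\<lambda>X \<in> Obj A. \<lambda>v \<in> carrier (FOb F X). \<eta> X v) X v)"
      using a functor_closed[OF F] nat_trans_natural[OF n] by simp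
  qed
  then show ?thesis by (auto simp: mk_mor_def mod_cat_def mod_hom_space_def Let_def)
qed

lemma zero_mem_mod_cat:
  assumes F: "is_functor K A F" and G: "is_functor K A G"
  shows "\<zero>\<^bsub>Hom (mod_cat K A) F G\<^esub> \<in> Mor (mod_cat K A) F G"
proof -
  have "nat_trans K A F G (\<lambda>X v. \<zero>\<^bsub>FOb G X\<^esub>)"
    unfolding nat_trans_def
  proof (intro conjI ballI)
    fix X assume "X \<in> Obj A"
    then show "linear_map K (FOb F X) (FOb G X) (\<lambda>v. \<zero>\<^bsub>FOb G X\<^esub>)"
      using zero_linear_map functor_vs[OF F] functor_vs[OF G] by blast
  next
    fix X Y f v assume "X \<in> Obj A" "Y \<in> Obj A" "f \<in> Mor A X Y"
    then show "\<zero>\<^bsub>FOb G Y\<^esub> = FMap G X Y f \<zero>\<^bsub>FOb G X\<^esub>"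
      using linear_mapD(4)[OF functor_lin[OF G arrI[of f A X Y]]] by simp
  qed
  from mk_mor_mem[OF F this] show ?thesis
    by (simp add: mk_mor_def mod_cat_def mod_hom_space_def Let_def)
qed

lemma id_mem_mod_cat:
  assumes F: "is_functor K A F"
  shows "Idn (mod_cat K A) F \<in> Mor (mod_cat K A) F F"
proof -
  have "nat_trans K A F F (\<lambda>X v. v)"
    unfolding nat_trans_def using functor_vs[OF F] by (auto intro!: linear_mapI)
  from mk_mor_mem[OF F this] show ?thesis by (simp add: mk_mor_def mod_cat_def)
qed

section \<open>Quotients of representable functors\<close>

context hom_finite_category
begin

lemma hom_vs: "\<lbrakk>X \<in> Obj D; Y \<in> Obj D\<rbrakk> \<Longrightarrow> vectorspace K (Hom D X Y)"
  by (rule hom_vectorspace)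

lemma hom_fin_dim: "\<lbrakk>X \<in> Obj D; Y \<in> Obj D\<rbrakk> \<Longrightarrow> vectorspace.fin_dim K (Hom D X Y)"
  using hom_finite by (simp add: hom_finite_def)

lemma arr_smult: "\<lbrakk>c \<in> carrier K; arr D X Y f\<rbrakk> \<Longrightarrow> arr D X Y (c \<odot>\<^bsub>Hom D X Y\<^esub> f)"
  using Module.module.smult_closed[of K "Hom D X Y"] hom_vs[of X Y] by (auto simp: arr_def vectorspace_def)

lemma comp_smult_r:
  "\<lbrakk>c \<in> carrier K; arr D X Y f; arr D Y Z g\<rbrakk> \<Longrightarrow> g \<cdot> (c \<odot>\<^bsub>Hom D X Y\<^esub> f) = c \<odot>\<^bsub>Hom D X Z\<^esub> (g \<cdot> f)"
  unfolding arr_def using comp_smult_right by blast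

lemma comp_smult_l:
  "\<lbrakk>c \<in> carrier K; arr D X Y f; arr D Y Z g\<rbrakk> \<Longrightarrow> (c \<odot>\<^bsub>Hom D Y Z\<^esub> g) \<cdot> f = c \<odot>\<^bsub>Hom D X Z\<^esub> (g \<cdot> f)"
  unfolding arr_def using comp_smult_left by blast

lemma functor_zero:
  assumes F: "is_functor K D F" and o: "X \<in> Obj D" "Y \<in> Obj D" and v: "v \<in> carrier (FOb F X)"
  shows "FMap F X Y \<zero>\<^bsub>Hom D X Y\<^esub> v = \<zero>\<^bsub>FOb F Y\<^esub>"
proof -
  interpret V: vectorspace K "FOb F Y" using functor_vs[OF F o(2)] .
  have z: "arr D X Y \<zero>\<^bsub>Hom D X Y\<^esub>" using o by (rule arr_zero)
  have c: "FMap F X Y \<zero>\<^bsub>Hom D X Y\<^esub> v \<in> carrier (FOb F Y)" using functor_closed[OF F z v] .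
  have "FMap F X Y \<zero>\<^bsub>Hom D X Y\<^esub> v \<oplus>\<^bsub>FOb F Y\<^esub> FMap F X Y \<zero>\<^bsub>Hom D X Y\<^esub> v = FMap F X Y \<zero>\<^bsub>Hom D X Y\<^esub> v"
    using functor_add[OF F z z v] add_zero(1)[OF z] by simp
  then show ?thesis using c V.M.add.l_cancel_one by blast
qed

definition subfunctor :: "'c \<Rightarrow> ('c \<Rightarrow> 'd set) \<Rightarrow> bool" where
  "subfunctor Y N \<longleftrightarrow> Y \<in> Obj D \<and> (\<forall>V \<in> Obj D. submodule K (N V) (Hom D Y V)) \<and>
     (\<forall>V W g n. arr D V W g \<longrightarrow> n \<in> N V \<longrightarrow> g \<cdot> n \<in> N W)"

end

lemma (in quotient_space) kernel_coset:
  "{v \<in> carrier V. coset v = \<zero>\<^bsub>quot_module V N\<^esub>} = N"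
  unfolding quot_zero coset_zero using coset_eq_N N_carrier by blast

context hom_finite_category
begin

lemma subfunctorD:
  assumes "subfunctor Y N"
  shows "Y \<in> Obj D"
    and "V \<in> Obj D \<Longrightarrow> quotient_space K (Hom D Y V) (N V)"
    and "\<lbrakk>arr D V W g; n \<in> N V\<rbrakk> \<Longrightarrow> g \<cdot> n \<in> N W"
  using assms hom_vs unfolding subfunctor_def quotient_space_def quotient_space_axioms_def by blast+

lemma quotient_functor_FOb [simp]: "FOb (quotient_functor D Y N) V = quot_module (Hom D Y V) (N V)"
  by (simp add: quotient_functor_def)

lemma coset_mem_quotient:
  assumes "subfunctor Y N" "arr D Y V a"
  shows "N V +>\<^bsub>Hom D Y V\<^esub> a \<in> carrier (quot_module (Hom D Y V) (N V))"
  using quotient_space.quot_carrier[OF subfunctorD(2)[OF assms(1)]] assms(2) by (auto simp: arr_def)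

lemma quotientE:
  assumes "subfunctor Y N" "V \<in> Obj D" "S \<in> carrier (quot_module (Hom D Y V) (N V))"
  obtains a where "arr D Y V a" "S = N V +>\<^bsub>Hom D Y V\<^esub> a"
  using quotient_space.quot_carrier[OF subfunctorD(2)[OF assms(1,2)]] assms(2,3) subfunctorD(1)[OF assms(1)]
  by (auto simp: arr_def)

lemma coset_eq:
  assumes "subfunctor Y N" "arr D Y V a" "arr D Y V b"
  shows "N V +>\<^bsub>Hom D Y V\<^esub> a = N V +>\<^bsub>Hom D Y V\<^esub> b \<longleftrightarrow> a \<ominus>\<^bsub>Hom D Y V\<^esub> b \<in> N V"
  using quotient_space.coset_eq_iff[OF subfunctorD(2)[OF assms(1)]] assms(2,3) by (auto simp: arr_def)

lemma coset_eq_zero: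
  assumes "subfunctor Y N" "arr D Y V a"
  shows "N V +>\<^bsub>Hom D Y V\<^esub> a = \<zero>\<^bsub>quot_module (Hom D Y V) (N V)\<^esub> \<longleftrightarrow> a \<in> N V"
proof -
  interpret quotient_space K "Hom D Y V" "N V"
    using subfunctorD(2)[OF assms(1)] assms(2) by (simp add: arr_def)
  show ?thesis using coset_eq_N[of a] assms(2) by (simp add: quot_zero coset_zero arr_def)
qed

text \<open>Independence of the representative: two representatives differ by an element of
  \<open>N V\<close>, which composition with \<open>g\<close> carries into
  \<open>N W\<close>.\<close>

lemma quotient_functor_FMap:
  assumes s: "subfunctor Y N" and a: "arr D Y V a" and g: "arr D V W g"
  shows "FMap (quotient_functor D Y N) V W g (N V +>\<^bsub>Hom D Y V\<^esub> a) = N W +>\<^bsub>Hom D Y W\<^esub> (g \<cdot> a)"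
proof -
  have V: "V \<in> Obj D" and W: "W \<in> Obj D" and Y: "Y \<in> Obj D" using a g by (auto simp: arr_def)
  interpret Q: quotient_space K "Hom D Y V" "N V" using subfunctorD(2)[OF s V] .
  have "N W +>\<^bsub>Hom D Y W\<^esub> (g \<cdot> x) = N W +>\<^bsub>Hom D Y W\<^esub> (g \<cdot> a)"
    if x: "x \<in> Mor D Y V" "Q.coset x = Q.coset a" for x
  proof -
    have ax: "arr D Y V x" using x V Y by (simp add: arr_def)
    have "x \<ominus>\<^bsub>Hom D Y V\<^esub> a \<in> N V" using coset_eq[OF s ax a] x(2) by simp
    then have "g \<cdot> (x \<ominus>\<^bsub>Hom D Y V\<^esub> a) \<in> N W" using subfunctorD(3)[OF s g] by blast
    then show ?thesis
      using coset_eq[OF s arr_comp[OF ax g] arr_comp[OF a g]] comp_diff_right[OF ax a g] by simp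
  qed
  then have "(\<Union>x \<in> Q.coset a. N W +>\<^bsub>Hom D Y W\<^esub> (g \<cdot> x)) = N W +>\<^bsub>Hom D Y W\<^esub> (g \<cdot> a)"
    by (rule Q.coset_UN[OF arr_mem[OF a], of "\<lambda>x. N W +>\<^bsub>Hom D Y W\<^esub> (g \<cdot> x)"])
  then show ?thesis by (simp add: quotient_functor_def)
qed

lemma coset_nat_trans:
  assumes s: "subfunctor Y N"
  shows "nat_trans K D (hom_functor D Y) (quotient_functor D Y N) (\<lambda>V a. N V +>\<^bsub>Hom D Y V\<^esub> a)"
  unfolding nat_trans_def
proof (intro conjI ballI)
  fix X assume X: "X \<in> Obj D"
  show "linear_map K (FOb (hom_functor D Y) X) (FOb (quotient_functor D Y N) X) (\<lambda>a. N X +>\<^bsub>Hom D Y X\<^esub> a)"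
    using quotient_space.coset_linear[OF subfunctorD(2)[OF s X]] by (simp add: hom_functor_def)
next
  fix V W f v assume "V \<in> Obj D" "W \<in> Obj D" "f \<in> Mor D V W" "v \<in> carrier (FOb (hom_functor D Y) V)"
  then have "arr D Y V v" "arr D V W f" using subfunctorD(1)[OF s] by (auto simp: arr_def hom_functor_def)
  then show "N W +>\<^bsub>Hom D Y W\<^esub> (FMap (hom_functor D Y) V W f v) =
      FMap (quotient_functor D Y N) V W f (N V +>\<^bsub>Hom D Y V\<^esub> v)"
    using quotient_functor_FMap[OF s] by (simp add: hom_functor_def)
qed

lemma quotient_is_functor:
  assumes s: "subfunctor Y N" shows "is_functor K D (quotient_functor D Y N)"
  unfolding is_functor_def quotient_functor_FOb
proof (intro conjI ballI)
  note Y = subfunctorD(1)[OF s]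
  fix X assume X: "X \<in> Obj D"
  show "vectorspace K (quot_module (Hom D Y X) (N X))" "vectorspace.fin_dim K (quot_module (Hom D Y X) (N X))"
    using quotient_space.quot_vectorspace[OF subfunctorD(2)[OF s X]]
      quotient_space.quot_fin_dim[OF subfunctorD(2)[OF s X] hom_fin_dim[OF Y X]] by blast+
next
  fix X v assume X: "X \<in> Obj D" and "v \<in> carrier (quot_module (Hom D Y X) (N X))"
  then obtain a where a: "arr D Y X a" "v = N X +>\<^bsub>Hom D Y X\<^esub> a" by (rule quotientE[OF s])
  then show "FMap (quotient_functor D Y N) X X (Idn D X) v = v"
    using quotient_functor_FMap[OF s a(1) arr_id[OF X]] idl[OF a(1)] by simp
next
  fix X Z W f g v assume o: "X \<in> Obj D" "Z \<in> Obj D" "W \<in> Obj D" "f \<in> Mor D X Z" "g \<in> Mor D Z W"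
    and "v \<in> carrier (quot_module (Hom D Y X) (N X))"
  then obtain a where a: "arr D Y X a" "v = N X +>\<^bsub>Hom D Y X\<^esub> a" using quotientE[OF s] by metis
  have f: "arr D X Z f" and g: "arr D Z W g" using o by (simp_all add: arr_def)
  show "FMap (quotient_functor D Y N) X W (g \<cdot> f) v =
      FMap (quotient_functor D Y N) Z W g (FMap (quotient_functor D Y N) X Z f v)"
    unfolding a(2) quotient_functor_FMap[OF s a(1) f] quotient_functor_FMap[OF s arr_comp[OF a(1) f] g]
      quotient_functor_FMap[OF s a(1) arr_comp[OF f g]] assoc[OF a(1) f g] ..
next
  fix X Z assume X: "X \<in> Obj D" and Z: "Z \<in> Obj D"
  interpret Q: quotient_space K "Hom D Y X" "N X" using subfunctorD(2)[OF s X] .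
  interpret R: quotient_space K "Hom D Y Z" "N Z" using subfunctorD(2)[OF s Z] .
  {
    fix f assume "f \<in> Mor D X Z"
    then have f: "arr D X Z f" using X Z by (simp add: arr_def)
    show "linear_map K (quot_module (Hom D Y X) (N X)) (quot_module (Hom D Y Z) (N Z))
        (FMap (quotient_functor D Y N) X Z f)"
    proof (rule linear_mapI[OF Q.quot_vectorspace R.quot_vectorspace])
      fix v w assume "v \<in> carrier (quot_module (Hom D Y X) (N X))" "w \<in> carrier (quot_module (Hom D Y X) (N X))"
      then obtain a b where a: "arr D Y X a" "v = Q.coset a" and b: "arr D Y X b" "w = Q.coset b"
        using quotientE[OF s X] by metis
      show "FMap (quotient_functor D Y N) X Z f (v \<oplus>\<^bsub>quot_module (Hom D Y X) (N X)\<^esub> w) =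
        FMap (quotient_functor D Y N) X Z f v \<oplus>\<^bsub>quot_module (Hom D Y Z) (N Z)\<^esub> FMap (quotient_functor D Y N) X Z f w"
        using a b quotient_functor_FMap[OF s _ f] comp_add_right[OF a(1) b(1) f] arr_add[OF a(1) b(1)]
          arr_mem[OF arr_comp[OF a(1) f]] arr_mem[OF arr_comp[OF b(1) f]]
        by (simp add: Q.quot_add R.quot_add arr_mem)
    next
      fix v assume "v \<in> carrier (quot_module (Hom D Y X) (N X))"
      then obtain a where a: "arr D Y X a" "v = Q.coset a" using quotientE[OF s X] by metis
      then show "FMap (quotient_functor D Y N) X Z f v \<in> carrier (quot_module (Hom D Y Z) (N Z))"
        using quotient_functor_FMap[OF s _ f] coset_mem_quotient[OF s arr_comp[OF a(1) f]] by simp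
      fix c assume c: "c \<in> carrier K"
      show "FMap (quotient_functor D Y N) X Z f (c \<odot>\<^bsub>quot_module (Hom D Y X) (N X)\<^esub> v) =
        c \<odot>\<^bsub>quot_module (Hom D Y Z) (N Z)\<^esub> FMap (quotient_functor D Y N) X Z f v"
        using a c quotient_functor_FMap[OF s _ f] comp_smult_r[OF c a(1) f] arr_smult[OF c a(1)]
          arr_mem[OF arr_comp[OF a(1) f]]
        by (simp add: Q.quot_smult R.quot_smult arr_mem)
    qed
  }
  {
    fix f g v assume fg: "f \<in> Mor D X Z" "g \<in> Mor D X Z"
      and "v \<in> carrier (quot_module (Hom D Y X) (N X))"
    then obtain a where a: "arr D Y X a" "v = Q.coset a" using quotientE[OF s X] by metis
    have f: "arr D X Z f" and g: "arr D X Z g" using fg X Z by (simp_all add: arr_def)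
    show "FMap (quotient_functor D Y N) X Z (f \<oplus>\<^bsub>Hom D X Z\<^esub> g) v =
        FMap (quotient_functor D Y N) X Z f v \<oplus>\<^bsub>quot_module (Hom D Y Z) (N Z)\<^esub> FMap (quotient_functor D Y N) X Z g v"
      using a quotient_functor_FMap[OF s a(1)] f g arr_add[OF f g] comp_add_left[OF a(1) f g]
        R.quot_add[OF arr_mem[OF arr_comp[OF a(1) f]] arr_mem[OF arr_comp[OF a(1) g]]] by simp
  }
  fix c f v assume c: "c \<in> carrier K" and fm: "f \<in> Mor D X Z"
    and "v \<in> carrier (quot_module (Hom D Y X) (N X))"
  then obtain a where a: "arr D Y X a" "v = Q.coset a" using quotientE[OF s X] by metis
  have f: "arr D X Z f" using fm X Z by (simp add: arr_def)
  show "FMap (quotient_functor D Y N) X Z (c \<odot>\<^bsub>Hom D X Z\<^esub> f) v =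
      c \<odot>\<^bsub>quot_module (Hom D Y Z) (N Z)\<^esub> FMap (quotient_functor D Y N) X Z f v"
    using a quotient_functor_FMap[OF s a(1)] f arr_smult[OF c f] comp_smult_l[OF c a(1) f]
      R.quot_smult[OF c arr_mem[OF arr_comp[OF a(1) f]]] by simp
qed

lemma precomp_nat_trans:
  assumes u: "arr D Y X u"
  shows "nat_trans K D (hom_functor D X) (hom_functor D Y) (\<lambda>V h. h \<cdot> u)"
  unfolding nat_trans_def
proof (intro conjI ballI)
  have X: "X \<in> Obj D" and Y: "Y \<in> Obj D" using u by (simp_all add: arr_def)
  fix V assume V: "V \<in> Obj D"
  show "linear_map K (FOb (hom_functor D X) V) (FOb (hom_functor D Y) V) (\<lambda>h. h \<cdot> u)"
    unfolding hom_functor_def kfunctor.simps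
  proof (rule linear_mapI[OF hom_vs[OF X V] hom_vs[OF Y V]])
    fix v w assume "v \<in> Mor D X V" "w \<in> Mor D X V"
    then have "arr D X V v" "arr D X V w" using X V by (simp_all add: arr_def)
    then show "(v \<oplus>\<^bsub>Hom D X V\<^esub> w) \<cdot> u = v \<cdot> u \<oplus>\<^bsub>Hom D Y V\<^esub> w \<cdot> u" using comp_add_left[OF u] by blast
  next
    fix v assume "v \<in> Mor D X V"
    then have v: "arr D X V v" using X V by (simp add: arr_def)
    then show "v \<cdot> u \<in> Mor D Y V" using arr_comp[OF u] arr_mem by blast
    fix c assume "c \<in> carrier K"
    then show "(c \<odot>\<^bsub>Hom D X V\<^esub> v) \<cdot> u = c \<odot>\<^bsub>Hom D Y V\<^esub> (v \<cdot> u)" using comp_smult_l[OF _ u v] by blast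
  qed
next
  fix V W f v assume "V \<in> Obj D" "W \<in> Obj D" "f \<in> Mor D V W" "v \<in> carrier (FOb (hom_functor D X) V)"
  then have "arr D V W f" "arr D X V v" using u by (auto simp: arr_def hom_functor_def)
  then show "FMap (hom_functor D X) V W f v \<cdot> u = FMap (hom_functor D Y) V W f (v \<cdot> u)"
    using assoc[OF u] by (simp add: hom_functor_def)
qed

text \<open>Precomposition with \<open>u\<close> is a map Hom(X, -) -> Hom(Y, -) and the quotient is
  its cokernel, so \<open>u\<close> itself is the presentation.\<close>

lemma quotient_by_image:
  assumes u: "arr D Y X u"
  shows "subfunctor Y (\<lambda>V. (\<lambda>h. h \<cdot> u) ` Mor D X V)" (is "subfunctor Y ?N")
    and "quotient_functor D Y (\<lambda>V. (\<lambda>h. h \<cdot> u) ` Mor D X V) \<in> Obj (mod_cat K D)"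
proof -
  have X: "X \<in> Obj D" and Y: "Y \<in> Obj D" using u by (simp_all add: arr_def)
  show s: "subfunctor Y ?N"
    unfolding subfunctor_def
  proof (intro conjI ballI allI impI Y)
    fix V assume V: "V \<in> Obj D"
    have "linear_map K (Hom D X V) (Hom D Y V) (\<lambda>h. h \<cdot> u)"
      using nat_trans_lin[OF precomp_nat_trans[OF u] V] by (simp add: hom_functor_def)
    from mod_hom.im_is_submodule[OF linear_map.axioms(3)[OF this]] show "submodule K (?N V) (Hom D Y V)"
      using mod_hom.im_def[OF linear_map.axioms(3)[OF \<open>linear_map K (Hom D X V) (Hom D Y V) (\<lambda>h. h \<cdot> u)\<close>]] by simp
  next
    fix V W g n assume g: "arr D V W g" and "n \<in> ?N V"
    then obtain h where h: "arr D X V h" "n = h \<cdot> u" using X by (auto simp: arr_def)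
    then show "g \<cdot> n \<in> ?N W" using assoc[OF u h(1) g] arr_mem[OF arr_comp[OF h(1) g]] by (metis imageI)
  qed
  have "finitely_presented K D (quotient_functor D Y ?N)"
    unfolding finitely_presented_def
  proof (rule bexI[OF _ X], rule bexI[OF _ Y], intro exI conjI ballI)
    show "nat_trans K D (hom_functor D X) (hom_functor D Y) (\<lambda>V h. h \<cdot> u)"
      by (rule precomp_nat_trans[OF u])
    show "nat_trans K D (hom_functor D Y) (quotient_functor D Y ?N) (\<lambda>V a. ?N V +>\<^bsub>Hom D Y V\<^esub> a)"
      by (rule coset_nat_trans[OF s])
    fix Z assume Z: "Z \<in> Obj D"
    interpret Q: quotient_space K "Hom D Y Z" "?N Z" using subfunctorD(2)[OF s Z] .
    show "(\<lambda>a. ?N Z +>\<^bsub>Hom D Y Z\<^esub> a) ` Mor D Y Z = carrier (FOb (quotient_functor D Y ?N) Z)"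
      by (simp add: Q.quot_carrier)
    show "{v \<in> Mor D Y Z. ?N Z +>\<^bsub>Hom D Y Z\<^esub> v = \<zero>\<^bsub>FOb (quotient_functor D Y ?N) Z\<^esub>} = ?N Z"
      using Q.kernel_coset by simp
  qed
  then show "quotient_functor D Y ?N \<in> Obj (mod_cat K D)"
    using quotient_is_functor[OF s] by (simp add: Obj_mod_cat)
qed

text \<open>The zero subfunctor is the image of precomposition with the zero endomorphism of
  \<open>V\<close>, which thus serves as a presentation of Hom(V, -).\<close>

lemma representable_mod:
  assumes V: "V \<in> Obj D"
  shows "subfunctor V (\<lambda>W. {\<zero>\<^bsub>Hom D V W\<^esub>})" and "representable D V \<in> Obj (mod_cat K D)"
proof -
  have z: "arr D V V \<zero>\<^bsub>Hom D V V\<^esub>" using V arr_zero by blast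
  \<comment> \<open>The two families are compared on objects only, so the functors they define need
    not be equal, and the presentation is verified again for the zero family.\<close>
  have e: "{\<zero>\<^bsub>Hom D V W\<^esub>} = (\<lambda>h. h \<cdot> \<zero>\<^bsub>Hom D V V\<^esub>) ` Mor D V W" if W: "W \<in> Obj D" for W
  proof -
    have "h \<cdot> \<zero>\<^bsub>Hom D V V\<^esub> = \<zero>\<^bsub>Hom D V W\<^esub>" if "h \<in> Mor D V W" for h
      using comp_zero_right[OF V] that V W by (simp add: arr_def)
    moreover have "\<zero>\<^bsub>Hom D V W\<^esub> \<in> Mor D V W" using arr_zero[OF V W] by (rule arr_mem)
    ultimately show ?thesis by (auto intro: rev_image_eqI)
  qed
  show s: "subfunctor V (\<lambda>W. {\<zero>\<^bsub>Hom D V W\<^esub>})"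
    unfolding subfunctor_def
  proof (intro conjI ballI allI impI V)
    fix W assume "W \<in> Obj D"
    then show "submodule K {\<zero>\<^bsub>Hom D V W\<^esub>} (Hom D V W)"
      using quotient_by_image(1)[OF z] e[of W] by (simp add: subfunctor_def)
  next
    fix W W' g n assume "arr D W W' g" "n \<in> {\<zero>\<^bsub>Hom D V W\<^esub>}"
    then show "g \<cdot> n \<in> {\<zero>\<^bsub>Hom D V W'\<^esub>}" using comp_zero_right[OF V] by blast
  qed
  have "finitely_presented K D (representable D V)"
    unfolding finitely_presented_def
  proof (intro bexI[OF _ V] exI conjI ballI)
    show "nat_trans K D (hom_functor D V) (hom_functor D V) (\<lambda>W h. h \<cdot> \<zero>\<^bsub>Hom D V V\<^esub>)"
      by (rule precomp_nat_trans[OF z])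
    show "nat_trans K D (hom_functor D V) (representable D V) (\<lambda>W a. {\<zero>\<^bsub>Hom D V W\<^esub>} +>\<^bsub>Hom D V W\<^esub> a)"
      by (rule coset_nat_trans[OF s])
    fix Z assume Z: "Z \<in> Obj D"
    interpret Q: quotient_space K "Hom D V Z" "{\<zero>\<^bsub>Hom D V Z\<^esub>}" using subfunctorD(2)[OF s Z] .
    show "(\<lambda>a. {\<zero>\<^bsub>Hom D V Z\<^esub>} +>\<^bsub>Hom D V Z\<^esub> a) ` Mor D V Z = carrier (FOb (representable D V) Z)"
      by (simp add: Q.quot_carrier)
    show "{v \<in> Mor D V Z. {\<zero>\<^bsub>Hom D V Z\<^esub>} +>\<^bsub>Hom D V Z\<^esub> v = \<zero>\<^bsub>FOb (representable D V) Z\<^esub>} =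
        (\<lambda>h. h \<cdot> \<zero>\<^bsub>Hom D V V\<^esub>) ` Mor D V Z"
      unfolding e[OF Z, symmetric] using Q.kernel_coset by simp
  qed
  then show "representable D V \<in> Obj (mod_cat K D)"
    using quotient_is_functor[OF s] by (simp add: Obj_mod_cat)
qed

lemma representable_coset_inj:
  assumes "arr D V W a" "arr D V W b"
    and "{\<zero>\<^bsub>Hom D V W\<^esub>} +>\<^bsub>Hom D V W\<^esub> a = {\<zero>\<^bsub>Hom D V W\<^esub>} +>\<^bsub>Hom D V W\<^esub> b"
  shows "a = b"
  using coset_eq[OF representable_mod(1)[OF arr_objs(1)[OF assms(1)]] assms(1,2)] assms diff_eq_zero by simp

end

locale additive_hom_finite_category = hom_finite_category + additive_category

lemma comp_mod_cat:
  assumes "m \<in> Mor (mod_cat K A) F G" "n \<in> Mor (mod_cat K A) G H"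
  shows "n \<cdot>\<^bsub>mod_cat K A\<^esub> m = (F, H, \<lambda>X \<in> Obj A. \<lambda>v \<in> carrier (FOb F X). app n X (app m X v))"
proof -
  obtain \<eta> \<theta> where "m = (F, G, \<eta>)" "n = (G, H, \<theta>)"
    using mor_mod_catE(1)[OF assms(1)] mor_mod_catE(1)[OF assms(2)] by blast
  then show ?thesis by (simp add: mod_cat_def app_def)
qed

lemma (in hom_finite_category) functor_diff_zero:
  assumes F: "is_functor K D F" and f: "arr D X Y f" and g: "arr D X Y g"
    and v: "v \<in> carrier (FOb F X)" and e: "FMap F X Y f v = FMap F X Y g v"
  shows "FMap F X Y (f \<ominus>\<^bsub>Hom D X Y\<^esub> g) v = \<zero>\<^bsub>FOb F Y\<^esub>"
proof -
  interpret V: vectorspace K "FOb F Y" using functor_vs[OF F arr_objs(2)[OF f]] .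
  have "FMap F X Y (f \<ominus>\<^bsub>Hom D X Y\<^esub> g) v \<oplus>\<^bsub>FOb F Y\<^esub> FMap F X Y g v = FMap F X Y g v"
    using functor_add[OF F arr_minus[OF f g] g v] diff_add[OF f g] e by simp
  then show ?thesis
    using V.M.add.l_cancel_one'[OF functor_closed[OF F g v]] functor_closed[OF F arr_minus[OF f g] v]
      V.M.add.r_cancel_one functor_closed[OF F g v] by blast
qed

section \<open>Yoneda's lemma, presentations and kernels\<close>

context hom_finite_category
begin

lemma yoneda:
  assumes F: "is_functor K D F" and V: "V \<in> Obj D" and v: "v \<in> carrier (FOb F V)"
  obtains m where "m \<in> Mor (mod_cat K D) (representable D V) F"
    and "\<And>W a. arr D V W a \<Longrightarrow> app m W ({\<zero>\<^bsub>Hom D V W\<^esub>} +>\<^bsub>Hom D V W\<^esub> a) = FMap F V W a v"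
proof -
  let ?c = "\<lambda>W a. {\<zero>\<^bsub>Hom D V W\<^esub>} +>\<^bsub>Hom D V W\<^esub> a"
  let ?Q = "\<lambda>W. quot_module (Hom D V W) {\<zero>\<^bsub>Hom D V W\<^esub>}"
  \<comment> \<open>Cosets modulo zero have a unique representative among the maps
    \<open>V -> W\<close>, so the choice is forced.\<close>
  define \<eta> where "\<eta> W S = FMap F V W (SOME a. arr D V W a \<and> S = ?c W a) v" for W S
  note s = representable_mod(1)[OF V]
  have \<eta>: "\<eta> W (?c W a) = FMap F V W a v" if a: "arr D V W a" for W a
  proof -
    have "(SOME a'. arr D V W a' \<and> ?c W a = ?c W a') = a"
      using a representable_coset_inj by (intro some_equality) blast+
    then show ?thesis by (simp add: \<eta>_def)
  qed
  have nt: "nat_trans K D (representable D V) F \<eta>"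
    unfolding nat_trans_def quotient_functor_FOb
  proof (intro conjI ballI)
    fix W assume W: "W \<in> Obj D"
    interpret Q: quotient_space K "Hom D V W" "{\<zero>\<^bsub>Hom D V W\<^esub>}" using subfunctorD(2)[OF s W] .
    show "linear_map K (?Q W) (FOb F W) (\<eta> W)"
    proof (rule linear_mapI[OF Q.quot_vectorspace functor_vs[OF F W]])
      fix S R assume "S \<in> carrier (?Q W)" "R \<in> carrier (?Q W)"
      then obtain a b where a: "arr D V W a" "S = ?c W a" and b: "arr D V W b" "R = ?c W b"
        using quotientE[OF s W] by metis
      show "\<eta> W (S \<oplus>\<^bsub>?Q W\<^esub> R) = \<eta> W S \<oplus>\<^bsub>FOb F W\<^esub> \<eta> W R"
        using a b \<eta> functor_add[OF F a(1) b(1) v] arr_add[OF a(1) b(1)] by (simp add: Q.quot_add arr_mem)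
    next
      fix S assume "S \<in> carrier (?Q W)"
      then obtain a where a: "arr D V W a" "S = ?c W a" using quotientE[OF s W] by metis
      then show "\<eta> W S \<in> carrier (FOb F W)" using \<eta> functor_closed[OF F a(1) v] by simp
      fix c assume c: "c \<in> carrier K"
      show "\<eta> W (c \<odot>\<^bsub>?Q W\<^esub> S) = c \<odot>\<^bsub>FOb F W\<^esub> \<eta> W S"
        using a \<eta> functor_smult[OF F c a(1) v] arr_smult[OF c a(1)] c by (simp add: Q.quot_smult arr_mem)
    qed
  next
    fix X Y f S assume o: "X \<in> Obj D" "Y \<in> Obj D" "f \<in> Mor D X Y" "S \<in> carrier (?Q X)"
    then obtain a where a: "arr D V X a" "S = ?c X a" using quotientE[OF s] by metis
    have f: "arr D X Y f" using o by (simp add: arr_def)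
    show "\<eta> Y (FMap (representable D V) X Y f S) = FMap F X Y f (\<eta> X S)"
      using a \<eta>[OF a(1)] \<eta>[OF arr_comp[OF a(1) f]] quotient_functor_FMap[OF s a(1) f] functor_comp[OF F a(1) f v]
      by simp
  qed
  show ?thesis
  proof (rule that[OF mk_mor_mem[OF quotient_is_functor[OF s] nt]])
    fix W a assume a: "arr D V W a"
    then show "app (mk_mor D (representable D V) F \<eta>) W (?c W a) = FMap F V W a v"
      using \<eta>[OF a] coset_mem_quotient[OF s a] by (subst app_mk_mor) (auto simp: arr_def)
  qed
qed

text \<open>By Yoneda, \<open>\<beta>\<close> and \<open>\<alpha>\<close> are determined by their
  values at identities. These values are a generator \<open>b\<close> of \<open>F\<close> and a map
  \<open>u\<close> through which all relations on \<open>b\<close> factor.\<close>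

lemma finitely_presentedE:
  assumes "F \<in> Obj (mod_cat K D)"
  obtains X Y u b where "arr D Y X u" and "b \<in> carrier (FOb F Y)"
    and "\<And>V v. \<lbrakk>V \<in> Obj D; v \<in> carrier (FOb F V)\<rbrakk> \<Longrightarrow> \<exists>a. arr D Y V a \<and> v = FMap F Y V a b"
    and "\<And>V a. \<lbrakk>arr D Y V a; FMap F Y V a b = \<zero>\<^bsub>FOb F V\<^esub>\<rbrakk> \<Longrightarrow> \<exists>h. arr D X V h \<and> a = h \<cdot> u"
    and "FMap F Y X u b = \<zero>\<^bsub>FOb F X\<^esub>"
proof -
  have F: "is_functor K D F" and "finitely_presented K D F" using assms by (simp_all add: Obj_mod_cat)
  then obtain X Y \<alpha> \<beta> where X: "X \<in> Obj D" and Y: "Y \<in> Obj D"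
    and \<alpha>: "nat_trans K D (hom_functor D X) (hom_functor D Y) \<alpha>"
    and \<beta>: "nat_trans K D (hom_functor D Y) F \<beta>"
    and ex': "\<forall>Z \<in> Obj D. \<beta> Z ` Mor D Y Z = carrier (FOb F Z) \<and>
           {v \<in> Mor D Y Z. \<beta> Z v = \<zero>\<^bsub>FOb F Z\<^esub>} = \<alpha> Z ` Mor D X Z"
    unfolding finitely_presented_def by (elim bexE exE conjE) (rule that)
  note ex = bspec[OF ex']
  let ?b = "\<beta> Y (Idn D Y)" and ?u = "\<alpha> X (Idn D X)"
  have iX: "Idn D X \<in> Mor D X X" and iY: "Idn D Y \<in> Mor D Y Y" using X Y by (simp_all add: id_closed)
  have b: "?b \<in> carrier (FOb F Y)" using ex[OF Y] iY by blast
  have uk: "?u \<in> Mor D Y X" "\<beta> X ?u = \<zero>\<^bsub>FOb F X\<^esub>" using ex[OF X] iX by blast+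
  then have u: "arr D Y X ?u" using X Y by (simp add: arr_def)
  have \<beta>': "FMap F Y V a ?b = \<beta> V a" if a: "arr D Y V a" for V a
    using nat_trans_natural[OF \<beta> a, of "Idn D Y"] iY idr[OF a] by (simp add: hom_functor_def)
  have \<alpha>': "\<alpha> V h = h \<cdot> ?u" if h: "arr D X V h" for V h
    using nat_trans_natural[OF \<alpha> h, of "Idn D X"] iX idr[OF h] by (simp add: hom_functor_def)
  show ?thesis
  proof (rule that[OF u b])
    fix V v assume V: "V \<in> Obj D" and "v \<in> carrier (FOb F V)"
    then have "v \<in> \<beta> V ` Mor D Y V" using ex[OF V] by simp
    then obtain a where a: "a \<in> Mor D Y V" "v = \<beta> V a" by auto
    have "arr D Y V a" using a(1) Y V by (rule arrI)
    then show "\<exists>a. arr D Y V a \<and> v = FMap F Y V a ?b" using \<beta>' a(2) by auto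
  next
    fix V a assume a: "arr D Y V a" and "FMap F Y V a ?b = \<zero>\<^bsub>FOb F V\<^esub>"
    then have "a \<in> {v \<in> Mor D Y V. \<beta> V v = \<zero>\<^bsub>FOb F V\<^esub>}" using \<beta>'[OF a] by (simp add: arr_def)
    then have "a \<in> \<alpha> V ` Mor D X V" using ex[OF arr_objs(2)[OF a]] by simp
    then obtain h where h: "h \<in> Mor D X V" "a = \<alpha> V h" by auto
    have "arr D X V h" using h(1) X arr_objs(2)[OF a] by (rule arrI)
    then show "\<exists>h. arr D X V h \<and> a = h \<cdot> ?u" using \<alpha>' h(2) by auto
  next
    show "FMap F Y X ?u ?b = \<zero>\<^bsub>FOb F X\<^esub>" using \<beta>'[OF u] uk by simp
  qed
qed

lemma mod_cat_epiI:
  assumes F: "F \<in> Obj (mod_cat K D)" and G: "G \<in> Obj (mod_cat K D)" and m: "m \<in> Mor (mod_cat K D) F G"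
    and surj: "\<And>V w. \<lbrakk>V \<in> Obj D; w \<in> carrier (FOb G V)\<rbrakk> \<Longrightarrow> \<exists>v \<in> carrier (FOb F V). app m V v = w"
  shows "is_epi (mod_cat K D) F G m"
  unfolding is_epi_def
proof (intro conjI ballI impI F G m)
  fix H n n' assume n: "n \<in> Mor (mod_cat K D) G H" "n' \<in> Mor (mod_cat K D) G H"
    and e: "n \<cdot>\<^bsub>mod_cat K D\<^esub> m = n' \<cdot>\<^bsub>mod_cat K D\<^esub> m"
  show "n = n'"
  proof (rule mor_mod_cat_eqI[OF n])
    fix V w assume V: "V \<in> Obj D" and "w \<in> carrier (FOb G V)"
    then obtain v where "v \<in> carrier (FOb F V)" "app m V v = w" using surj by blast
    then show "app n V w = app n' V w"
      using app_comp[OF m n(1) V, of v] app_comp[OF m n(2) V, of v] e by simp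
  qed
qed

text \<open>By Yoneda, \<open>v\<close> is a morphism Hom(V, -) -> F that \<open>g\<close> kills. It
  factors through the kernel, and the factor evaluated at the identity of \<open>V\<close> is a
  preimage of \<open>v\<close>.\<close>

lemma kernel_mod_cat_lift:
  assumes k: "is_kernel (mod_cat K D) W F G k g" and V: "V \<in> Obj D"
    and v: "v \<in> carrier (FOb F V)" and gv: "app g V v = \<zero>\<^bsub>FOb G V\<^esub>"
  shows "\<exists>w \<in> carrier (FOb W V). app k V w = v"
proof -
  let ?c = "\<lambda>W a. {\<zero>\<^bsub>Hom D V W\<^esub>} +>\<^bsub>Hom D V W\<^esub> a"
  note s = representable_mod(1)[OF V] and H = representable_mod(2)[OF V]
  have o: "W \<in> Obj (mod_cat K D)" "F \<in> Obj (mod_cat K D)" "G \<in> Obj (mod_cat K D)"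
    and km: "k \<in> Mor (mod_cat K D) W F" and gm: "g \<in> Mor (mod_cat K D) F G"
    and lift: "\<And>m. \<lbrakk>m \<in> Mor (mod_cat K D) (representable D V) F;
         g \<cdot>\<^bsub>mod_cat K D\<^esub> m = \<zero>\<^bsub>Hom (mod_cat K D) (representable D V) G\<^esub>\<rbrakk>
        \<Longrightarrow> \<exists>h. h \<in> Mor (mod_cat K D) (representable D V) W \<and> k \<cdot>\<^bsub>mod_cat K D\<^esub> h = m"
    using k H unfolding is_kernel_def by blast+
  have F: "is_functor K D F" and G: "is_functor K D G" using o by (simp_all add: Obj_mod_cat)
  obtain m where m: "m \<in> Mor (mod_cat K D) (representable D V) F"
    and mv: "\<And>W a. arr D V W a \<Longrightarrow> app m W (?c W a) = FMap F V W a v"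
    using yoneda[OF F V v] by blast
  have Hf: "is_functor K D (representable D V)" using H by (simp add: Obj_mod_cat)
  have gmm: "g \<cdot>\<^bsub>mod_cat K D\<^esub> m \<in> Mor (mod_cat K D) (representable D V) G"
  proof -
    have "nat_trans K D (representable D V) G (\<lambda>X v. app g X (app m X v))"
      unfolding nat_trans_def
    proof (intro conjI ballI)
      fix X assume X: "X \<in> Obj D"
      note l = linear_mapD[OF nat_trans_lin[OF mor_mod_catE(2)[OF m] X]]
        and l' = linear_mapD[OF nat_trans_lin[OF mor_mod_catE(2)[OF gm] X]]
      show "linear_map K (FOb (representable D V) X) (FOb G X) (\<lambda>v. app g X (app m X v))"
        by (rule linear_mapI) (use l l' in auto)
    next
      fix X Y f S assume "X \<in> Obj D" "Y \<in> Obj D" "f \<in> Mor D X Y" and S: "S \<in> carrier (FOb (representable D V) X)"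
      then have f: "arr D X Y f" by (simp add: arr_def)
      have "app m X S \<in> carrier (FOb F X)"
        using linear_mapD(1)[OF nat_trans_lin[OF mor_mod_catE(2)[OF m] arr_objs(1)[OF f]]] S by blast
      then show "app g Y (app m Y (FMap (representable D V) X Y f S)) = FMap G X Y f (app g X (app m X S))"
        using nat_trans_natural[OF mor_mod_catE(2)[OF m] f S] nat_trans_natural[OF mor_mod_catE(2)[OF gm] f] by simp
    qed
    from mk_mor_mem[OF Hf this] show ?thesis
      by (simp add: mk_mor_def comp_mod_cat[OF m gm])
  qed
  have "g \<cdot>\<^bsub>mod_cat K D\<^esub> m = \<zero>\<^bsub>Hom (mod_cat K D) (representable D V) G\<^esub>"
  proof (rule mor_mod_cat_eqI[OF gmm zero_mem_mod_cat[OF Hf G]])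
    fix X S assume X: "X \<in> Obj D" and S: "S \<in> carrier (FOb (representable D V) X)"
    then obtain a where a: "arr D V X a" "S = ?c X a" using quotientE[OF s X] by auto
    have "app (g \<cdot>\<^bsub>mod_cat K D\<^esub> m) X S = app g X (FMap F V X a v)"
      using app_comp[OF m gm X S] mv[OF a(1)] a(2) by simp
    also have "\<dots> = FMap G V X a (app g V v)" using nat_trans_natural[OF mor_mod_catE(2)[OF gm] a(1) v] .
    also have "\<dots> = \<zero>\<^bsub>FOb G X\<^esub>" using gv linear_mapD(4)[OF functor_lin[OF G a(1)]] by simp
    finally show "app (g \<cdot>\<^bsub>mod_cat K D\<^esub> m) X S = app \<zero>\<^bsub>Hom (mod_cat K D) (representable D V) G\<^esub> X S"
      using app_zero[OF X S, of K G] by simp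
  qed
  then obtain h where h: "h \<in> Mor (mod_cat K D) (representable D V) W" "k \<cdot>\<^bsub>mod_cat K D\<^esub> h = m"
    using lift[OF m] by blast
  let ?i = "?c V (Idn D V)"
  have i: "?i \<in> carrier (FOb (representable D V) V)" using coset_mem_quotient[OF s arr_id[OF V]] by simp
  have "app k V (app h V ?i) = v"
    using app_comp[OF h(1) km V i] h(2) mv[OF arr_id[OF V]] functor_id[OF F V v] by simp
  moreover have "app h V ?i \<in> carrier (FOb W V)"
    using linear_mapD(1)[OF nat_trans_lin[OF mor_mod_catE(2)[OF h(1)] V] i] .
  ultimately show ?thesis by blast
qed

text \<open>On a zero object the identity agrees with the zero morphism; both are evaluated at
  \<open>v\<close>.\<close>

lemma zero_object_mod_cat:
  assumes z: "zero_object (mod_cat K D) F" and V: "V \<in> Obj D" and v: "v \<in> carrier (FOb F V)"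
  shows "v = \<zero>\<^bsub>FOb F V\<^esub>"
proof -
  have o: "F \<in> Obj (mod_cat K D)" using z by (simp add: zero_object_def)
  then have F: "is_functor K D F" by (simp add: Obj_mod_cat)
  have "Idn (mod_cat K D) F = \<zero>\<^bsub>Hom (mod_cat K D) F F\<^esub>"
    using z o id_mem_mod_cat[OF F] zero_mem_mod_cat[OF F F] unfolding zero_object_def by blast
  then show ?thesis using app_id[OF V v, of K] app_zero[OF V v, of K F] by simp
qed

end

section \<open>Epimorphisms and exactness, objectwise\<close>

context additive_hom_finite_category
begin

text \<open>
  The cokernel of \<open>m\<close> is again finitely presented: it is the quotient of \<open>Hom(Y, -)\<close> by the image of a
  map from \<open>Hom(Z \<oplus> X, -)\<close>, where \<open>Z\<close> comes from the generator of \<open>F\<close> and \<open>X\<close> from the relations of \<open>G\<close>.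
\<close>

lemma mod_cat_epi_surj:
  assumes epi: "is_epi (mod_cat K D) F G m" and V: "V \<in> Obj D" and w: "w \<in> carrier (FOb G V)"
  shows "\<exists>v \<in> carrier (FOb F V). app m V v = w"
proof -
  have Fo: "F \<in> Obj (mod_cat K D)" and Go: "G \<in> Obj (mod_cat K D)"
    and m: "m \<in> Mor (mod_cat K D) F G" using epi by (simp_all add: is_epi_def)
  have F: "is_functor K D F" and G: "is_functor K D G" using Fo Go by (simp_all add: Obj_mod_cat)
  note nt = mor_mod_catE(2)[OF m]
  obtain X Y u b where u: "arr D Y X u" and b: "b \<in> carrier (FOb G Y)"
    and gen: "\<And>V v. \<lbrakk>V \<in> Obj D; v \<in> carrier (FOb G V)\<rbrakk> \<Longrightarrow> \<exists>a. arr D Y V a \<and> v = FMap G Y V a b"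
    and rel: "\<And>V a. \<lbrakk>arr D Y V a; FMap G Y V a b = \<zero>\<^bsub>FOb G V\<^esub>\<rbrakk> \<Longrightarrow> \<exists>h. arr D X V h \<and> a = h \<cdot> u"
    and ub: "FMap G Y X u b = \<zero>\<^bsub>FOb G X\<^esub>"
    by (rule finitely_presentedE[OF Go]) (rule that)
  obtain X' Z u' x where u': "arr D Z X' u'" and x: "x \<in> carrier (FOb F Z)"
    and gen': "\<And>V v. \<lbrakk>V \<in> Obj D; v \<in> carrier (FOb F V)\<rbrakk> \<Longrightarrow> \<exists>a. arr D Z V a \<and> v = FMap F Z V a x"
    by (rule finitely_presentedE[OF Fo]) (rule that)
  have X: "X \<in> Obj D" and Y: "Y \<in> Obj D" and Z: "Z \<in> Obj D" using u u' by (auto simp: arr_def)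
  have mx: "app m Z x \<in> carrier (FOb G Z)" using linear_mapD(1)[OF nat_trans_lin[OF nt Z] x] .
  obtain y where y: "arr D Y Z y" and mxy: "app m Z x = FMap G Y Z y b" using gen[OF Z mx] by blast
  obtain E i j p q where "biproduct D E Z X i j p q"
    using has_direct_sums[OF Z X] by (auto simp: is_direct_sum_def)
  then have E: "E \<in> Obj D" and i: "arr D Z E i" and j: "arr D X E j" and p: "arr D E Z p" and q: "arr D E X q"
    and pi: "p \<cdot> i = Idn D Z" and qj: "q \<cdot> j = Idn D X"
    and qi: "q \<cdot> i = \<zero>\<^bsub>Hom D Z X\<^esub>" and pj: "p \<cdot> j = \<zero>\<^bsub>Hom D X Z\<^esub>"
    by (auto simp: biproduct_def arr_def)
  have iy: "arr D Y E (i \<cdot> y)" and ju: "arr D Y E (j \<cdot> u)" using arr_comp y i u j by blast+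
  \<comment> \<open>The components of \<open>t\<close> are \<open>y\<close>, which represents the
    image under \<open>m\<close> of the generator of \<open>F\<close>, and \<open>u\<close>, which
    carries the relations of \<open>G\<close>. The maps factoring through \<open>t\<close> are those
    whose action on \<open>b\<close> dies in the cokernel of \<open>m\<close>.\<close>
  define t where "t = i \<cdot> y \<oplus>\<^bsub>Hom D Y E\<^esub> j \<cdot> u"
  have t: "arr D Y E t" unfolding t_def using arr_add[OF iy ju] .
  let ?N = "\<lambda>V. (\<lambda>h. h \<cdot> t) ` Mor D E V"
  let ?Q = "quotient_functor D Y ?N"
  note s = quotient_by_image(1)[OF t] and Qo = quotient_by_image(2)[OF t]
  have pt: "p \<cdot> t = y"
    unfolding t_def comp_add_right[OF iy ju p] assoc[OF y i p, symmetric] assoc[OF u j p, symmetric] pi pj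
    using idl[OF y] comp_zero_left[OF Z u] add_zero(1)[OF y] by simp
  have qt: "q \<cdot> t = u"
    unfolding t_def comp_add_right[OF iy ju q] assoc[OF y i q, symmetric] assoc[OF u j q, symmetric] qi qj
    using idl[OF u] comp_zero_left[OF X y] add_zero(2)[OF u] by simp
  have N: "h \<cdot> t \<in> ?N W" if "arr D E W h" for W h using that arr_mem by blast
  have yN: "h \<cdot> y \<in> ?N W" if h: "arr D Z W h" for W h
    using N[OF arr_comp[OF p h]] assoc[OF t p h] pt by simp
  have uN: "h \<cdot> u \<in> ?N W" if h: "arr D X W h" for W h
    using N[OF arr_comp[OF q h]] assoc[OF t q h] qt by simp
  \<comment> \<open>On the generator \<open>b\<close> the part of \<open>t\<close> through
    \<open>u\<close> vanishes and the part through \<open>y\<close> gives a value of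
    \<open>m\<close>.\<close>
  have Nim: "\<exists>v \<in> carrier (FOb F W). app m W v = FMap G Y W a b" if W: "W \<in> Obj D" and a: "a \<in> ?N W" for W a
  proof -
    obtain h where h: "arr D E W h" "a = h \<cdot> t" using a W E by (auto simp: arr_def)
    interpret GE: vectorspace K "FOb G E" using functor_vs[OF G E] .
    have "FMap G Y E t b = FMap G Y E (i \<cdot> y) b \<oplus>\<^bsub>FOb G E\<^esub> FMap G Y E (j \<cdot> u) b"
      unfolding t_def using functor_add[OF G iy ju b] .
    also have "FMap G Y E (j \<cdot> u) b = \<zero>\<^bsub>FOb G E\<^esub>"
      using functor_comp[OF G u j b] ub linear_mapD(4)[OF functor_lin[OF G j]] by simp
    also have "FMap G Y E (i \<cdot> y) b \<oplus>\<^bsub>FOb G E\<^esub> \<zero>\<^bsub>FOb G E\<^esub> = FMap G Z E i (app m Z x)"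
      using functor_closed[OF G iy b] functor_comp[OF G y i b] mxy by simp
    also have "\<dots> = app m E (FMap F Z E i x)" using nat_trans_natural[OF nt i x] by simp
    finally have "FMap G Y E t b = app m E (FMap F Z E i x)" .
    then have "FMap G Y W a b = app m W (FMap F E W h (FMap F Z E i x))"
      using functor_comp[OF G t h(1) b] h(2) nat_trans_natural[OF nt h(1) functor_closed[OF F i x]] by simp
    then show ?thesis using functor_closed[OF F h(1) functor_closed[OF F i x]] by metis
  qed
  \<comment> \<open>The projection of \<open>G\<close> onto \<open>?Q\<close>: an element is lifted
    to Hom(Y, -) and the coset of the lift is taken. Two lifts differ by a relation, which factors
    through \<open>u\<close> and so lies in \<open>?N\<close>.\<close>
  define \<eta> where "\<eta> W g = ?N W +>\<^bsub>Hom D Y W\<^esub> (SOME a. arr D Y W a \<and> g = FMap G Y W a b)" for W g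
  have \<eta>: "\<eta> W (FMap G Y W a b) = ?N W +>\<^bsub>Hom D Y W\<^esub> a" if a: "arr D Y W a" for W a
  proof -
    define a' where "a' = (SOME a'. arr D Y W a' \<and> FMap G Y W a b = FMap G Y W a' b)"
    have a': "arr D Y W a'" "FMap G Y W a b = FMap G Y W a' b"
      using someI[of "\<lambda>a'. arr D Y W a' \<and> FMap G Y W a b = FMap G Y W a' b" a] a unfolding a'_def by blast+
    then have "FMap G Y W (a' \<ominus>\<^bsub>Hom D Y W\<^esub> a) b = \<zero>\<^bsub>FOb G W\<^esub>" using functor_diff_zero[OF G a'(1) a b] by simp
    then have "a' \<ominus>\<^bsub>Hom D Y W\<^esub> a \<in> ?N W" using rel[OF arr_minus[OF a'(1) a]] uN by metis
    then show ?thesis unfolding \<eta>_def a'_def[symmetric] using coset_eq[OF s a'(1) a] by blast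
  qed
  have "nat_trans K D G ?Q \<eta>"
    unfolding nat_trans_def
  proof (intro conjI ballI)
    fix W assume W: "W \<in> Obj D"
    interpret Q: quotient_space K "Hom D Y W" "?N W" using subfunctorD(2)[OF s W] .
    show "linear_map K (FOb G W) (FOb ?Q W) (\<eta> W)"
      unfolding quotient_functor_FOb
    proof (rule linear_mapI[OF functor_vs[OF G W] Q.quot_vectorspace])
      fix v w assume "v \<in> carrier (FOb G W)" "w \<in> carrier (FOb G W)"
      then obtain a c where a: "arr D Y W a" "v = FMap G Y W a b" and c: "arr D Y W c" "w = FMap G Y W c b"
        using gen[OF W] by meson
      show "\<eta> W (v \<oplus>\<^bsub>FOb G W\<^esub> w) = \<eta> W v \<oplus>\<^bsub>quot_module (Hom D Y W) (?N W)\<^esub> \<eta> W w"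
        unfolding a(2) c(2) \<eta>[OF a(1)] \<eta>[OF c(1)] Q.quot_add[OF arr_mem[OF a(1)] arr_mem[OF c(1)]]
          functor_add[OF G a(1) c(1) b, symmetric] \<eta>[OF arr_add[OF a(1) c(1)]] ..
    next
      fix v assume "v \<in> carrier (FOb G W)"
      then obtain a where a: "arr D Y W a" "v = FMap G Y W a b" using gen[OF W] by meson
      then show "\<eta> W v \<in> carrier (quot_module (Hom D Y W) (?N W))"
        using \<eta>[OF a(1)] coset_mem_quotient[OF s a(1)] by simp
      fix c assume c: "c \<in> carrier K"
      show "\<eta> W (c \<odot>\<^bsub>FOb G W\<^esub> v) = c \<odot>\<^bsub>quot_module (Hom D Y W) (?N W)\<^esub> \<eta> W v"
        unfolding a(2) \<eta>[OF a(1)] Q.quot_smult[OF c arr_mem[OF a(1)]]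
          functor_smult[OF G c a(1) b, symmetric] \<eta>[OF arr_smult[OF c a(1)]] ..
    qed
  next
    fix W W' f v assume W: "W \<in> Obj D" "W' \<in> Obj D" "f \<in> Mor D W W'" and "v \<in> carrier (FOb G W)"
    then obtain a where a: "arr D Y W a" "v = FMap G Y W a b" using gen[OF W(1)] by meson
    have f: "arr D W W' f" using W by (simp add: arr_def)
    show "\<eta> W' (FMap G W W' f v) = FMap ?Q W W' f (\<eta> W v)"
      unfolding a(2) \<eta>[OF a(1)] functor_comp[OF G a(1) f b, symmetric] \<eta>[OF arr_comp[OF a(1) f]]
        quotient_functor_FMap[OF s a(1) f] ..
  qed
  note c = mk_mor_mem[OF G this]
  have Qf: "is_functor K D ?Q" using Qo by (simp add: Obj_mod_cat)
  note z = zero_mem_mod_cat[OF G Qf]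
  \<comment> \<open>The projection kills the image of \<open>m\<close>. As \<open>m\<close> is epi,
    the projection is zero, which puts every element of \<open>G\<close> into that image.\<close>
  have "mk_mor D G ?Q \<eta> \<cdot>\<^bsub>mod_cat K D\<^esub> m = \<zero>\<^bsub>Hom (mod_cat K D) G ?Q\<^esub> \<cdot>\<^bsub>mod_cat K D\<^esub> m"
    unfolding comp_mod_cat[OF m c] comp_mod_cat[OF m z]
  proof (intro arg_cong[where f = "\<lambda>h. (F, ?Q, h)"] restrict_ext)
    fix W v assume W: "W \<in> Obj D" and v: "v \<in> carrier (FOb F W)"
    have mv: "app m W v \<in> carrier (FOb G W)" using linear_mapD(1)[OF nat_trans_lin[OF nt W] v] .
    obtain h where h: "arr D Z W h" "v = FMap F Z W h x" using gen'[OF W v] by blast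
    have "app m W v = FMap G Y W (h \<cdot> y) b"
      using h nat_trans_natural[OF nt h(1) x] mxy functor_comp[OF G y h(1) b] by simp
    then have "\<eta> W (app m W v) = \<zero>\<^bsub>FOb ?Q W\<^esub>"
      using \<eta>[OF arr_comp[OF y h(1)]] coset_eq_zero[OF s arr_comp[OF y h(1)]] yN[OF h(1)] by simp
    then show "app (mk_mor D G ?Q \<eta>) W (app m W v) = app \<zero>\<^bsub>Hom (mod_cat K D) G ?Q\<^esub> W (app m W v)"
      using app_mk_mor[OF W mv] app_zero[OF W mv, of K ?Q] by simp
  qed
  then have cz: "mk_mor D G ?Q \<eta> = \<zero>\<^bsub>Hom (mod_cat K D) G ?Q\<^esub>"
    using epi Qo c z unfolding is_epi_def by blast
  obtain a where a: "arr D Y V a" "w = FMap G Y V a b" using gen[OF V w] by blast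
  have "\<eta> V w = \<zero>\<^bsub>FOb ?Q V\<^esub>"
    using app_mk_mor[OF V w, where G = ?Q and \<eta> = \<eta>] cz app_zero[OF V w, of K ?Q] by simp
  then have "a \<in> ?N V" using \<eta>[OF a(1)] a(2) coset_eq_zero[OF s a(1)] by simp
  then show ?thesis using Nim[OF V] a(2) by blast
qed

text \<open>With kernels and epimorphisms known objectwise, exactness in \<open>mod_cat\<close>
  becomes exactness of the sequences of values, the form in which a resolution can be read through
  Yoneda.\<close>

lemma exact_at_mod_cat:
  assumes ex: "exact_at (mod_cat K D) F G H f g" and V: "V \<in> Obj D"
  shows "\<lbrakk>v \<in> carrier (FOb G V); app g V v = \<zero>\<^bsub>FOb H V\<^esub>\<rbrakk> \<Longrightarrow> \<exists>x \<in> carrier (FOb F V). app f V x = v"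
    and "x \<in> carrier (FOb F V) \<Longrightarrow> app g V (app f V x) = \<zero>\<^bsub>FOb H V\<^esub>"
proof -
  obtain W k e where k: "is_kernel (mod_cat K D) W G H k g" and e: "is_epi (mod_cat K D) F W e"
    and f: "f = k \<cdot>\<^bsub>mod_cat K D\<^esub> e" using ex by (auto simp: exact_at_def)
  have km: "k \<in> Mor (mod_cat K D) W G" and gm: "g \<in> Mor (mod_cat K D) G H"
    and gk: "g \<cdot>\<^bsub>mod_cat K D\<^esub> k = \<zero>\<^bsub>Hom (mod_cat K D) W H\<^esub>"
    using k by (simp_all add: is_kernel_def)
  have em: "e \<in> Mor (mod_cat K D) F W" using e by (simp add: is_epi_def)
  {
    assume "v \<in> carrier (FOb G V)" "app g V v = \<zero>\<^bsub>FOb H V\<^esub>"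
    then obtain w where w: "w \<in> carrier (FOb W V)" "app k V w = v" using kernel_mod_cat_lift[OF k V] by blast
    obtain x where "x \<in> carrier (FOb F V)" "app e V x = w" using mod_cat_epi_surj[OF e V w(1)] by blast
    then show "\<exists>x \<in> carrier (FOb F V). app f V x = v" using app_comp[OF em km V, of x] f w(2) by auto
  }
  {
    assume x: "x \<in> carrier (FOb F V)"
    have ex: "app e V x \<in> carrier (FOb W V)"
      using linear_mapD(1)[OF nat_trans_lin[OF mor_mod_catE(2)[OF em] V] x] .
    then show "app g V (app f V x) = \<zero>\<^bsub>FOb H V\<^esub>"
      using app_comp[OF em km V x] app_comp[OF km gm V ex] gk f app_zero[OF V ex, of K H] by simp
  }
qed

end

context hom_finite_category
begin

text \<open>
  In Yoneda form: \<open>P\<close> is a direct summand of \<open>Hom(Y, -)\<close>, with projection given by \<open>b\<close> and inclusion \<open>\<sigma>\<close>.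
\<close>

lemma projective_mod_catE:
  assumes proj: "projective_object (mod_cat K D) P"
  obtains Y b \<sigma> where "Y \<in> Obj D" and "b \<in> carrier (FOb P Y)"
    and "\<And>V v. \<lbrakk>V \<in> Obj D; v \<in> carrier (FOb P V)\<rbrakk> \<Longrightarrow> arr D Y V (\<sigma> V v) \<and> FMap P Y V (\<sigma> V v) b = v"
    and "\<And>V W a v. \<lbrakk>arr D V W a; v \<in> carrier (FOb P V)\<rbrakk> \<Longrightarrow> \<sigma> W (FMap P V W a v) = a \<cdot> \<sigma> V v"
    and "\<And>V. V \<in> Obj D \<Longrightarrow> \<sigma> V \<zero>\<^bsub>FOb P V\<^esub> = \<zero>\<^bsub>Hom D Y V\<^esub>"
proof -
  have Po: "P \<in> Obj (mod_cat K D)" using proj by (simp add: projective_object_def)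
  then have P: "is_functor K D P" by (simp add: Obj_mod_cat)
  obtain X Y u b where u: "arr D Y X u" and b: "b \<in> carrier (FOb P Y)"
    and gen: "\<And>V v. \<lbrakk>V \<in> Obj D; v \<in> carrier (FOb P V)\<rbrakk> \<Longrightarrow> \<exists>a. arr D Y V a \<and> v = FMap P Y V a b"
    by (rule finitely_presentedE[OF Po]) (rule that)
  have Y: "Y \<in> Obj D" using u by (simp add: arr_def)
  let ?c = "\<lambda>W a. {\<zero>\<^bsub>Hom D Y W\<^esub>} +>\<^bsub>Hom D Y W\<^esub> a"
  note s = representable_mod(1)[OF Y]
  obtain m where m: "m \<in> Mor (mod_cat K D) (representable D Y) P"
    and mv: "\<And>W a. arr D Y W a \<Longrightarrow> app m W (?c W a) = FMap P Y W a b"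
    using yoneda[OF P Y b] by blast
  have "is_epi (mod_cat K D) (representable D Y) P m"
  proof (rule mod_cat_epiI[OF representable_mod(2)[OF Y] Po m])
    fix V w assume V: "V \<in> Obj D" and "w \<in> carrier (FOb P V)"
    then obtain a where a: "arr D Y V a" "w = FMap P Y V a b" using gen by blast
    show "\<exists>v\<in>carrier (FOb (representable D Y) V). app m V v = w"
      using mv[OF a(1)] a(2) coset_mem_quotient[OF s a(1)] by (intro bexI[of _ "?c V a"]) simp_all
  qed
  then obtain n where n: "n \<in> Mor (mod_cat K D) P (representable D Y)"
    and mn: "m \<cdot>\<^bsub>mod_cat K D\<^esub> n = Idn (mod_cat K D) P"
    using proj id_mem_mod_cat[OF P] unfolding projective_object_def by blast
  note nt = mor_mod_catE(2)[OF n]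
  \<comment> \<open>\<open>n\<close> is the section of the epimorphism Hom(Y, -) -> P that
    projectivity provides; \<open>\<sigma>\<close> reads off the unique representatives of its
    values.\<close>
  define \<sigma> where "\<sigma> V v = (SOME a. arr D Y V a \<and> app n V v = ?c V a)" for V v
  have \<sigma>: "arr D Y V (\<sigma> V v)" "app n V v = ?c V (\<sigma> V v)" if V: "V \<in> Obj D" and v: "v \<in> carrier (FOb P V)" for V v
  proof -
    have "app n V v \<in> carrier (quot_module (Hom D Y V) {\<zero>\<^bsub>Hom D Y V\<^esub>})"
      using linear_mapD(1)[OF nat_trans_lin[OF nt V] v] by simp
    then obtain a where "arr D Y V a \<and> app n V v = ?c V a" using quotientE[OF s V] by blast
    from someI[of "\<lambda>a. arr D Y V a \<and> app n V v = ?c V a", OF this]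
    show "arr D Y V (\<sigma> V v)" "app n V v = ?c V (\<sigma> V v)" unfolding \<sigma>_def by blast+
  qed
  show ?thesis
  proof (rule that[OF Y b])
    fix V v assume V: "V \<in> Obj D" and v: "v \<in> carrier (FOb P V)"
    have "app m V (app n V v) = v" using app_comp[OF n m V v] mn app_id[OF V v, of K] by simp
    then show "arr D Y V (\<sigma> V v) \<and> FMap P Y V (\<sigma> V v) b = v"
      using \<sigma>[OF V v] mv[OF \<sigma>(1)[OF V v]] by simp
  next
    fix V W a v assume a: "arr D V W a" and v: "v \<in> carrier (FOb P V)"
    have V: "V \<in> Obj D" and W: "W \<in> Obj D" using a by (simp_all add: arr_def)
    have w: "FMap P V W a v \<in> carrier (FOb P W)" using functor_closed[OF P a v] .
    have "?c W (\<sigma> W (FMap P V W a v)) = ?c W (a \<cdot> \<sigma> V v)"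
      using \<sigma>(2)[OF W w] nat_trans_natural[OF nt a v] \<sigma>(2)[OF V v] quotient_functor_FMap[OF s \<sigma>(1)[OF V v] a] by simp
    then show "\<sigma> W (FMap P V W a v) = a \<cdot> \<sigma> V v"
      using representable_coset_inj[OF \<sigma>(1)[OF W w] arr_comp[OF \<sigma>(1)[OF V v] a]] by blast
  next
    fix V assume V: "V \<in> Obj D"
    interpret PV: vectorspace K "FOb P V" using functor_vs[OF P V] .
    have z: "\<zero>\<^bsub>FOb P V\<^esub> \<in> carrier (FOb P V)" by simp
    have "?c V (\<sigma> V \<zero>\<^bsub>FOb P V\<^esub>) = \<zero>\<^bsub>quot_module (Hom D Y V) {\<zero>\<^bsub>Hom D Y V\<^esub>}\<^esub>"
      using \<sigma>(2)[OF V z] linear_mapD(4)[OF nat_trans_lin[OF nt V]] by simp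
    then show "\<sigma> V \<zero>\<^bsub>FOb P V\<^esub> = \<zero>\<^bsub>Hom D Y V\<^esub>" using coset_eq_zero[OF s \<sigma>(1)[OF V z]] by simp
  qed
qed

lemma radical_subfunctor:
  assumes Z: "Z \<in> Obj D" shows "subfunctor Z (cat_radical D Z)"
  unfolding subfunctor_def
proof (intro conjI ballI allI impI Z)
  fix V assume V: "V \<in> Obj D"
  interpret H: vectorspace K "Hom D Z V" using hom_vs[OF Z V] .
  show "submodule K (cat_radical D Z V) (Hom D Z V)"
  proof (rule LinearCombinations.submodule.intro)
    show "Module.module K (Hom D Z V)" by (rule H.module_axioms)
    show "cat_radical D Z V \<subseteq> Mor D Z V" by (auto simp: cat_radical_def)
    show "\<zero>\<^bsub>Hom D Z V\<^esub> \<in> cat_radical D Z V" using radical_zero[OF Z V] .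
  next
    fix v w assume "v \<in> cat_radical D Z V" "w \<in> cat_radical D Z V"
    then show "v \<oplus>\<^bsub>Hom D Z V\<^esub> w \<in> cat_radical D Z V" using radical_add Z V by blast
  next
    fix c v assume c: "c \<in> carrier K" and v: "v \<in> cat_radical D Z V"
    have a: "arr D Z V v" using v Z V radical_arr by blast
    have "c \<odot>\<^bsub>Hom D Z V\<^esub> v = (c \<odot>\<^bsub>Hom D V V\<^esub> Idn D V) \<cdot> v"
      using comp_smult_l[OF c a arr_id[OF V]] idl[OF a] by simp
    then show "c \<odot>\<^bsub>Hom D Z V\<^esub> v \<in> cat_radical D Z V"
      using radical_comp_left[OF v arr_smult[OF c arr_id[OF V]] Z] by simp
  qed
next
  fix V W g n assume "arr D V W g" "n \<in> cat_radical D Z V"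
  then show "g \<cdot> n \<in> cat_radical D Z W" using radical_comp_left Z by blast
qed

end

section \<open>Resolutions of simple functors\<close>

text \<open>The infimum of the empty set is infinite, so the bound forces a finite resolution to
  exist; the infimum of a nonempty set of extended naturals is attained.\<close>

lemma proj_dim_leE:
  assumes "proj_dim A X \<le> enat k"
  obtains P d \<epsilon> where "projective_resolution A X P d \<epsilon>" "\<And>i. i > k \<Longrightarrow> zero_object A (P i)"
proof -
  let ?S = "{enat n | n. \<exists>P d \<epsilon>. projective_resolution A X P d \<epsilon> \<and> (\<forall>i > n. zero_object A (P i))}"
  have "?S \<noteq> {}" using assms unfolding proj_dim_def by (metis Inf_enat_def enat_ord_code(5))
  then obtain s where "s \<in> ?S" by blast
  then have "(LEAST x. x \<in> ?S) \<in> ?S" by (rule LeastI)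
  then have "Inf ?S \<in> ?S" unfolding Inf_enat_def if_not_P[OF \<open>?S \<noteq> {}\<close>] .
  then obtain n P d \<epsilon> where n: "Inf ?S = enat n" "projective_resolution A X P d \<epsilon>" "\<forall>i > n. zero_object A (P i)"
    by blast
  then have "n \<le> k" using assms by (simp add: proj_dim_def)
  then show ?thesis using that n by (meson le_less_trans)
qed

context additive_hom_finite_category
begin

text \<open>
  A projective resolution of the simple functor at \<open>Z\<close>, read through Yoneda's lemma: the summand of
  \<open>Hom(Y n, -)\<close> cut out by the idempotent \<open>e n\<close> is the \<open>n\<close>-th term, so that no idempotent has to
  split. The maps \<open>z\<close> and \<open>y\<close> compare the resolution with the projective cover \<open>Hom(Z, -)\<close>.
\<close>

lemma simple_functor_resolution:
  assumes Z: "Z \<in> Obj D" and pd: "proj_dim (mod_cat K D) (simple_functor D Z) \<le> enat k"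
  obtains Y e u z y where
    "\<And>n. arr D (Y n) (Y (Suc n)) (u n)"
    and "\<And>n. u (Suc n) \<cdot> u n = \<zero>\<^bsub>Hom D (Y n) (Y (Suc (Suc n)))\<^esub>"
    and "\<And>n V a. \<lbrakk>arr D (Y (Suc n)) V a; a \<cdot> e (Suc n) = a; a \<cdot> u n = \<zero>\<^bsub>Hom D (Y n) V\<^esub>\<rbrakk>
      \<Longrightarrow> \<exists>c. arr D (Y (Suc (Suc n))) V c \<and> c \<cdot> e (Suc (Suc n)) = c \<and> a = c \<cdot> u (Suc n)"
    and "\<And>n V a. \<lbrakk>n > k; arr D (Y n) V a; a \<cdot> e n = a\<rbrakk> \<Longrightarrow> a = \<zero>\<^bsub>Hom D (Y n) V\<^esub>"
    and "arr D (Y 0) Z z" and "arr D Z (Y 0) y"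
    and "Idn D Z \<ominus>\<^bsub>Hom D Z Z\<^esub> z \<cdot> y \<in> cat_radical D Z Z"
    and "u 0 \<cdot> y \<in> cat_radical D Z (Y 1)"
    and "\<And>V f. \<lbrakk>V \<in> Obj D; f \<in> cat_radical D Z V\<rbrakk>
      \<Longrightarrow> \<exists>g. arr D (Y 1) V g \<and> g \<cdot> e 1 = g \<and> g \<cdot> u 0 = f \<cdot> z"
    and "\<And>n. arr D (Y n) (Y n) (e n)"
proof -
  let ?S = "simple_functor D Z"
  obtain P d \<epsilon> where res: "projective_resolution (mod_cat K D) ?S P d \<epsilon>"
    and zP: "\<And>i. i > k \<Longrightarrow> zero_object (mod_cat K D) (P i)"
    using proj_dim_leE[OF pd] by blast
  have proj: "\<And>n. projective_object (mod_cat K D) (P n)"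
    and epi: "is_epi (mod_cat K D) (P 0) ?S \<epsilon>"
    and ex0: "exact_at (mod_cat K D) (P (Suc 0)) (P 0) ?S (d 0) \<epsilon>"
    and ex: "\<And>n. exact_at (mod_cat K D) (P (Suc (Suc n))) (P (Suc n)) (P n) (d (Suc n)) (d n)"
    using res by (simp_all add: projective_resolution_def)
  have P: "is_functor K D (P n)" for n using proj[of n] by (simp add: projective_object_def Obj_mod_cat)
  have "\<exists>Y b \<sigma>. Y \<in> Obj D \<and> b \<in> carrier (FOb (P n) Y) \<and>
      (\<forall>V v. V \<in> Obj D \<longrightarrow> v \<in> carrier (FOb (P n) V) \<longrightarrow> arr D Y V (\<sigma> V v) \<and> FMap (P n) Y V (\<sigma> V v) b = v) \<and>
      (\<forall>V W a v. arr D V W a \<longrightarrow> v \<in> carrier (FOb (P n) V) \<longrightarrow> \<sigma> W (FMap (P n) V W a v) = a \<cdot> \<sigma> V v) \<and>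
      (\<forall>V. V \<in> Obj D \<longrightarrow> \<sigma> V \<zero>\<^bsub>FOb (P n) V\<^esub> = \<zero>\<^bsub>Hom D Y V\<^esub>)" for n
    by (rule projective_mod_catE[OF proj[of n]]) blast
  then obtain Y b \<sigma> where Y: "\<And>n. Y n \<in> Obj D" and b: "\<And>n. b n \<in> carrier (FOb (P n) (Y n))"
    and \<sigma>': "\<And>n V v. \<lbrakk>V \<in> Obj D; v \<in> carrier (FOb (P n) V)\<rbrakk> \<Longrightarrow> arr D (Y n) V (\<sigma> n V v) \<and> FMap (P n) (Y n) V (\<sigma> n V v) (b n) = v"
    and \<sigma>nat: "\<And>n V W a v. \<lbrakk>arr D V W a; v \<in> carrier (FOb (P n) V)\<rbrakk> \<Longrightarrow> \<sigma> n W (FMap (P n) V W a v) = a \<cdot> \<sigma> n V v"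
    and \<sigma>0: "\<And>n V. V \<in> Obj D \<Longrightarrow> \<sigma> n V \<zero>\<^bsub>FOb (P n) V\<^esub> = \<zero>\<^bsub>Hom D (Y n) V\<^esub>"
    by metis
  note \<sigma> = \<sigma>'[THEN conjunct1] \<sigma>'[THEN conjunct2]
  \<comment> \<open>Represents the projection onto \<open>P n\<close> followed by the inclusion, so
    \<open>a e n = a\<close> singles out the maps \<open>a\<close> that belong to the
    summand.\<close>
  define e where "e n = \<sigma> n (Y n) (b n)" for n
  have e: "arr D (Y n) (Y n) (e n)" for n unfolding e_def using \<sigma>(1)[OF Y b] .
  have ae: "a \<cdot> e n = \<sigma> n V (FMap (P n) (Y n) V a (b n))" if "arr D (Y n) V a" for n V a
    unfolding e_def using \<sigma>nat[OF that b] by simp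
  have \<sigma>e: "\<sigma> n V v \<cdot> e n = \<sigma> n V v" if "V \<in> Obj D" "v \<in> carrier (FOb (P n) V)" for n V v
    using ae[OF \<sigma>(1)[OF that]] \<sigma>(2)[OF that] by simp
  have \<sigma>inj: "v = \<zero>\<^bsub>FOb (P n) V\<^esub>"
    if "V \<in> Obj D" "v \<in> carrier (FOb (P n) V)" "\<sigma> n V v = \<zero>\<^bsub>Hom D (Y n) V\<^esub>" for n V v
    using \<sigma>(2)[OF that(1,2)] that(3) functor_zero[OF P Y that(1) b] by simp
  have act: "FMap (P n) (Y n) V a (b n) \<in> carrier (FOb (P n) V)" if "arr D (Y n) V a" for n V a
    using functor_closed[OF P that b] .
  have dm: "d n \<in> Mor (mod_cat K D) (P (Suc n)) (P n)" for n
    using ex[of n] unfolding exact_at_def is_kernel_def by auto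
  note dnt = mor_mod_catE(2)[OF dm]
  have dc: "app (d n) V v \<in> carrier (FOb (P n) V)" if "V \<in> Obj D" "v \<in> carrier (FOb (P (Suc n)) V)" for n V v
    using linear_mapD(1)[OF nat_trans_lin[OF dnt that(1)] that(2)] .
  \<comment> \<open>The differential in Yoneda form: \<open>d n\<close> applied to the generator of
    \<open>P (Suc n)\<close>, then included in Hom(Y n, -).\<close>
  define u where "u n = \<sigma> n (Y (Suc n)) (app (d n) (Y (Suc n)) (b (Suc n)))" for n
  have u: "arr D (Y n) (Y (Suc n)) (u n)" for n unfolding u_def using \<sigma>(1)[OF Y dc[OF Y b]] .
  have au: "a \<cdot> u n = \<sigma> n V (app (d n) V (FMap (P (Suc n)) (Y (Suc n)) V a (b (Suc n))))"
    if a: "arr D (Y (Suc n)) V a" for n V a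
    unfolding u_def using \<sigma>nat[OF a dc[OF Y b]] nat_trans_natural[OF dnt a b] by simp
  have exact: "\<exists>c. arr D (Y (Suc (Suc n))) V c \<and> c \<cdot> e (Suc (Suc n)) = c \<and> a = c \<cdot> u (Suc n)"
    if a: "arr D (Y (Suc n)) V a" "a \<cdot> e (Suc n) = a" "a \<cdot> u n = \<zero>\<^bsub>Hom D (Y n) V\<^esub>" for n V a
  proof -
    have V: "V \<in> Obj D" using a(1) by (simp add: arr_def)
    let ?v = "FMap (P (Suc n)) (Y (Suc n)) V a (b (Suc n))"
    have v: "?v \<in> carrier (FOb (P (Suc n)) V)" using act[OF a(1)] .
    have "app (d n) V ?v = \<zero>\<^bsub>FOb (P n) V\<^esub>" using \<sigma>inj[OF V dc[OF V v]] au[OF a(1)] a(3) by simp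
    then obtain x where x: "x \<in> carrier (FOb (P (Suc (Suc n))) V)" "app (d (Suc n)) V x = ?v"
      using exact_at_mod_cat(1)[OF ex V v] by blast
    let ?c = "\<sigma> (Suc (Suc n)) V x"
    have "?c \<cdot> u (Suc n) = a"
      using au[OF \<sigma>(1)[OF V x(1)]] \<sigma>(2)[OF V x(1)] x(2) ae[OF a(1)] a(2) by simp
    then show ?thesis using \<sigma>(1)[OF V x(1)] \<sigma>e[OF V x(1)] by metis
  qed
  have uu: "u (Suc n) \<cdot> u n = \<zero>\<^bsub>Hom D (Y n) (Y (Suc (Suc n)))\<^esub>" for n
  proof -
    have "FMap (P (Suc n)) (Y (Suc n)) (Y (Suc (Suc n))) (u (Suc n)) (b (Suc n)) =
        app (d (Suc n)) (Y (Suc (Suc n))) (b (Suc (Suc n)))"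
      unfolding u_def using \<sigma>(2)[OF Y dc[OF Y b]] .
    then show ?thesis using au[OF u[of "Suc n"]] exact_at_mod_cat(2)[OF ex Y b] \<sigma>0[OF Y] by simp
  qed
  have van: "a = \<zero>\<^bsub>Hom D (Y n) V\<^esub>" if n: "n > k" and a: "arr D (Y n) V a" "a \<cdot> e n = a" for n V a
    using zero_object_mod_cat[OF zP[OF n] arr_objs(2)[OF a(1)] act[OF a(1)]] ae[OF a(1)] a(2)
      \<sigma>0[OF arr_objs(2)[OF a(1)], of n] by simp
  note s = radical_subfunctor[OF Z]
  let ?c = "\<lambda>V a. cat_radical D Z V +>\<^bsub>Hom D Z V\<^esub> a"
  have So: "?S \<in> Obj (mod_cat K D)" and \<epsilon>: "\<epsilon> \<in> Mor (mod_cat K D) (P 0) ?S" using epi by (simp_all add: is_epi_def)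
  have S: "is_functor K D ?S" using So by (simp add: Obj_mod_cat)
  note \<epsilon>nt = mor_mod_catE(2)[OF \<epsilon>]
  have FS: "FOb ?S V = quot_module (Hom D Z V) (cat_radical D Z V)" for V by (simp add: simple_functor_eq)
  have FM: "FMap ?S V W g (?c V a) = ?c W (g \<cdot> a)" if "arr D Z V a" "arr D V W g" for V W a g
    unfolding simple_functor_eq using quotient_functor_FMap[OF s that] .
  have one: "?c Z (Idn D Z) \<in> carrier (FOb ?S Z)" unfolding FS using coset_mem_quotient[OF s arr_id[OF Z]] .
  \<comment> \<open>A lift of the identity of \<open>Z\<close> along \<open>\<epsilon>\<close> gives
    \<open>z\<close>, and the image under \<open>\<epsilon>\<close> of the generator of
    \<open>P 0\<close> gives \<open>y\<close>. Both induce maps over the simple functor, so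
    \<open>z y\<close> is the identity modulo the radical.\<close>
  obtain z' where z': "z' \<in> carrier (FOb (P 0) Z)" "app \<epsilon> Z z' = ?c Z (Idn D Z)"
    using mod_cat_epi_surj[OF epi Z one] by blast
  define z where "z = \<sigma> 0 Z z'"
  have z: "arr D (Y 0) Z z" and zb: "FMap (P 0) (Y 0) Z z (b 0) = z'" unfolding z_def using \<sigma>[OF Z z'(1)] by blast+
  have "app \<epsilon> (Y 0) (b 0) \<in> carrier (quot_module (Hom D Z (Y 0)) (cat_radical D Z (Y 0)))"
    using linear_mapD(1)[OF nat_trans_lin[OF \<epsilon>nt Y] b] unfolding FS .
  then obtain y where y: "arr D Z (Y 0) y" and \<epsilon>b: "app \<epsilon> (Y 0) (b 0) = ?c (Y 0) y" using quotientE[OF s Y] by blast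
  have "?c Z (z \<cdot> y) = ?c Z (Idn D Z)"
    using FM[OF y z] \<epsilon>b nat_trans_natural[OF \<epsilon>nt z b] zb z'(2) by simp
  then have zy: "Idn D Z \<ominus>\<^bsub>Hom D Z Z\<^esub> z \<cdot> y \<in> cat_radical D Z Z"
    using coset_eq[OF s arr_id[OF Z] arr_comp[OF y z]] by simp
  have "?c (Y 1) (u 0 \<cdot> y) = \<zero>\<^bsub>FOb ?S (Y 1)\<^esub>"
  proof -
    have u0: "arr D (Y 0) (Y 1) (u 0)" using u[of 0] by simp
    have "?c (Y 1) (u 0 \<cdot> y) = app \<epsilon> (Y 1) (FMap (P 0) (Y 0) (Y 1) (u 0) (b 0))"
      using FM[OF y u0] \<epsilon>b nat_trans_natural[OF \<epsilon>nt u0 b] by simp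
    also have "FMap (P 0) (Y 0) (Y 1) (u 0) (b 0) = app (d 0) (Y 1) (b 1)"
      unfolding u_def using \<sigma>(2)[OF Y dc[OF Y b]] by simp
    finally show ?thesis using exact_at_mod_cat(2)[OF ex0 Y, of "b 1"] b[of 1] by simp
  qed
  then have uy: "u 0 \<cdot> y \<in> cat_radical D Z (Y 1)"
    using coset_eq_zero[OF s arr_comp[OF y, of "Y 1" "u 0"]] u[of 0] by (simp add: FS)
  \<comment> \<open>A radical \<open>f\<close> annihilates the class of the identity, so
    \<open>f\<close> acting on its lift \<open>z'\<close> lies in the kernel of
    \<open>\<epsilon>\<close>; exactness makes it a boundary.\<close>
  have rad: "\<exists>g. arr D (Y 1) V g \<and> g \<cdot> e 1 = g \<and> g \<cdot> u 0 = f \<cdot> z"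
    if V: "V \<in> Obj D" and f: "f \<in> cat_radical D Z V" for V f
  proof -
    have fa: "arr D Z V f" using radical_arr[OF f Z V] .
    have w: "FMap (P 0) Z V f z' \<in> carrier (FOb (P 0) V)" using functor_closed[OF P fa z'(1)] .
    have "app \<epsilon> V (FMap (P 0) Z V f z') = ?c V f"
      using nat_trans_natural[OF \<epsilon>nt fa z'(1)] z'(2) FM[OF arr_id[OF Z] fa] idr[OF fa] by simp
    also have "\<dots> = \<zero>\<^bsub>FOb ?S V\<^esub>" using coset_eq_zero[OF s fa] f by (simp add: FS)
    finally obtain x where x: "x \<in> carrier (FOb (P (Suc 0)) V)" "app (d 0) V x = FMap (P 0) Z V f z'"
      using exact_at_mod_cat(1)[OF ex0 V w] by blast
    let ?g = "\<sigma> (Suc 0) V x"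
    have "?g \<cdot> u 0 = f \<cdot> z"
      using au[OF \<sigma>(1)[OF V x(1)]] \<sigma>(2)[OF V x(1)] x(2) \<sigma>nat[OF fa z'(1)] by (simp add: z_def)
    then show ?thesis using \<sigma>(1)[OF V x(1)] \<sigma>e[OF V x(1)] by (metis One_nat_def)
  qed
  show ?thesis by (rule that[OF u uu exact van z y zy uy rad e])
qed

end

section \<open>Conflations in an abelian category\<close>

context preadditive_category
begin

lemma kernelD:
  assumes "is_kernel D X Y Z f g"
  shows "arr D X Y f" "arr D Y Z g" "g \<cdot> f = \<zero>\<^bsub>Hom D X Z\<^esub>"
    and "\<lbrakk>arr D W Y h; g \<cdot> h = \<zero>\<^bsub>Hom D W Z\<^esub>\<rbrakk> \<Longrightarrow> \<exists>h'. arr D W X h' \<and> f \<cdot> h' = h"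
    and "\<lbrakk>arr D W X a; arr D W X b; f \<cdot> a = f \<cdot> b\<rbrakk> \<Longrightarrow> a = b"
proof -
  show f: "arr D X Y f" and g: "arr D Y Z g" and gf: "g \<cdot> f = \<zero>\<^bsub>Hom D X Z\<^esub>"
    using assms by (simp_all add: is_kernel_def arr_def)
  have univ: "\<exists>!h'. h' \<in> Mor D W X \<and> f \<cdot> h' = h" if "arr D W Y h" "g \<cdot> h = \<zero>\<^bsub>Hom D W Z\<^esub>" for W h
    using assms that unfolding is_kernel_def arr_def by blast
  show "\<exists>h'. arr D W X h' \<and> f \<cdot> h' = h" if "arr D W Y h" "g \<cdot> h = \<zero>\<^bsub>Hom D W Z\<^esub>"
    using univ[OF that] that(1) f by (auto simp: arr_def)
  show "a = b" if a: "arr D W X a" and b: "arr D W X b" and e: "f \<cdot> a = f \<cdot> b"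
  proof -
    have "g \<cdot> (f \<cdot> a) = \<zero>\<^bsub>Hom D W Z\<^esub>"
      using assoc[OF a f g] gf comp_zero_left[OF arr_objs(2)[OF g] a] by simp
    from univ[OF arr_comp[OF a f] this] show ?thesis using arr_mem[OF a] arr_mem[OF b] e by metis
  qed
qed

lemma cokernelD:
  assumes "is_cokernel D X Y Z f g"
  shows "arr D X Y f" "arr D Y Z g" "g \<cdot> f = \<zero>\<^bsub>Hom D X Z\<^esub>"
    and "\<lbrakk>arr D Y W h; h \<cdot> f = \<zero>\<^bsub>Hom D X W\<^esub>\<rbrakk> \<Longrightarrow> \<exists>h'. arr D Z W h' \<and> h' \<cdot> g = h"
    and "\<lbrakk>arr D Z W a; arr D Z W b; a \<cdot> g = b \<cdot> g\<rbrakk> \<Longrightarrow> a = b"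
proof -
  show f: "arr D X Y f" and g: "arr D Y Z g" and gf: "g \<cdot> f = \<zero>\<^bsub>Hom D X Z\<^esub>"
    using assms by (simp_all add: is_cokernel_def arr_def)
  have univ: "\<exists>!h'. h' \<in> Mor D Z W \<and> h' \<cdot> g = h" if "arr D Y W h" "h \<cdot> f = \<zero>\<^bsub>Hom D X W\<^esub>" for W h
    using assms that unfolding is_cokernel_def arr_def by blast
  show "\<exists>h'. arr D Z W h' \<and> h' \<cdot> g = h" if "arr D Y W h" "h \<cdot> f = \<zero>\<^bsub>Hom D X W\<^esub>"
    using univ[OF that] that(1) g by (auto simp: arr_def)
  show "a = b" if a: "arr D Z W a" and b: "arr D Z W b" and e: "a \<cdot> g = b \<cdot> g"
  proof -
    have "(a \<cdot> g) \<cdot> f = \<zero>\<^bsub>Hom D X W\<^esub>"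
      using assoc[OF f g a] gf comp_zero_right[OF arr_objs(1)[OF f] a] by simp
    from univ[OF arr_comp[OF g a] this] show ?thesis using arr_mem[OF a] arr_mem[OF b] e by metis
  qed
qed

lemma epiI:
  assumes g: "arr D Y Z g" and "\<And>W w. \<lbrakk>arr D Z W w; w \<cdot> g = \<zero>\<^bsub>Hom D Y W\<^esub>\<rbrakk> \<Longrightarrow> w = \<zero>\<^bsub>Hom D Z W\<^esub>"
  shows "is_epi D Y Z g"
  unfolding is_epi_def
proof (intro conjI ballI impI)
  show o: "Y \<in> Obj D" "Z \<in> Obj D" "g \<in> Mor D Y Z" using g by (simp_all add: arr_def)
  fix W u v assume "W \<in> Obj D" "u \<in> Mor D Z W" "v \<in> Mor D Z W" and e: "u \<cdot> g = v \<cdot> g"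
  then have u: "arr D Z W u" and v: "arr D Z W v" using o by (simp_all add: arr_def)
  have "(u \<ominus>\<^bsub>Hom D Z W\<^esub> v) \<cdot> g = \<zero>\<^bsub>Hom D Y W\<^esub>"
    using comp_diff_left[OF g u v] diff_self[OF arr_comp[OF g v]] e by simp
  then have "u \<ominus>\<^bsub>Hom D Z W\<^esub> v = \<zero>\<^bsub>Hom D Z W\<^esub>" using assms(2) arr_minus[OF u v] by blast
  then show "u = v" using diff_eq_zero[OF u v] by blast
qed

lemma biproductD:
  assumes "biproduct D X A B i j p q"
  shows "arr D A X i" "arr D B X j" "arr D X A p" "arr D X B q"
    "p \<cdot> i = Idn D A" "q \<cdot> j = Idn D B" "q \<cdot> i = \<zero>\<^bsub>Hom D A B\<^esub>" "p \<cdot> j = \<zero>\<^bsub>Hom D B A\<^esub>"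
    "(i \<cdot> p) \<oplus>\<^bsub>Hom D X X\<^esub> (j \<cdot> q) = Idn D X"
  using assms by (simp_all add: biproduct_def arr_def)

lemma biproduct_decompose:
  assumes b: "biproduct D X A B i j p q" and f: "arr D W X f"
  shows "f = i \<cdot> (p \<cdot> f) \<oplus>\<^bsub>Hom D W X\<^esub> j \<cdot> (q \<cdot> f)"
proof -
  note b = biproductD[OF b]
  have "f = ((i \<cdot> p) \<oplus>\<^bsub>Hom D X X\<^esub> (j \<cdot> q)) \<cdot> f" using b(9) idl[OF f] by simp
  also have "\<dots> = (i \<cdot> p) \<cdot> f \<oplus>\<^bsub>Hom D W X\<^esub> (j \<cdot> q) \<cdot> f"
    by (rule comp_add_left[OF f arr_comp[OF b(3,1)] arr_comp[OF b(4,2)]])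
  finally show ?thesis using assoc[OF f b(3,1)] assoc[OF f b(4,2)] by simp
qed

lemma biproduct_codecompose:
  assumes b: "biproduct D X A B i j p q" and f: "arr D X W f"
  shows "f = (f \<cdot> i) \<cdot> p \<oplus>\<^bsub>Hom D X W\<^esub> (f \<cdot> j) \<cdot> q"
proof -
  note b = biproductD[OF b]
  have "f = f \<cdot> ((i \<cdot> p) \<oplus>\<^bsub>Hom D X X\<^esub> (j \<cdot> q))" using b(9) idr[OF f] by simp
  also have "\<dots> = f \<cdot> (i \<cdot> p) \<oplus>\<^bsub>Hom D X W\<^esub> f \<cdot> (j \<cdot> q)"
    by (rule comp_add_right[OF arr_comp[OF b(3,1)] arr_comp[OF b(4,2)] f])
  finally show ?thesis using assoc[OF b(3,1) f] assoc[OF b(4,2) f] by simp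
qed

end

lemma biproduct_full_subcat:
  "biproduct (full_subcat D S) X A B i j p q \<Longrightarrow> S \<subseteq> Obj D \<Longrightarrow> biproduct D X A B i j p q"
  by (auto simp: biproduct_def)

context abelian_category
begin

text \<open>By normality \<open>g\<close> is the cokernel of some \<open>f'\<close>, and
  \<open>f'\<close> factors through the kernel \<open>f\<close>. A map killing \<open>f\<close>
  therefore kills \<open>f'\<close> and descends along \<open>g\<close>.\<close>

lemma epi_short_exact:
  assumes e: "is_epi D Y Z g" and k: "is_kernel D X Y Z f g"
  shows "short_exact D X Y Z f g"
proof -
  obtain X' f' where c: "is_cokernel D X' Y Z f' g" using epi_normal[OF e] by blast
  note c = cokernelD[OF c] and k' = kernelD[OF k]
  obtain t where t: "arr D X' X t" "f \<cdot> t = f'" using k'(4)[OF c(1,3)] by blast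
  have "is_cokernel D X Y Z f g"
    unfolding is_cokernel_def
  proof (intro conjI ballI impI)
    show "X \<in> Obj D" "Y \<in> Obj D" "Z \<in> Obj D" "f \<in> Mor D X Y" "g \<in> Mor D Y Z" "g \<cdot> f = \<zero>\<^bsub>Hom D X Z\<^esub>"
      using k by (simp_all add: is_kernel_def)
    fix W h assume "W \<in> Obj D" "h \<in> Mor D Y W" and hf: "h \<cdot> f = \<zero>\<^bsub>Hom D X W\<^esub>"
    then have h: "arr D Y W h" using k'(2) by (simp add: arr_def)
    have "h \<cdot> f' = \<zero>\<^bsub>Hom D X' W\<^esub>"
      using assoc[OF t(1) k'(1) h] t(2) hf comp_zero_left[OF arr_objs(2)[OF h] t(1)] by simp
    then obtain h' where h': "arr D Z W h'" "h' \<cdot> g = h" using c(4)[OF h] by blast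
    show "\<exists>!h'. h' \<in> Mor D Z W \<and> h' \<cdot> g = h"
    proof (rule ex1I)
      show "h' \<in> Mor D Z W \<and> h' \<cdot> g = h" using h' by (simp add: arr_def)
      fix h'' assume a: "h'' \<in> Mor D Z W \<and> h'' \<cdot> g = h"
      then have h'': "arr D Z W h''" using h'(1) by (simp add: arr_def)
      show "h'' = h'" using c(5)[OF h'' h'(1)] a h'(2) by simp
    qed
  qed
  with k show ?thesis by (simp add: short_exact_def)
qed

text \<open>
  Given a deflation \<open>\<pi> : P \<rightarrow> X\<close>, every \<open>t : T \<rightarrow> X\<close> becomes part of a deflation \<open>(\<pi>, t) : P \<oplus> T \<rightarrow> X\<close>:
  its kernel is the pull-back of \<open>\<pi>\<close> along \<open>t\<close>, an extension of \<open>T\<close> by the kernel of \<open>\<pi>\<close>.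
\<close>

lemma enlarge_deflation:
  assumes C: "extension_closed_subcat D C" and con: "conflation D C \<Omega> P X \<kappa> \<pi>"
    and T: "T \<in> C" and t: "arr D T X t"
  obtains L E l p j where "conflation D C L E X l p" "is_direct_sum (full_subcat D C) E P T"
    "arr D T E j" "p \<cdot> j = t"
proof -
  have CD: "C \<subseteq> Obj D" and add: "additive_category (full_subcat D C)"
    and ext: "\<And>X Y Z f g. \<lbrakk>short_exact D X Y Z f g; X \<in> C; Z \<in> C\<rbrakk> \<Longrightarrow> Y \<in> C"
    using C unfolding extension_closed_subcat_def by blast+
  have c: "\<Omega> \<in> C" "P \<in> C" "X \<in> C" and ker: "is_kernel D \<Omega> P X \<kappa> \<pi>" and cok: "is_cokernel D \<Omega> P X \<kappa> \<pi>"
    using con by (simp_all add: conflation_def short_exact_def)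
  note k = kernelD[OF ker] and ck = cokernelD[OF cok]
  obtain E where E: "is_direct_sum (full_subcat D C) E P T"
    using additive_category.has_direct_sums[OF add, of P T] c T by auto
  then obtain i j a b where bi: "biproduct (full_subcat D C) E P T i j a b" by (auto simp: is_direct_sum_def)
  have EC: "E \<in> C" using bi by (simp add: biproduct_def)
  note bip = biproduct_full_subcat[OF bi CD]
  note B = biproductD[OF bip]
  define p where "p = \<pi> \<cdot> a \<oplus>\<^bsub>Hom D E X\<^esub> t \<cdot> b"
  have pa: "arr D E X (\<pi> \<cdot> a)" and tb: "arr D E X (t \<cdot> b)" using arr_comp B k(2) t by blast+
  have p: "arr D E X p" unfolding p_def by (rule arr_add[OF pa tb])
  have pi: "p \<cdot> i = \<pi>"
    unfolding p_def comp_add_left[OF B(1) pa tb] assoc[OF B(1,3) k(2)] assoc[OF B(1,4) t] B(5,7)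
    using idr[OF k(2)] comp_zero_right[OF arr_objs(1)[OF B(1)] t] add_zero(1)[OF k(2)] by simp
  have pj: "p \<cdot> j = t"
    unfolding p_def comp_add_left[OF B(2) pa tb] assoc[OF B(2,3) k(2)] assoc[OF B(2,4) t] B(6,8)
    using idr[OF t] comp_zero_right[OF arr_objs(1)[OF B(2)] k(2)] add_zero(2)[OF t] by simp
  have "is_epi D E X p"
  proof (rule epiI[OF p])
    fix W w assume w: "arr D X W w" and wp: "w \<cdot> p = \<zero>\<^bsub>Hom D E W\<^esub>"
    have "w \<cdot> \<pi> = \<zero>\<^bsub>Hom D P W\<^esub>"
      using assoc[OF B(1) p w] pi wp comp_zero_left[OF arr_objs(2)[OF w] B(1)] by simp
    then show "w = \<zero>\<^bsub>Hom D X W\<^esub>"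
      using ck(5)[OF w arr_zero[OF arr_objs[OF w]]] comp_zero_left[OF arr_objs(2)[OF w] k(2)] by simp
  qed
  obtain L l where L: "is_kernel D L E X l p" using has_kernels[of E X p] p by (auto simp: arr_def)
  have se: "short_exact D L E X l p" by (rule epi_short_exact[OF \<open>is_epi D E X p\<close> L])
  note l = kernelD[OF L]
  have lc: "is_cokernel D L E X l p" using se by (simp add: short_exact_def)
  have n: "arr D L T (b \<cdot> l)" using arr_comp l(1) B(4) by blast
  have ik: "arr D \<Omega> E (i \<cdot> \<kappa>)" using arr_comp k(1) B(1) by blast
  have "p \<cdot> (i \<cdot> \<kappa>) = \<zero>\<^bsub>Hom D \<Omega> X\<^esub>" using assoc[OF k(1) B(1) p] pi k(3) by simp
  then obtain m where m: "arr D \<Omega> L m" "l \<cdot> m = i \<cdot> \<kappa>" using l(4)[OF ik] by blast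
  \<comment> \<open>Up to sign, \<open>L\<close> is the pull-back of \<open>\<pi>\<close> and
    \<open>t\<close>, so the kernel of \<open>L -> T\<close> is that of \<open>\<pi>\<close>. This
    extension is what places \<open>L\<close> in \<open>C\<close>.\<close>
  have kn: "is_kernel D \<Omega> L T m (b \<cdot> l)"
    unfolding is_kernel_def
  proof (intro conjI ballI impI)
    show "\<Omega> \<in> Obj D" "L \<in> Obj D" "T \<in> Obj D" "m \<in> Mor D \<Omega> L" "b \<cdot> l \<in> Mor D L T"
      using m n by (simp_all add: arr_def)
    show "(b \<cdot> l) \<cdot> m = \<zero>\<^bsub>Hom D \<Omega> T\<^esub>"
      using assoc[OF m(1) l(1) B(4)] m(2) assoc[OF k(1) B(1,4)] B(7) comp_zero_left[OF arr_objs(2)[OF B(4)] k(1)] by simp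
    fix W h assume "W \<in> Obj D" "h \<in> Mor D W L" and nh: "(b \<cdot> l) \<cdot> h = \<zero>\<^bsub>Hom D W T\<^esub>"
    then have h: "arr D W L h" using l(1) by (simp add: arr_def)
    have lh: "arr D W E (l \<cdot> h)" by (rule arr_comp[OF h l(1)])
    have alh: "arr D W P (a \<cdot> (l \<cdot> h))" by (rule arr_comp[OF lh B(3)])
    have "b \<cdot> (l \<cdot> h) = \<zero>\<^bsub>Hom D W T\<^esub>" using nh assoc[OF h l(1) B(4)] by simp
    then have lh_eq: "l \<cdot> h = i \<cdot> (a \<cdot> (l \<cdot> h))"
      using biproduct_decompose[OF bip lh] comp_zero_right[OF arr_objs(1)[OF h] B(2)] add_zero(1)[OF arr_comp[OF alh B(1)]]
      by simp
    have "\<pi> \<cdot> (a \<cdot> (l \<cdot> h)) = p \<cdot> (l \<cdot> h)" using assoc[OF alh B(1) p] pi lh_eq by simp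
    also have "\<dots> = \<zero>\<^bsub>Hom D W X\<^esub>" using assoc[OF h l(1) p] l(3) comp_zero_left[OF arr_objs(2)[OF p] h] by simp
    finally obtain h' where h': "arr D W \<Omega> h'" "\<kappa> \<cdot> h' = a \<cdot> (l \<cdot> h)" using k(4)[OF alh] by blast
    have "l \<cdot> (m \<cdot> h') = l \<cdot> h"
      using assoc[OF h'(1) m(1) l(1)] m(2) assoc[OF h'(1) k(1) B(1)] h'(2) lh_eq by simp
    then have mh: "m \<cdot> h' = h" using l(5)[OF arr_comp[OF h'(1) m(1)] h] by blast
    show "\<exists>!h'. h' \<in> Mor D W \<Omega> \<and> m \<cdot> h' = h"
    proof (rule ex1I)
      show "h' \<in> Mor D W \<Omega> \<and> m \<cdot> h' = h" using h'(1) mh by (simp add: arr_def)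
      fix h'' assume a'': "h'' \<in> Mor D W \<Omega> \<and> m \<cdot> h'' = h"
      then have h'': "arr D W \<Omega> h''" using h'(1) by (simp add: arr_def)
      have "i \<cdot> (\<kappa> \<cdot> h'') = i \<cdot> (\<kappa> \<cdot> h')"
        using assoc[OF h'' k(1) B(1)] assoc[OF h'(1) k(1) B(1)] assoc[OF h'' m(1) l(1)] assoc[OF h'(1) m(1) l(1)]
          m(2) a'' mh by simp
      then have "(a \<cdot> i) \<cdot> (\<kappa> \<cdot> h'') = (a \<cdot> i) \<cdot> (\<kappa> \<cdot> h')"
        using assoc[OF arr_comp[OF h'' k(1)] B(1,3)] assoc[OF arr_comp[OF h'(1) k(1)] B(1,3)] by simp
      then have "\<kappa> \<cdot> h'' = \<kappa> \<cdot> h'" using B(5) idl[OF arr_comp[OF h'' k(1)]] idl[OF arr_comp[OF h'(1) k(1)]] by simp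
      then show "h'' = h'" using k(5)[OF h'' h'(1)] by blast
    qed
  qed
  \<comment> \<open>If \<open>w\<close> kills \<open>b l\<close>, then \<open>w b\<close> kills the
    kernel of \<open>p\<close> and descends to \<open>s\<close> on \<open>X\<close>. Restricted to
    \<open>P\<close> this gives \<open>s \<pi> = 0\<close>, hence \<open>s = 0\<close>.\<close>
  have "is_epi D L T (b \<cdot> l)"
  proof (rule epiI[OF n])
    fix W w assume w: "arr D T W w" and wn: "w \<cdot> (b \<cdot> l) = \<zero>\<^bsub>Hom D L W\<^esub>"
    have wb: "arr D E W (w \<cdot> b)" by (rule arr_comp[OF B(4) w])
    have "(w \<cdot> b) \<cdot> l = \<zero>\<^bsub>Hom D L W\<^esub>" using wn assoc[OF l(1) B(4) w] by simp
    then obtain s where s: "arr D X W s" "s \<cdot> p = w \<cdot> b" using cokernelD(4)[OF lc wb] by blast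
    have "s \<cdot> \<pi> = (w \<cdot> b) \<cdot> i" using assoc[OF B(1) p s(1)] pi s(2) by simp
    also have "\<dots> = \<zero>\<^bsub>Hom D P W\<^esub>" using assoc[OF B(1,4) w] B(7) comp_zero_right[OF arr_objs(1)[OF B(1)] w] by simp
    finally have "s = \<zero>\<^bsub>Hom D X W\<^esub>"
      using ck(5)[OF s(1) arr_zero[OF arr_objs[OF s(1)]]] comp_zero_left[OF arr_objs(2)[OF s(1)] k(2)] by simp
    then have "w \<cdot> b = \<zero>\<^bsub>Hom D E W\<^esub>" using s comp_zero_left[OF arr_objs(2)[OF s(1)] p] by simp
    then show "w = \<zero>\<^bsub>Hom D T W\<^esub>"
      using assoc[OF B(2,4) w] B(6) idr[OF w] comp_zero_left[OF arr_objs(2)[OF w] B(2)] by simp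
  qed
  then have "L \<in> C" using ext[OF epi_short_exact[OF _ kn]] c(1) T by blast
  then have "conflation D C L E X l p" using se EC c(3) by (simp add: conflation_def)
  then show ?thesis using that E B(2) pj by blast
qed

text \<open>The complementary idempotent \<open>1 - s g\<close> is killed by \<open>g\<close> and so
  factors through \<open>f\<close>; the factor \<open>b\<close> is the projection onto
  \<open>X\<close>.\<close>

lemma split_conflation:
  assumes CD: "C \<subseteq> Obj D" and con: "conflation D C X Y Z f g" and s: "arr D Z Y s" "g \<cdot> s = Idn D Z"
  shows "is_direct_sum (full_subcat D C) Y Z X"
proof -
  have c: "X \<in> C" "Y \<in> C" "Z \<in> C" and ker: "is_kernel D X Y Z f g"
    using con by (simp_all add: conflation_def short_exact_def)
  note k = kernelD[OF ker]
  have Y: "arr D Y Y (Idn D Y)" using arr_id c CD by blast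
  have X: "arr D X X (Idn D X)" using arr_id c CD by blast
  have sg: "arr D Y Y (s \<cdot> g)" by (rule arr_comp[OF k(2) s(1)])
  have "g \<cdot> (Idn D Y \<ominus>\<^bsub>Hom D Y Y\<^esub> s \<cdot> g) = \<zero>\<^bsub>Hom D Y Z\<^esub>"
    using comp_diff_right[OF Y sg k(2)] idr[OF k(2)] assoc[OF k(2) s(1) k(2)] s(2) idl[OF k(2)] diff_self[OF k(2)] by simp
  then obtain b where b: "arr D Y X b" "f \<cdot> b = Idn D Y \<ominus>\<^bsub>Hom D Y Y\<^esub> s \<cdot> g"
    using k(4)[OF arr_minus[OF Y sg]] by blast
  have fb: "arr D Y Y (f \<cdot> b)" by (rule arr_comp[OF b(1) k(1)])
  have sum: "(s \<cdot> g) \<oplus>\<^bsub>Hom D Y Y\<^esub> (f \<cdot> b) = Idn D Y"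
  proof -
    interpret H: abelian_group "Hom D Y Y" using hom_ag[OF Y] .
    show ?thesis using diff_add[OF Y sg] b(2) H.a_comm arr_mem[OF sg] arr_mem[OF fb] by simp
  qed
  have "f \<cdot> (b \<cdot> f) = f"
    using assoc[OF k(1) b(1) k(1)] b(2) comp_diff_left[OF k(1) Y sg] idl[OF k(1)] assoc[OF k(1,2) s(1)] k(3)
      comp_zero_right[OF arr_objs(1)[OF k(1)] s(1)] diff_zero[OF k(1)] by simp
  then have bf: "b \<cdot> f = Idn D X" using k(5)[OF arr_comp[OF k(1) b(1)] X] idr[OF k(1)] by simp
  have "f \<cdot> (b \<cdot> s) = f \<cdot> \<zero>\<^bsub>Hom D Z X\<^esub>"
    using assoc[OF s(1) b(1) k(1)] b(2) comp_diff_left[OF s(1) Y sg] idl[OF s(1)] assoc[OF s(1) k(2) s(1)] s(2)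
      idr[OF s(1)] diff_self[OF s(1)] comp_zero_right[OF arr_objs(1)[OF s(1)] k(1)] by simp
  then have bs: "b \<cdot> s = \<zero>\<^bsub>Hom D Z X\<^esub>"
    using k(5)[OF arr_comp[OF s(1) b(1)] arr_zero[OF arr_objs(1)[OF s(1)] arr_objs(1)[OF k(1)]]] by blast
  have "biproduct (full_subcat D C) Y Z X s f g b"
    using c s b k bf bs sum by (simp add: biproduct_def arr_def)
  then show ?thesis by (auto simp: is_direct_sum_def)
qed

end

section \<open>Rigid subcategories of global dimension at most three\<close>

lemma K_linear_full_subcat:
  assumes "K_linear_category K D" "S \<subseteq> Obj D"
  shows "K_linear_category K (full_subcat D S)"
proof -
  interpret L: K_linear_category K D by fact
  note o = subsetD[OF assms(2)]
  show ?thesis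
  proof (intro K_linear_category.intro preadditive_category.intro category.intro
      preadditive_category_axioms.intro K_linear_category_axioms.intro)
    show "\<And>X. X \<in> Obj (full_subcat D S) \<Longrightarrow> Idn (full_subcat D S) X \<in> Mor (full_subcat D S) X X"
      by (simp add: L.id_closed o)
  next
    fix X Y Z f g
    assume "X \<in> Obj (full_subcat D S)" "Y \<in> Obj (full_subcat D S)" "Z \<in> Obj (full_subcat D S)"
      "f \<in> Mor (full_subcat D S) X Y" "g \<in> Mor (full_subcat D S) Y Z"
    then show "g \<cdot>\<^bsub>full_subcat D S\<^esub> f \<in> Mor (full_subcat D S) X Z"
      using L.comp_closed[of X Y Z f g] o by simp
  next
    fix W X Y Z f g h
    assume "W \<in> Obj (full_subcat D S)" "X \<in> Obj (full_subcat D S)" "Y \<in> Obj (full_subcat D S)" "Z \<in> Obj (full_subcat D S)"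
      "f \<in> Mor (full_subcat D S) W X" "g \<in> Mor (full_subcat D S) X Y" "h \<in> Mor (full_subcat D S) Y Z"
    then show "h \<cdot>\<^bsub>full_subcat D S\<^esub> (g \<cdot>\<^bsub>full_subcat D S\<^esub> f) = (h \<cdot>\<^bsub>full_subcat D S\<^esub> g) \<cdot>\<^bsub>full_subcat D S\<^esub> f"
      using L.comp_assoc[of W X Y Z f g h] o by simp
  next
    fix X Y f
    assume "X \<in> Obj (full_subcat D S)" "Y \<in> Obj (full_subcat D S)" "f \<in> Mor (full_subcat D S) X Y"
    then show "Idn (full_subcat D S) Y \<cdot>\<^bsub>full_subcat D S\<^esub> f = f" "f \<cdot>\<^bsub>full_subcat D S\<^esub> Idn (full_subcat D S) X = f"
      using L.id_left[of X Y f] L.id_right[of X Y f] o by simp_all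
  next
    fix X Y assume "X \<in> Obj (full_subcat D S)" "Y \<in> Obj (full_subcat D S)"
    then show "abelian_group (Hom (full_subcat D S) X Y)" "vectorspace K (Hom (full_subcat D S) X Y)"
      using L.hom_abelian_group[of X Y] L.hom_vectorspace[of X Y] o by simp_all
  next
    fix X Y Z f f' g
    assume "X \<in> Obj (full_subcat D S)" "Y \<in> Obj (full_subcat D S)" "Z \<in> Obj (full_subcat D S)"
      "f \<in> Mor (full_subcat D S) X Y" "f' \<in> Mor (full_subcat D S) X Y" "g \<in> Mor (full_subcat D S) Y Z"
    then show "g \<cdot>\<^bsub>full_subcat D S\<^esub> (f \<oplus>\<^bsub>Hom (full_subcat D S) X Y\<^esub> f') =
        g \<cdot>\<^bsub>full_subcat D S\<^esub> f \<oplus>\<^bsub>Hom (full_subcat D S) X Z\<^esub> g \<cdot>\<^bsub>full_subcat D S\<^esub> f'"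
      using L.comp_distrib_right[of X Y Z f f' g] o by simp
  next
    fix X Y Z f g g'
    assume "X \<in> Obj (full_subcat D S)" "Y \<in> Obj (full_subcat D S)" "Z \<in> Obj (full_subcat D S)"
      "f \<in> Mor (full_subcat D S) X Y" "g \<in> Mor (full_subcat D S) Y Z" "g' \<in> Mor (full_subcat D S) Y Z"
    then show "(g \<oplus>\<^bsub>Hom (full_subcat D S) Y Z\<^esub> g') \<cdot>\<^bsub>full_subcat D S\<^esub> f =
        g \<cdot>\<^bsub>full_subcat D S\<^esub> f \<oplus>\<^bsub>Hom (full_subcat D S) X Z\<^esub> g' \<cdot>\<^bsub>full_subcat D S\<^esub> f"
      using L.comp_distrib_left[of X Y Z f g g'] o by simp
  next
    fix X Y Z c f g
    assume "X \<in> Obj (full_subcat D S)" "Y \<in> Obj (full_subcat D S)" "Z \<in> Obj (full_subcat D S)"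
      "c \<in> carrier K" "f \<in> Mor (full_subcat D S) X Y" "g \<in> Mor (full_subcat D S) Y Z"
    then show "g \<cdot>\<^bsub>full_subcat D S\<^esub> (c \<odot>\<^bsub>Hom (full_subcat D S) X Y\<^esub> f) =
        c \<odot>\<^bsub>Hom (full_subcat D S) X Z\<^esub> (g \<cdot>\<^bsub>full_subcat D S\<^esub> f)"
      "(c \<odot>\<^bsub>Hom (full_subcat D S) Y Z\<^esub> g) \<cdot>\<^bsub>full_subcat D S\<^esub> f =
        c \<odot>\<^bsub>Hom (full_subcat D S) X Z\<^esub> (g \<cdot>\<^bsub>full_subcat D S\<^esub> f)"
      using L.comp_smult_right[of X Y Z c f g] L.comp_smult_left[of X Y Z c f g] o by simp_all
  qed
qed

section \<open>Local endomorphism rings and indecomposability\<close>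

context preadditive_category
begin

lemma zero_object_if_id_zero:
  assumes "X \<in> Obj D" "Idn D X = \<zero>\<^bsub>Hom D X X\<^esub>"
  shows "zero_object D X"
  unfolding zero_object_def
proof (intro conjI ballI assms(1))
  fix Y assume Y: "Y \<in> Obj D"
  show "\<exists>!f. f \<in> Mor D Y X"
  proof (rule ex1I)
    show "\<zero>\<^bsub>Hom D Y X\<^esub> \<in> Mor D Y X" using arr_zero[OF Y assms(1)] by (rule arr_mem)
    fix f assume "f \<in> Mor D Y X"
    then have f: "arr D Y X f" using Y assms(1) by (simp add: arr_def)
    show "f = \<zero>\<^bsub>Hom D Y X\<^esub>" using idl[OF f] assms(2) comp_zero_left[OF assms(1) f] by simp
  qed
  show "\<exists>!f. f \<in> Mor D X Y"
  proof (rule ex1I)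
    show "\<zero>\<^bsub>Hom D X Y\<^esub> \<in> Mor D X Y" using arr_zero[OF assms(1) Y] by (rule arr_mem)
    fix f assume "f \<in> Mor D X Y"
    then have f: "arr D X Y f" using Y assms(1) by (simp add: arr_def)
    show "f = \<zero>\<^bsub>Hom D X Y\<^esub>" using idr[OF f] assms(2) comp_zero_right[OF assms(1) f] by simp
  qed
qed

lemma zero_object_id: "zero_object D X \<Longrightarrow> Idn D X = \<zero>\<^bsub>Hom D X X\<^esub>"
  using id_closed arr_mem[OF arr_zero] unfolding zero_object_def by blast

lemma local_ringD:
  assumes "local_ring (End_ring D X)" "X \<in> Obj D"
  shows "Idn D X \<noteq> \<zero>\<^bsub>Hom D X X\<^esub>"
    and "\<lbrakk>arr D X X a; arr D X X b; endo_unit D X (a \<oplus>\<^bsub>Hom D X X\<^esub> b)\<rbrakk> \<Longrightarrow> endo_unit D X a \<or> endo_unit D X b"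
  using assms unfolding local_ring_def by (auto simp: arr_def Units_End_ring)

text \<open>An invertible idempotent is the identity, so \<open>i p = 1\<close> and the other
  projection is \<open>q = q i p = 0\<close>.\<close>

lemma biproduct_unit_imp_zero:
  assumes b: "biproduct D X A B i j p q" and u: "endo_unit D X (i \<cdot> p)"
  shows "zero_object D B"
proof -
  note B = biproductD[OF b]
  have ip: "arr D X X (i \<cdot> p)" by (rule arr_comp[OF B(3,1)])
  obtain w where w: "arr D X X w" "w \<cdot> (i \<cdot> p) = Idn D X" using u by (auto simp: endo_unit_def)
  have "(i \<cdot> p) \<cdot> (i \<cdot> p) = i \<cdot> p"
    using assoc[OF ip B(3,1)] assoc[OF B(3,1,3)] B(5) idl[OF B(3)] by simp
  then have "i \<cdot> p = Idn D X" using assoc[OF ip ip w(1)] w(2) idl[OF ip] by simp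
  then have "q = q \<cdot> (i \<cdot> p)" using idr[OF B(4)] by simp
  also have "\<dots> = \<zero>\<^bsub>Hom D X B\<^esub>"
    using assoc[OF B(3,1,4)] B(7) comp_zero_left[OF arr_objs(2)[OF B(4)] B(3)] by simp
  finally have "Idn D B = \<zero>\<^bsub>Hom D B B\<^esub>" using B(6) comp_zero_left[OF arr_objs(2)[OF B(4)] B(2)] by simp
  then show ?thesis using zero_object_if_id_zero arr_objs(1)[OF B(2)] by blast
qed

text \<open>Krull-Schmidt decompositions supply local endomorphism rings, whereas
  \<open>gl_dim\<close> ranges over indecomposables. In a local ring one of the summands of
  \<open>i p + j q = 1\<close> is a unit, which makes the complementary summand zero.\<close>

lemma local_imp_indecomposable:
  assumes l: "local_ring (End_ring D X)" and X: "X \<in> Obj D"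
  shows "indecomposable D X"
  unfolding indecomposable_def
proof (intro conjI allI impI X)
  show "\<not> zero_object D X" using zero_object_id local_ringD(1)[OF l X] by blast
  fix A B assume "is_direct_sum D X A B"
  then obtain i j p q where b: "biproduct D X A B i j p q" by (auto simp: is_direct_sum_def)
  note B = biproductD[OF b]
  have ip: "arr D X X (i \<cdot> p)" and jq: "arr D X X (j \<cdot> q)" using arr_comp B by blast+
  interpret H: abelian_group "Hom D X X" using hom_ag[OF ip] .
  have b': "biproduct D X B A j i q p"
    using b H.a_comm[OF arr_mem[OF jq] arr_mem[OF ip]] by (simp add: biproduct_def)
  have "endo_unit D X (i \<cdot> p) \<or> endo_unit D X (j \<cdot> q)"
    using local_ringD(2)[OF l X ip jq] B(9) endo_unit_id[OF X] by simp
  then show "zero_object D A \<or> zero_object D B"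
    using biproduct_unit_imp_zero[OF b] biproduct_unit_imp_zero[OF b'] by blast
qed

text \<open>Testing \<open>1 - x\<close> against the identity makes \<open>1 - (1 - x)\<close> a
  unit.\<close>

lemma endo_unit_if_radical:
  assumes x: "arr D Z Z x" and r: "Idn D Z \<ominus>\<^bsub>Hom D Z Z\<^esub> x \<in> cat_radical D Z Z"
  shows "endo_unit D Z x"
proof -
  have Z: "Z \<in> Obj D" using x by (simp add: arr_def)
  note i = arr_id[OF Z]
  have d: "arr D Z Z (Idn D Z \<ominus>\<^bsub>Hom D Z Z\<^esub> x)" by (rule arr_minus[OF i x])
  have "endo_unit D Z (Idn D Z \<ominus>\<^bsub>Hom D Z Z\<^esub> Idn D Z \<cdot> (Idn D Z \<ominus>\<^bsub>Hom D Z Z\<^esub> x))"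
    using r i mem_cat_radical[OF Z Z] by blast
  moreover have "Idn D Z \<ominus>\<^bsub>Hom D Z Z\<^esub> (Idn D Z \<ominus>\<^bsub>Hom D Z Z\<^esub> x) = x"
  proof -
    interpret H: abelian_group "Hom D Z Z" using hom_ag[OF i] .
    show ?thesis using diff_iff[OF i d x] diff_add[OF i x] H.a_comm[OF arr_mem[OF x] arr_mem[OF d]] by simp
  qed
  ultimately show ?thesis using idl[OF d] by simp
qed

end

locale gl_dim_three_subcat = abelian_category D
  for D :: "('k, 'o, 'm) kcat" (structure) +
  fixes K :: "('k, 'c) ring_scheme" and C T :: "'o set"
  assumes ext_closed: "extension_closed_subcat D C"
    and frob: "frobenius D C"
    and lin: "K_linear_category K (full_subcat D C)"
    and fin: "hom_finite K (full_subcat D C)"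
    and ks: "krull_schmidt (full_subcat D C)"
    and add_T: "additive_subcat (full_subcat D C) T"
    and ff_T: "functorially_finite (full_subcat D C) T"
    and proj_T: "exact_projective D C P \<Longrightarrow> P \<in> T"
    and gd: "gl_dim K (full_subcat D T) \<le> 3"
begin

lemma C_Obj: "X \<in> C \<Longrightarrow> X \<in> Obj D"
  using ext_closed unfolding extension_closed_subcat_def by (elim conjE) (rule subsetD)

lemma T_C: "X \<in> T \<Longrightarrow> X \<in> C"
  using add_T unfolding additive_subcat_def Obj_full_subcat by (elim conjE) (rule subsetD)

lemma T_Obj: "X \<in> T \<Longrightarrow> X \<in> Obj D"
  using C_Obj T_C by blast

lemma T_direct_sum: "is_direct_sum (full_subcat D C) X A B \<Longrightarrow> X \<in> T \<longleftrightarrow> A \<in> T \<and> B \<in> T"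
  using add_T unfolding additive_subcat_def by blast

lemma T_linear: "additive_hom_finite_category K (full_subcat D T)"
proof -
  have "K_linear_category K (full_subcat D T)"
    using K_linear_full_subcat[OF lin, of T] T_C by auto
  then interpret A: K_linear_category K "full_subcat D T" .
  have addC: "additive_category (full_subcat D C)" using ext_closed by (simp add: extension_closed_subcat_def)
  show ?thesis
  proof unfold_locales
    show "hom_finite K (full_subcat D T)" using fin T_C by (simp add: hom_finite_def)
    obtain Z where "Z \<in> T" "zero_object (full_subcat D C) Z" using add_T by (auto simp: additive_subcat_def)
    then have "zero_object (full_subcat D T) Z" using T_C by (simp add: zero_object_def)
    then show "\<exists>Z. zero_object (full_subcat D T) Z" ..
    fix A B assume "A \<in> Obj (full_subcat D T)" "B \<in> Obj (full_subcat D T)"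
    then have AB: "A \<in> T" "B \<in> T" by simp_all
    then obtain X where X: "is_direct_sum (full_subcat D C) X A B"
      using additive_category.has_direct_sums[OF addC, of A B] T_C by auto
    then have "X \<in> T" using T_direct_sum AB by blast
    then have "is_direct_sum (full_subcat D T) X A B"
      using X AB by (auto simp: is_direct_sum_def biproduct_def)
    then show "\<exists>X. is_direct_sum (full_subcat D T) X A B" ..
  qed
qed

sublocale A: additive_hom_finite_category K "full_subcat D T"
  by (rule T_linear)

lemma arr_T: "arr (full_subcat D T) X Y f \<longleftrightarrow> X \<in> T \<and> Y \<in> T \<and> arr D X Y f"
  using T_Obj by (auto simp: arr_def)

text \<open>A local endomorphism ring makes \<open>Z\<close> indecomposable, so the bound on
  \<open>gl_dim\<close> reaches its simple functor. The resolution found inside the subcategory is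
  rewritten in terms of \<open>D\<close>, and \<open>z y\<close> is invertible because it is the
  identity modulo the radical.\<close>

lemma resolution:
  assumes Z: "Z \<in> T" and l: "local_ring (End_ring D Z)"
  obtains Y e u z y where
    "\<And>n. Y n \<in> T" and "\<And>n. arr D (Y n) (Y (Suc n)) (u n)" and "\<And>n. arr D (Y n) (Y n) (e n)"
    and "\<And>n. u (Suc n) \<cdot> u n = \<zero>\<^bsub>Hom D (Y n) (Y (Suc (Suc n)))\<^esub>"
    and "\<And>n V a. \<lbrakk>V \<in> T; arr D (Y (Suc n)) V a; a \<cdot> e (Suc n) = a; a \<cdot> u n = \<zero>\<^bsub>Hom D (Y n) V\<^esub>\<rbrakk>
      \<Longrightarrow> \<exists>c. arr D (Y (Suc (Suc n))) V c \<and> c \<cdot> e (Suc (Suc n)) = c \<and> a = c \<cdot> u (Suc n)"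
    and "\<And>n V a. \<lbrakk>n > 3; V \<in> T; arr D (Y n) V a; a \<cdot> e n = a\<rbrakk> \<Longrightarrow> a = \<zero>\<^bsub>Hom D (Y n) V\<^esub>"
    and "arr D (Y 0) Z z" and "arr D Z (Y 0) y"
    and "endo_unit D Z (z \<cdot> y)"
    and "u 0 \<cdot> y \<in> cat_radical D Z (Y 1)"
    and "\<And>V f. \<lbrakk>V \<in> T; f \<in> cat_radical D Z V\<rbrakk>
      \<Longrightarrow> \<exists>g. arr D (Y 1) V g \<and> g \<cdot> e 1 = g \<and> g \<cdot> u 0 = f \<cdot> z"
proof -
  have ind: "indecomposable (full_subcat D T) Z"
    using A.local_imp_indecomposable l Z by simp
  have "proj_dim (mod_cat K (full_subcat D T)) (simple_functor (full_subcat D T) Z) \<le> gl_dim K (full_subcat D T)"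
    unfolding gl_dim_def using ind by (intro Sup_upper) blast
  also have "\<dots> \<le> enat 3" using gd by (simp add: numeral_eq_enat)
  finally have pd: "proj_dim (mod_cat K (full_subcat D T)) (simple_functor (full_subcat D T) Z) \<le> enat 3" .
  have Zo: "Z \<in> Obj (full_subcat D T)" using Z by simp
  obtain Y e u z y where
    1: "\<And>n. arr (full_subcat D T) (Y n) (Y (Suc n)) (u n)"
    and 2: "\<And>n. u (Suc n) \<cdot>\<^bsub>full_subcat D T\<^esub> u n = \<zero>\<^bsub>Hom (full_subcat D T) (Y n) (Y (Suc (Suc n)))\<^esub>"
    and 3: "\<And>n V a. \<lbrakk>arr (full_subcat D T) (Y (Suc n)) V a; a \<cdot>\<^bsub>full_subcat D T\<^esub> e (Suc n) = a;
        a \<cdot>\<^bsub>full_subcat D T\<^esub> u n = \<zero>\<^bsub>Hom (full_subcat D T) (Y n) V\<^esub>\<rbrakk>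
      \<Longrightarrow> \<exists>c. arr (full_subcat D T) (Y (Suc (Suc n))) V c \<and> c \<cdot>\<^bsub>full_subcat D T\<^esub> e (Suc (Suc n)) = c
        \<and> a = c \<cdot>\<^bsub>full_subcat D T\<^esub> u (Suc n)"
    and 4: "\<And>n V a. \<lbrakk>n > 3; arr (full_subcat D T) (Y n) V a; a \<cdot>\<^bsub>full_subcat D T\<^esub> e n = a\<rbrakk>
      \<Longrightarrow> a = \<zero>\<^bsub>Hom (full_subcat D T) (Y n) V\<^esub>"
    and 5: "arr (full_subcat D T) (Y 0) Z z" and 6: "arr (full_subcat D T) Z (Y 0) y"
    and 7: "Idn (full_subcat D T) Z \<ominus>\<^bsub>Hom (full_subcat D T) Z Z\<^esub> z \<cdot>\<^bsub>full_subcat D T\<^esub> y \<in> cat_radical (full_subcat D T) Z Z"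
    and 8: "u 0 \<cdot>\<^bsub>full_subcat D T\<^esub> y \<in> cat_radical (full_subcat D T) Z (Y 1)"
    and 9: "\<And>V f. \<lbrakk>V \<in> Obj (full_subcat D T); f \<in> cat_radical (full_subcat D T) Z V\<rbrakk>
      \<Longrightarrow> \<exists>g. arr (full_subcat D T) (Y 1) V g \<and> g \<cdot>\<^bsub>full_subcat D T\<^esub> e 1 = g \<and> g \<cdot>\<^bsub>full_subcat D T\<^esub> u 0 = f \<cdot>\<^bsub>full_subcat D T\<^esub> z"
    and 10: "\<And>n. arr (full_subcat D T) (Y n) (Y n) (e n)"
    by (rule A.simple_functor_resolution[OF Zo pd]) (rule that)
  note s = Obj_full_subcat Hom_full_subcat Idn_full_subcat Comp_full_subcat cat_radical_full_subcat arr_T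
  show ?thesis
  proof (rule that[of Y u e z y])
    fix n show Yn: "Y n \<in> T" "arr D (Y n) (Y (Suc n)) (u n)" "arr D (Y n) (Y n) (e n)"
      using 1[of n] 10[of n] by (simp_all add: s)
    show "u (Suc n) \<cdot> u n = \<zero>\<^bsub>Hom D (Y n) (Y (Suc (Suc n)))\<^esub>" using 2 by (simp add: s)
  next
    fix n V a assume "V \<in> T" "arr D (Y (Suc n)) V a" "a \<cdot> e (Suc n) = a" "a \<cdot> u n = \<zero>\<^bsub>Hom D (Y n) V\<^esub>"
    then show "\<exists>c. arr D (Y (Suc (Suc n))) V c \<and> c \<cdot> e (Suc (Suc n)) = c \<and> a = c \<cdot> u (Suc n)"
      using 3[of n V a] 1[of "Suc n"] 10[of "Suc n"] by (auto simp: s)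
  next
    fix n :: nat and V a assume "n > 3" "V \<in> T" "arr D (Y n) V a" "a \<cdot> e n = a"
    then show "a = \<zero>\<^bsub>Hom D (Y n) V\<^esub>" using 4[of n V a] 10[of n] by (simp add: s)
  next
    show z: "arr D (Y 0) Z z" and y: "arr D Z (Y 0) y" using 5 6 by (simp_all add: s)
    show "endo_unit D Z (z \<cdot> y)" using endo_unit_if_radical[OF arr_comp[OF y z]] 7 by (simp add: s)
    show "u 0 \<cdot> y \<in> cat_radical D Z (Y 1)" using 8 by (simp add: s)
  next
    fix V f assume "V \<in> T" "f \<in> cat_radical D Z V"
    then show "\<exists>g. arr D (Y 1) V g \<and> g \<cdot> e 1 = g \<and> g \<cdot> u 0 = f \<cdot> z" using 9[of V f] by (auto simp: s)
  qed
qed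

end

lemma conflationD:
  assumes "conflation D C X Y Z f g"
  shows "X \<in> C" "Y \<in> C" "Z \<in> C" "is_kernel D X Y Z f g" "is_cokernel D X Y Z f g"
  using assms by (simp_all add: conflation_def short_exact_def)

section \<open>Approximations and vanishing of Tor\<close>

context gl_dim_three_subcat
begin

text \<open>No minimality is meant: any deflation from a projective object serves, and projective
  objects lie in \<open>T\<close>.\<close>

lemma projective_cover_T:
  assumes "X \<in> C"
  obtains \<Omega> P \<kappa> \<pi> where "P \<in> T" "conflation D C \<Omega> P X \<kappa> \<pi>"
  using frob assms proj_T unfolding frobenius_def by blast

text \<open>Injectives are projective in a Frobenius category, hence in \<open>T\<close>. Two
  inflations into injectives are spliced; the second is mono, so the composite \<open>I -> J\<close>
  has the same kernel as the deflation that it starts with.\<close>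

lemma injective_copresentation:
  assumes X: "X \<in> C"
  obtains I J \<iota> \<delta> where "I \<in> T" "J \<in> T" "is_kernel D X I J \<iota> \<delta>"
proof -
  have inj: "\<exists>I Z f g. I \<in> T \<and> conflation D C X I Z f g" if "X \<in> C" for X
    using frob that proj_T unfolding frobenius_def by metis
  obtain I Z f g where I: "I \<in> T" "conflation D C X I Z f g" using inj[OF X] by blast
  obtain J W f' g' where J: "J \<in> T" "conflation D C Z J W f' g'" using inj[OF conflationD(3)[OF I(2)]] by blast
  note k = kernelD[OF conflationD(4)[OF I(2)]] and k' = kernelD[OF conflationD(4)[OF J(2)]]
  have fg: "arr D I J (f' \<cdot> g)" by (rule arr_comp[OF k(2) k'(1)])
  have "is_kernel D X I J f (f' \<cdot> g)"
    unfolding is_kernel_def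
  proof (intro conjI ballI impI)
    show "X \<in> Obj D" "I \<in> Obj D" "J \<in> Obj D" "f \<in> Mor D X I" "f' \<cdot> g \<in> Mor D I J"
      using k(1) fg by (simp_all add: arr_def)
    show "(f' \<cdot> g) \<cdot> f = \<zero>\<^bsub>Hom D X J\<^esub>"
      using assoc[OF k(1,2) k'(1)] k(3) comp_zero_right[OF arr_objs(1)[OF k(1)] k'(1)] by simp
    fix W h assume W: "W \<in> Obj D" and "h \<in> Mor D W I" and z: "(f' \<cdot> g) \<cdot> h = \<zero>\<^bsub>Hom D W J\<^esub>"
    then have h: "arr D W I h" using k(1) by (simp add: arr_def)
    have "f' \<cdot> (g \<cdot> h) = f' \<cdot> \<zero>\<^bsub>Hom D W Z\<^esub>"
      using z assoc[OF h k(2) k'(1)] comp_zero_right[OF W k'(1)] by simp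
    then have "g \<cdot> h = \<zero>\<^bsub>Hom D W Z\<^esub>"
      using k'(5)[OF arr_comp[OF h k(2)] arr_zero[OF W arr_objs(1)[OF k'(1)]]] by blast
    then show "\<exists>!h'. h' \<in> Mor D W X \<and> f \<cdot> h' = h"
      using conflationD(4)[OF I(2)] W arr_mem[OF h] unfolding is_kernel_def by blast
  qed
  then show ?thesis using that I(1) J(1) by blast
qed

text \<open>A right \<open>T\<close>-approximation that is moreover a deflation, with its kernel
  recorded. The sequence 0 -> R_L -> R_E -> R_X -> 0 of right modules is then exact, which is what
  dimension shifting uses.\<close>

definition approximation :: "'o \<Rightarrow> 'o \<Rightarrow> 'o \<Rightarrow> 'm \<Rightarrow> 'm \<Rightarrow> bool" where
  "approximation L E X l p \<longleftrightarrow> conflation D C L E X l p \<and> E \<in> T \<and>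
     (\<forall>V h. V \<in> T \<longrightarrow> arr D V X h \<longrightarrow> (\<exists>h'. arr D V E h' \<and> p \<cdot> h' = h))"

text \<open>A right approximation becomes a deflation after adding a projective object.\<close>

lemma approximation_exists:
  assumes X: "X \<in> C"
  obtains L E l p where "approximation L E X l p"
proof -
  obtain \<Omega> P \<kappa> \<pi> where P: "P \<in> T" "conflation D C \<Omega> P X \<kappa> \<pi>"
    by (rule projective_cover_T[OF X]) (rule that)
  have "\<exists>Y \<in> T. \<exists>f \<in> Mor D Y X. \<forall>X' \<in> T. \<forall>h \<in> Mor D X' X. \<exists>h' \<in> Mor D X' Y. f \<cdot> h' = h"
    using ff_T X unfolding functorially_finite_def by simp
  then obtain Y t where Y: "Y \<in> T" and t: "t \<in> Mor D Y X"
    and ap: "\<And>V h. \<lbrakk>V \<in> T; h \<in> Mor D V X\<rbrakk> \<Longrightarrow> \<exists>h' \<in> Mor D V Y. t \<cdot> h' = h"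
    by blast
  have ta: "arr D Y X t" using t Y X T_Obj C_Obj by (simp add: arr_def)
  obtain L E l p j where con: "conflation D C L E X l p" and E: "is_direct_sum (full_subcat D C) E P Y"
    and j: "arr D Y E j" "p \<cdot> j = t"
    using enlarge_deflation[OF ext_closed P(2) T_C[OF Y] ta] by blast
  have "E \<in> T" using T_direct_sum[OF E] P(1) Y by blast
  have p: "arr D E X p" using kernelD(2)[OF conflationD(4)[OF con]] .
  have "\<exists>h'. arr D V E h' \<and> p \<cdot> h' = h" if V: "V \<in> T" and h: "arr D V X h" for V h
  proof -
    obtain h' where "h' \<in> Mor D V Y" "t \<cdot> h' = h" using ap[OF V arr_mem[OF h]] by blast
    then have h': "arr D V Y h'" "t \<cdot> h' = h" using V Y T_Obj by (simp_all add: arr_def)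
    then show ?thesis using arr_comp[OF h'(1) j(1)] assoc[OF h'(1) j(1) p] j(2) by metis
  qed
  then show ?thesis using that con \<open>E \<in> T\<close> unfolding approximation_def by blast
qed

lemma approximationD:
  assumes "approximation L E X l p"
  shows "L \<in> C" "E \<in> T" "X \<in> C" "conflation D C L E X l p" "is_kernel D L E X l p"
    and "\<lbrakk>V \<in> T; arr D V X h\<rbrakk> \<Longrightarrow> \<exists>h'. arr D V E h' \<and> p \<cdot> h' = h"
  using assms conflationD[of D C L E X l p] by (simp_all add: approximation_def)

text \<open>
  Write \<open>R\<^sub>X = Hom(-, X)\<close> for the right \<open>T\<close>-module given by \<open>X \<in> C\<close>. Since \<open>0 \<rightarrow> R\<^sub>X \<rightarrow> R\<^sub>I \<rightarrow> R\<^sub>J\<close> is exact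
  with \<open>I, J \<in> T\<close>, dimension shifting gives \<open>Tor\<^sub>2(R\<^sub>X, S) = Tor\<^sub>4(R\<^sub>J / im R\<^sub>I, S) = 0\<close> for a simple
  functor \<open>S\<close>; and an approximation \<open>L \<rightarrow> E \<rightarrow> X\<close> gives \<open>Tor\<^sub>1(R\<^sub>L, S) = Tor\<^sub>2(R\<^sub>X, S)\<close>. The next lemma
  spells out this vanishing of \<open>Tor\<^sub>1\<close>.
\<close>

lemma tor_vanishing:
  assumes X: "X \<in> C" and ap: "approximation L E X l p"
    and Y: "\<And>n. Y n \<in> T" and u: "\<And>n. arr D (Y n) (Y (Suc n)) (u n)" and e: "\<And>n. arr D (Y n) (Y n) (e n)"
    and uu: "\<And>n. u (Suc n) \<cdot> u n = \<zero>\<^bsub>Hom D (Y n) (Y (Suc (Suc n)))\<^esub>"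
    and ex: "\<And>n V a. \<lbrakk>V \<in> T; arr D (Y (Suc n)) V a; a \<cdot> e (Suc n) = a; a \<cdot> u n = \<zero>\<^bsub>Hom D (Y n) V\<^esub>\<rbrakk>
      \<Longrightarrow> \<exists>c. arr D (Y (Suc (Suc n))) V c \<and> c \<cdot> e (Suc (Suc n)) = c \<and> a = c \<cdot> u (Suc n)"
    and van: "\<And>n V a. \<lbrakk>n > 3; V \<in> T; arr D (Y n) V a; a \<cdot> e n = a\<rbrakk> \<Longrightarrow> a = \<zero>\<^bsub>Hom D (Y n) V\<^esub>"
    and a: "arr D (Y 1) L a" "a \<cdot> e 1 = a" "a \<cdot> u 0 = \<zero>\<^bsub>Hom D (Y 0) L\<^esub>"
  shows "\<exists>c. arr D (Y 2) L c \<and> a = c \<cdot> u 1"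
proof -
  have u': "arr D (Y 0) (Y 1) (u 0)" "arr D (Y 1) (Y 2) (u 1)" "arr D (Y 2) (Y 3) (u 2)" "arr D (Y 3) (Y 4) (u 3)"
    using u[of 0] u[of 1] u[of 2] u[of 3] by (simp_all add: eval_nat_numeral)
  have uu': "u 2 \<cdot> u 1 = \<zero>\<^bsub>Hom D (Y 1) (Y 3)\<^esub>" using uu[of 1] by (simp add: eval_nat_numeral)
  have ex0: "\<exists>c. arr D (Y 2) V c \<and> c \<cdot> e 2 = c \<and> a = c \<cdot> u 1"
    if "V \<in> T" "arr D (Y 1) V a" "a \<cdot> e 1 = a" "a \<cdot> u 0 = \<zero>\<^bsub>Hom D (Y 0) V\<^esub>" for V a
    using ex[of V 0 a] that by (simp add: eval_nat_numeral)
  have ex1: "\<exists>c. arr D (Y 3) V c \<and> c \<cdot> e 3 = c \<and> a = c \<cdot> u 2"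
    if "V \<in> T" "arr D (Y 2) V a" "a \<cdot> e 2 = a" "a \<cdot> u 1 = \<zero>\<^bsub>Hom D (Y 1) V\<^esub>" for V a
    using ex[of V 1 a] that by (simp add: eval_nat_numeral)
  \<comment> \<open>Here the bound 3 enters: a cycle in degree 3 is a boundary from degree 4, where
    the resolution vanishes.\<close>
  have ex2: "a = \<zero>\<^bsub>Hom D (Y 3) V\<^esub>"
    if V: "V \<in> T" and h: "arr D (Y 3) V a" "a \<cdot> e 3 = a" "a \<cdot> u 2 = \<zero>\<^bsub>Hom D (Y 2) V\<^esub>" for V a
  proof -
    obtain c where "arr D (Y 4) V c" "c \<cdot> e 4 = c" "a = c \<cdot> u 3"
      using ex[of V 2 a] V h by (auto simp: eval_nat_numeral)
    then show ?thesis using van[of 4 V c] V comp_zero_left[OF T_Obj[OF V] u'(4)] by simp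
  qed
  note A = approximationD[OF ap]
  note k = kernelD[OF A(5)]
  obtain I J \<iota> \<delta> where I: "I \<in> T" and J: "J \<in> T" and "is_kernel D X I J \<iota> \<delta>"
    by (rule injective_copresentation[OF X]) (rule that)
  note i = kernelD[OF \<open>is_kernel D X I J \<iota> \<delta>\<close>]
  \<comment> \<open>Tor_2 of R_X: in \<open>I\<close> the cycle \<open>a\<close> becomes a boundary
    \<open>c u 2\<close>. The image \<open>\<delta> c\<close> is a cycle of degree 3 with values in
    \<open>J\<close>, hence zero, so \<open>c\<close> comes from \<open>X\<close>.\<close>
  have tor2: "\<exists>b. arr D (Y 3) X b \<and> a = b \<cdot> u 2"
    if a: "arr D (Y 2) X a" "a \<cdot> e 2 = a" "a \<cdot> u 1 = \<zero>\<^bsub>Hom D (Y 1) X\<^esub>" for a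
  proof -
    have ia: "arr D (Y 2) I (\<iota> \<cdot> a)" by (rule arr_comp[OF a(1) i(1)])
    have "(\<iota> \<cdot> a) \<cdot> e 2 = \<iota> \<cdot> a" using assoc[OF e a(1) i(1)] a(2) by simp
    moreover have "(\<iota> \<cdot> a) \<cdot> u 1 = \<zero>\<^bsub>Hom D (Y 1) I\<^esub>"
      using assoc[OF u'(2) a(1) i(1)] a(3) comp_zero_right[OF T_Obj[OF Y] i(1)] by simp
    ultimately obtain c where c: "arr D (Y 3) I c" "c \<cdot> e 3 = c" "\<iota> \<cdot> a = c \<cdot> u 2" using ex1[OF I ia] by blast
    have dc: "arr D (Y 3) J (\<delta> \<cdot> c)" by (rule arr_comp[OF c(1) i(2)])
    have "(\<delta> \<cdot> c) \<cdot> e 3 = \<delta> \<cdot> c" using assoc[OF e c(1) i(2)] c(2) by simp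
    moreover have "(\<delta> \<cdot> c) \<cdot> u 2 = \<zero>\<^bsub>Hom D (Y 2) J\<^esub>"
      using assoc[OF u'(3) c(1) i(2)] c(3) assoc[OF a(1) i(1,2)] i(3) comp_zero_left[OF T_Obj[OF J] a(1)] by simp
    ultimately have "\<delta> \<cdot> c = \<zero>\<^bsub>Hom D (Y 3) J\<^esub>" using ex2[OF J dc] by blast
    then obtain b where b: "arr D (Y 3) X b" "\<iota> \<cdot> b = c" using i(4)[OF c(1)] by blast
    have "\<iota> \<cdot> a = \<iota> \<cdot> (b \<cdot> u 2)" using c(3) b(2) assoc[OF u'(3) b(1) i(1)] by simp
    then show ?thesis using i(5)[OF a(1) arr_comp[OF u'(3) b(1)]] b(1) by blast
  qed
  \<comment> \<open>The connecting map into Tor_2: \<open>l a\<close> is the boundary of some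
    \<open>c\<close> with values in \<open>E\<close>, and \<open>p c\<close> is a cycle of degree 2
    with values in \<open>X\<close>.\<close>
  have la: "arr D (Y 1) E (l \<cdot> a)" by (rule arr_comp[OF a(1) k(1)])
  have "(l \<cdot> a) \<cdot> e 1 = l \<cdot> a" using assoc[OF e a(1) k(1)] a(2) by simp
  moreover have "(l \<cdot> a) \<cdot> u 0 = \<zero>\<^bsub>Hom D (Y 0) E\<^esub>"
    using assoc[OF u'(1) a(1) k(1)] a(3) comp_zero_right[OF T_Obj[OF Y] k(1)] by simp
  ultimately obtain c where c: "arr D (Y 2) E c" "c \<cdot> e 2 = c" "l \<cdot> a = c \<cdot> u 1" using ex0[OF A(2) la] by blast
  have pc: "arr D (Y 2) X (p \<cdot> c)" by (rule arr_comp[OF c(1) k(2)])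
  have "(p \<cdot> c) \<cdot> e 2 = p \<cdot> c" using assoc[OF e c(1) k(2)] c(2) by simp
  moreover have "(p \<cdot> c) \<cdot> u 1 = \<zero>\<^bsub>Hom D (Y 1) X\<^esub>"
    using assoc[OF u'(2) c(1) k(2)] c(3) assoc[OF a(1) k(1,2)] k(3) comp_zero_left[OF arr_objs(2)[OF k(2)] a(1)] by simp
  ultimately obtain b where b: "arr D (Y 3) X b" "p \<cdot> c = b \<cdot> u 2" using tor2[OF pc] by blast
  \<comment> \<open>Lifting \<open>b\<close> through the approximation and subtracting
    \<open>b' u 2\<close> moves \<open>c\<close> into \<open>L\<close>; as
    \<open>u 2 u 1 = 0\<close>, the boundary stays \<open>l a\<close>.\<close>
  obtain b' where b': "arr D (Y 3) E b'" "p \<cdot> b' = b" using A(6)[OF Y b(1)] by blast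
  have bu: "arr D (Y 2) E (b' \<cdot> u 2)" by (rule arr_comp[OF u'(3) b'(1)])
  have "p \<cdot> (c \<ominus>\<^bsub>Hom D (Y 2) E\<^esub> b' \<cdot> u 2) = \<zero>\<^bsub>Hom D (Y 2) X\<^esub>"
    using comp_diff_right[OF c(1) bu k(2)] assoc[OF u'(3) b'(1) k(2)] b'(2) b(2) diff_self[OF pc] by simp
  then obtain h where h: "arr D (Y 2) L h" "l \<cdot> h = c \<ominus>\<^bsub>Hom D (Y 2) E\<^esub> b' \<cdot> u 2"
    using k(4)[OF arr_minus[OF c(1) bu]] by blast
  have "l \<cdot> (h \<cdot> u 1) = (c \<ominus>\<^bsub>Hom D (Y 2) E\<^esub> b' \<cdot> u 2) \<cdot> u 1" using assoc[OF u'(2) h(1) k(1)] h(2) by simp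
  also have "\<dots> = l \<cdot> a"
    using comp_diff_left[OF u'(2) c(1) bu] c(3) assoc[OF u'(2,3) b'(1)] uu' comp_zero_right[OF T_Obj[OF Y] b'(1)]
      diff_zero[OF la] by simp
  finally have "a = h \<cdot> u 1" using k(5)[OF a(1) arr_comp[OF u'(2) h(1)]] by simp
  then show ?thesis using h(1) by blast
qed

text \<open>Let N be the kernel of R_E' -> R_L, generated by \<open>\<nu>\<close>. Tensoring N with
  the simple functor S at \<open>Z\<close> gives N(Z) modulo N rad, so Tor_1(R_L, S) = 0 means that
  an element of N(Z) that is radical as a map to \<open>E'\<close> already lies in N rad, that is,
  in \<open>\<nu>\<close> composed with the radical.\<close>

lemma radical_factorization:
  assumes X: "X \<in> C" and ap: "approximation L E X l p" and ap': "approximation L' E' L l' p'"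
    and V: "V \<in> T" "arr D V E' \<nu>"
    and \<nu>: "\<And>W n. \<lbrakk>W \<in> T; arr D W E' n; p' \<cdot> n = \<zero>\<^bsub>Hom D W L\<^esub>\<rbrakk> \<Longrightarrow> \<exists>n'. arr D W V n' \<and> n = \<nu> \<cdot> n'"
    and Z: "Z \<in> T" and l: "local_ring (End_ring D Z)"
    and f: "f \<in> cat_radical D Z E'" and pf: "p' \<cdot> f = \<zero>\<^bsub>Hom D Z L\<^esub>"
  shows "\<exists>r \<in> cat_radical D Z V. f = \<nu> \<cdot> r"
proof -
  note A = approximationD[OF ap']
  note k = kernelD[OF A(5)]
  have E': "E' \<in> T" using A(2) .
  have fa: "arr D Z E' f" using radical_arr[OF f T_Obj[OF Z] T_Obj[OF E']] .
  obtain Y e u z y where Y: "\<And>n. Y n \<in> T" and u: "\<And>n. arr D (Y n) (Y (Suc n)) (u n)"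
    and e: "\<And>n. arr D (Y n) (Y n) (e n)"
    and uu: "\<And>n. u (Suc n) \<cdot> u n = \<zero>\<^bsub>Hom D (Y n) (Y (Suc (Suc n)))\<^esub>"
    and ex: "\<And>n V a. \<lbrakk>V \<in> T; arr D (Y (Suc n)) V a; a \<cdot> e (Suc n) = a; a \<cdot> u n = \<zero>\<^bsub>Hom D (Y n) V\<^esub>\<rbrakk>
      \<Longrightarrow> \<exists>c. arr D (Y (Suc (Suc n))) V c \<and> c \<cdot> e (Suc (Suc n)) = c \<and> a = c \<cdot> u (Suc n)"
    and van: "\<And>n V a. \<lbrakk>n > 3; V \<in> T; arr D (Y n) V a; a \<cdot> e n = a\<rbrakk> \<Longrightarrow> a = \<zero>\<^bsub>Hom D (Y n) V\<^esub>"
    and z: "arr D (Y 0) Z z" and y: "arr D Z (Y 0) y" and zy: "endo_unit D Z (z \<cdot> y)"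
    and uy: "u 0 \<cdot> y \<in> cat_radical D Z (Y 1)"
    and rad: "\<And>V f. \<lbrakk>V \<in> T; f \<in> cat_radical D Z V\<rbrakk>
      \<Longrightarrow> \<exists>g. arr D (Y 1) V g \<and> g \<cdot> e 1 = g \<and> g \<cdot> u 0 = f \<cdot> z"
    by (rule resolution[OF Z l]) (rule that)
  have u': "arr D (Y 0) (Y 1) (u 0)" "arr D (Y 1) (Y 2) (u 1)"
    using u[of 0] u[of 1] by (simp_all add: eval_nat_numeral)
  have uu': "u 1 \<cdot> u 0 = \<zero>\<^bsub>Hom D (Y 0) (Y 2)\<^esub>" using uu[of 0] by (simp add: eval_nat_numeral)
  \<comment> \<open>\<open>g\<close> extends \<open>f z\<close> along \<open>u 0\<close>, and
    \<open>p' g\<close> is a cycle of degree 1 with values in \<open>L\<close>, to which the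
    vanishing of Tor applies.\<close>
  obtain g where g: "arr D (Y 1) E' g" "g \<cdot> e 1 = g" "g \<cdot> u 0 = f \<cdot> z" using rad[OF E' f] by blast
  have pg: "arr D (Y 1) L (p' \<cdot> g)" by (rule arr_comp[OF g(1) k(2)])
  have "(p' \<cdot> g) \<cdot> e 1 = p' \<cdot> g" using assoc[OF e g(1) k(2)] g(2) by simp
  moreover have "(p' \<cdot> g) \<cdot> u 0 = \<zero>\<^bsub>Hom D (Y 0) L\<^esub>"
    using assoc[OF u'(1) g(1) k(2)] g(3) assoc[OF z fa k(2)] pf comp_zero_left[OF arr_objs(2)[OF k(2)] z] by simp
  ultimately obtain c where c: "arr D (Y 2) L c" "p' \<cdot> g = c \<cdot> u 1"
    using tor_vanishing[OF X ap Y u e uu ex van pg] by blast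
  obtain c' where c': "arr D (Y 2) E' c'" "p' \<cdot> c' = c" using A(6)[OF Y c(1)] by blast
  have cu: "arr D (Y 1) E' (c' \<cdot> u 1)" by (rule arr_comp[OF u'(2) c'(1)])
  \<comment> \<open>As \<open>c'\<close> lifts \<open>c\<close>, the difference is killed by
    \<open>p'\<close> and factors through \<open>\<nu>\<close>; the correction leaves
    \<open>?n u 0 = f z\<close> because \<open>u 1 u 0 = 0\<close>.\<close>
  let ?n = "g \<ominus>\<^bsub>Hom D (Y 1) E'\<^esub> c' \<cdot> u 1"
  have n: "arr D (Y 1) E' ?n" by (rule arr_minus[OF g(1) cu])
  have "p' \<cdot> ?n = \<zero>\<^bsub>Hom D (Y 1) L\<^esub>"
    using comp_diff_right[OF g(1) cu k(2)] assoc[OF u'(2) c'(1) k(2)] c'(2) c(2) diff_self[OF pg] by simp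
  then obtain n' where n': "arr D (Y 1) V n'" "?n = \<nu> \<cdot> n'" using \<nu>[OF Y n] by blast
  have fz: "arr D (Y 0) E' (f \<cdot> z)" by (rule arr_comp[OF z fa])
  have nu0: "?n \<cdot> u 0 = f \<cdot> z"
    using comp_diff_left[OF u'(1) g(1) cu] g(3) assoc[OF u'(1,2) c'(1)] uu' comp_zero_right[OF T_Obj[OF Y] c'(1)]
      diff_zero[OF fz] by simp
  obtain w where w: "arr D Z Z w" "(z \<cdot> y) \<cdot> w = Idn D Z" using zy by (auto simp: endo_unit_def)
  \<comment> \<open>Cancelling the unit \<open>z y\<close> in \<open>f z y = \<nu> n' u 0 y\<close>
    leaves \<open>\<nu>\<close> after a map that contains the radical factor
    \<open>u 0 y\<close>.\<close>
  let ?r = "(n' \<cdot> (u 0 \<cdot> y)) \<cdot> w"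
  have uya: "arr D Z (Y 1) (u 0 \<cdot> y)" by (rule arr_comp[OF y u'(1)])
  have nuy: "arr D Z V (n' \<cdot> (u 0 \<cdot> y))" by (rule arr_comp[OF uya n'(1)])
  have "?r \<in> cat_radical D Z V"
    using radical_comp_right[OF radical_comp_left[OF uy n'(1) T_Obj[OF Z]] w(1) T_Obj[OF V(1)]] .
  moreover have "\<nu> \<cdot> ?r = f"
  proof -
    have "\<nu> \<cdot> (n' \<cdot> (u 0 \<cdot> y)) = (?n \<cdot> u 0) \<cdot> y"
      using assoc[OF uya n'(1) V(2)] n'(2) assoc[OF y u'(1) n] by simp
    also have "\<dots> = f \<cdot> (z \<cdot> y)" using nu0 assoc[OF y z fa] by simp
    finally show ?thesis
      using assoc[OF w(1) nuy V(2)] assoc[OF w(1) arr_comp[OF y z] fa] w(2) idr[OF fa] by simp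
  qed
  ultimately show ?thesis by metis
qed

end

section \<open>Minimal approximations and Nakayama's lemma\<close>

context gl_dim_three_subcat
begin

text \<open>
  Each nonradical \<open>f : Z \<rightarrow> E\<close> in \<open>e E\<close> that is killed by \<open>p\<close> splits off a summand \<open>f g e\<close> of \<open>e\<close>. The
  summands split off in succession are linearly independent, so this stops.
\<close>

lemma minimal_idempotent:
  assumes E: "E \<in> T" and p: "arr D E L p"
  obtains e where "arr D E E e" "e \<cdot> e = e" "p \<cdot> e = p"
    and "\<And>Z f. \<lbrakk>Z \<in> T; local_ring (End_ring D Z); arr D Z E f; e \<cdot> f = f; p \<cdot> f = \<zero>\<^bsub>Hom D Z L\<^esub>\<rbrakk>
      \<Longrightarrow> f \<in> cat_radical D Z E"
proof -
  have Eo: "E \<in> Obj D" using T_Obj[OF E] .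
  interpret V: vectorspace K "Hom D E E" using A.hom_vs[of E E] E by simp
  have fd: "V.fin_dim" using A.hom_fin_dim[of E E] E by simp
  \<comment> \<open>\<open>e\<close> is the idempotent still to be reduced and \<open>S\<close>
    stands for the idempotents already split off, all killed by \<open>e\<close>. Independence
    bounds the size of \<open>S\<close> by the dimension of End(E), so a pair with \<open>S\<close>
    as large as possible exists.\<close>
  define Q where "Q eS \<longleftrightarrow> (case eS of (e, S) \<Rightarrow> arr D E E e \<and> e \<cdot> e = e \<and> p \<cdot> e = p \<and>
      S \<subseteq> Mor D E E \<and> V.lin_indpt S \<and> (\<forall>s \<in> S. e \<cdot> s = \<zero>\<^bsub>Hom D E E\<^esub>))" for eS
  have Q0: "Q (Idn D E, {})"
    using arr_id[OF Eo] idl[OF arr_id[OF Eo]] idr[OF p] by (simp add: Q_def V.lin_dep_def)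
  have "\<forall>eS. Q eS \<longrightarrow> card (snd eS) < Suc V.dim"
    using V.li_le_dim(2)[OF fd] by (auto simp: Q_def less_Suc_eq_le)
  from ex_has_greatest_nat[OF Q0 this] obtain eS
    where eS: "Q eS" and max: "\<forall>eS'. Q eS' \<longrightarrow> card (snd eS') \<le> card (snd eS)"
    by blast
  obtain e S where "eS = (e, S)" by (cases eS)
  with eS have e: "arr D E E e" "e \<cdot> e = e" "p \<cdot> e = p" and S: "S \<subseteq> Mor D E E" "V.lin_indpt S"
    and eS0: "\<And>s. s \<in> S \<Longrightarrow> e \<cdot> s = \<zero>\<^bsub>Hom D E E\<^esub>" by (simp_all add: Q_def)
  have finS: "finite S" using V.li_le_dim(1)[OF fd S] .
  show ?thesis
  proof (rule that[OF e], rule ccontr)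
    fix Z f assume Z: "Z \<in> T" and l: "local_ring (End_ring D Z)" and f: "arr D Z E f" and ef: "e \<cdot> f = f"
      and pf: "p \<cdot> f = \<zero>\<^bsub>Hom D Z L\<^esub>" and nr: "f \<notin> cat_radical D Z E"
    have Zo: "Z \<in> Obj D" using T_Obj[OF Z] .
    note iZ = arr_id[OF Zo]
    obtain g where g: "arr D E Z g" and nu: "\<not> endo_unit D Z (Idn D Z \<ominus>\<^bsub>Hom D Z Z\<^esub> g \<cdot> f)"
      using nr f mem_cat_radical[OF Zo Eo] by blast
    have gf: "arr D Z Z (g \<cdot> f)" by (rule arr_comp[OF f g])
    \<comment> \<open>In a local ring one of two summands of 1 is invertible, and
      \<open>1 - g f\<close> is not.\<close>
    have "endo_unit D Z (g \<cdot> f)"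
      using local_ringD(2)[OF l Zo arr_minus[OF iZ gf] gf] diff_add[OF iZ gf] endo_unit_id[OF Zo] nu by simp
    then obtain w where w: "arr D Z Z w" "w \<cdot> (g \<cdot> f) = Idn D Z" by (auto simp: endo_unit_def)
    \<comment> \<open>A left inverse of \<open>f\<close> adapted to \<open>e\<close>. Then
      \<open>x = f h\<close> is an idempotent below \<open>e\<close> and killed by \<open>p\<close>,
      so passing from \<open>e\<close> to \<open>e - x\<close> keeps all conditions and lets
      \<open>S\<close> grow.\<close>
    define h where "h = (w \<cdot> g) \<cdot> e"
    have wg: "arr D E Z (w \<cdot> g)" by (rule arr_comp[OF g w(1)])
    have h: "arr D E Z h" unfolding h_def by (rule arr_comp[OF e(1) wg])
    have hf: "h \<cdot> f = Idn D Z"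
      unfolding h_def using assoc[OF f e(1) wg] ef assoc[OF f g w(1)] w(2) by simp
    have he: "h \<cdot> e = h" unfolding h_def using assoc[OF e(1) e(1) wg] e(2) by simp
    define x where "x = f \<cdot> h"
    have x: "arr D E E x" unfolding x_def by (rule arr_comp[OF h f])
    have ex: "e \<cdot> x = x" unfolding x_def using assoc[OF h f e(1)] ef by simp
    have xe: "x \<cdot> e = x" unfolding x_def using assoc[OF e(1) h f] he by simp
    have xx: "x \<cdot> x = x" using assoc[OF x h f] assoc[OF h f h] hf idl[OF h] by (simp add: x_def)
    let ?e = "e \<ominus>\<^bsub>Hom D E E\<^esub> x"
    have e': "arr D E E ?e" by (rule arr_minus[OF e(1) x])
    have "?e \<cdot> x = \<zero>\<^bsub>Hom D E E\<^esub>" using comp_diff_left[OF x e(1) x] ex xx diff_self[OF x] by simp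
    moreover have "?e \<cdot> e = ?e" using comp_diff_left[OF e(1) e(1) x] e(2) xe by simp
    ultimately have "?e \<cdot> ?e = ?e" using comp_diff_right[OF e(1) x e'] diff_zero[OF e'] by simp
    moreover have "p \<cdot> ?e = p"
      using comp_diff_right[OF e(1) x p] e(3) assoc[OF h f p] pf comp_zero_left[OF arr_objs(2)[OF p] h] diff_zero[OF p]
      by (simp add: x_def)
    moreover have "?e \<cdot> s = \<zero>\<^bsub>Hom D E E\<^esub>" if s: "s \<in> insert x S" for s
    proof (cases "s = x")
      case False
      then have sS: "s \<in> S" using s by simp
      then have sa: "arr D E E s" using S(1) Eo by (auto simp: arr_def)
      have "x \<cdot> s = (x \<cdot> e) \<cdot> s" using xe by simp
      also have "\<dots> = \<zero>\<^bsub>Hom D E E\<^esub>" using assoc[OF sa e(1) x] eS0[OF sS] comp_zero_right[OF Eo x] by simp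
      finally show ?thesis using comp_diff_left[OF sa e(1) x] eS0[OF sS] diff_self[OF arr_zero[OF Eo Eo]] by simp
    qed (use \<open>?e \<cdot> x = \<zero>\<^bsub>Hom D E E\<^esub>\<close> in simp)
    \<comment> \<open>\<open>e\<close> annihilates the span of \<open>S\<close>, while
      \<open>e x = x\<close> is nonzero.\<close>
    moreover have "x \<notin> V.span S"
    proof
      assume xs: "x \<in> V.span S"
      have "submodule K {s \<in> Mor D E E. e \<cdot> s = \<zero>\<^bsub>Hom D E E\<^esub>} (Hom D E E)"
      proof (rule LinearCombinations.submodule.intro)
        show "Module.module K (Hom D E E)" by (rule V.module_axioms)
      next
        fix v w assume "v \<in> {s \<in> Mor D E E. e \<cdot> s = \<zero>\<^bsub>Hom D E E\<^esub>}" "w \<in> {s \<in> Mor D E E. e \<cdot> s = \<zero>\<^bsub>Hom D E E\<^esub>}"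
        then have v: "arr D E E v" "e \<cdot> v = \<zero>\<^bsub>Hom D E E\<^esub>" and w: "arr D E E w" "e \<cdot> w = \<zero>\<^bsub>Hom D E E\<^esub>"
          using Eo by (simp_all add: arr_def)
        then show "v \<oplus>\<^bsub>Hom D E E\<^esub> w \<in> {s \<in> Mor D E E. e \<cdot> s = \<zero>\<^bsub>Hom D E E\<^esub>}"
          using comp_add_right[OF v(1) w(1) e(1)] arr_mem[OF arr_add[OF v(1) w(1)]] by simp
      next
        fix c v assume c: "c \<in> carrier K" and "v \<in> {s \<in> Mor D E E. e \<cdot> s = \<zero>\<^bsub>Hom D E E\<^esub>}"
        then have v: "arr D E E v" "e \<cdot> v = \<zero>\<^bsub>Hom D E E\<^esub>" using Eo by (simp_all add: arr_def)
        have "e \<cdot> (c \<odot>\<^bsub>Hom D E E\<^esub> v) = c \<odot>\<^bsub>Hom D E E\<^esub> (e \<cdot> v)"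
          using A.comp_smult_r[of c E E v E e] c v(1) e(1) E by (simp add: arr_T)
        then show "c \<odot>\<^bsub>Hom D E E\<^esub> v \<in> {s \<in> Mor D E E. e \<cdot> s = \<zero>\<^bsub>Hom D E E\<^esub>}"
          using v c arr_mem[OF v(1)] by simp
      qed (use comp_zero_right[OF Eo e(1)] in auto)
      then have "V.span S \<subseteq> {s \<in> Mor D E E. e \<cdot> s = \<zero>\<^bsub>Hom D E E\<^esub>}"
        by (rule V.span_is_subset[rotated]) (use S(1) eS0 in auto)
      then have "x = \<zero>\<^bsub>Hom D E E\<^esub>" using xs ex by auto
      then have "f = \<zero>\<^bsub>Hom D Z E\<^esub>"
        using assoc[OF f h f] hf idr[OF f] comp_zero_left[OF Eo f] by (simp add: x_def)
      then show False using hf comp_zero_right[OF Zo h] local_ringD(1)[OF l Zo] by simp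
    qed
    ultimately have "Q (?e, insert x S)"
      using e' S V.insert_lin_indpt[OF S arr_mem[OF x]] arr_mem[OF x] by (simp add: Q_def)
    then have "card (insert x S) \<le> card S" using max \<open>eS = (e, S)\<close> by fastforce
    moreover have "x \<notin> S" using \<open>x \<notin> V.span S\<close> V.span_mem[OF S(1)] by blast
    ultimately show False using finS by simp
  qed
qed

text \<open>By Nakayama's lemma the minimal idempotent \<open>e\<close> kills every map from
  \<open>T\<close> to \<open>E'\<close> that \<open>p'\<close> kills, so the part of
  \<open>E'\<close> cut out by \<open>e\<close> and the object \<open>L\<close> receive the same
  maps from \<open>T\<close>. A presentation of \<open>L\<close> by projectives turns this
  comparison of modules into an actual section.\<close>

lemma approximation_of_kernel_splits:
  assumes X: "X \<in> C" and ap: "approximation L E X l p" and ap': "approximation L' E' L l' p'"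
  shows "\<exists>t. arr D L E' t \<and> p' \<cdot> t = Idn D L"
proof -
  note A' = approximationD[OF ap']
  note k' = kernelD[OF A'(5)]
  have Lo: "L \<in> Obj D" and E'o: "E' \<in> Obj D" using k'(2) by (simp_all add: arr_def)
  obtain L'' V l'' q where aq: "approximation L'' V L' l'' q"
    by (rule approximation_exists[OF A'(1)]) (rule that)
  note Aq = approximationD[OF aq]
  note kq = kernelD[OF Aq(5)]
  have V: "V \<in> T" using Aq(2) .
  \<comment> \<open>An approximation of the kernel \<open>L'\<close> of \<open>p'\<close> yields a
    single map through which all maps from \<open>T\<close> killed by \<open>p'\<close>
    factor.\<close>
  define \<nu> where "\<nu> = l' \<cdot> q"
  have \<nu>: "arr D V E' \<nu>" unfolding \<nu>_def by (rule arr_comp[OF kq(2) k'(1)])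
  have p\<nu>: "p' \<cdot> \<nu> = \<zero>\<^bsub>Hom D V L\<^esub>"
    unfolding \<nu>_def using assoc[OF kq(2) k'(1,2)] k'(3) comp_zero_left[OF Lo kq(2)] by simp
  have gen: "\<exists>n'. arr D W V n' \<and> n = \<nu> \<cdot> n'"
    if W: "W \<in> T" and n: "arr D W E' n" "p' \<cdot> n = \<zero>\<^bsub>Hom D W L\<^esub>" for W n
  proof -
    obtain m where m: "arr D W L' m" "l' \<cdot> m = n" using k'(4)[OF n] by blast
    obtain m' where m': "arr D W V m'" "q \<cdot> m' = m" using Aq(6)[OF W m(1)] by blast
    show ?thesis unfolding \<nu>_def using m'(1) assoc[OF m'(1) kq(2) k'(1)] m'(2) m(2) by metis
  qed
  obtain e where e: "arr D E' E' e" "e \<cdot> e = e" "p' \<cdot> e = p'"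
    and rad: "\<And>Z f. \<lbrakk>Z \<in> T; local_ring (End_ring D Z); arr D Z E' f; e \<cdot> f = f; p' \<cdot> f = \<zero>\<^bsub>Hom D Z L\<^esub>\<rbrakk>
      \<Longrightarrow> f \<in> cat_radical D Z E'"
    by (rule minimal_idempotent[OF A'(2) k'(2)]) (rule that)
  \<comment> \<open>The source is treated summand by summand, since
    \<open>radical_factorization\<close> concerns the simple functor at an object with local
    endomorphism ring; the pieces reassemble because the radical is closed under composition and
    sums.\<close>
  have fac: "\<exists>r \<in> cat_radical D W V. f = \<nu> \<cdot> r"
    if "finite_direct_sum (full_subcat D C) (\<lambda>Z. local_ring (End_ring D Z)) W"
      and "W \<in> T" "arr D W E' f" "e \<cdot> f = f" "p' \<cdot> f = \<zero>\<^bsub>Hom D W L\<^esub>" for W f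
    using that
  proof (induction arbitrary: f rule: finite_direct_sum.induct)
    case (zero X)
    have Xo: "X \<in> Obj D" and Vo: "V \<in> Obj D" using T_Obj zero V by blast+
    have "f = \<zero>\<^bsub>Hom D X E'\<^esub>"
      using zero.hyps T_C[OF A'(2)] arr_mem[OF zero.prems(2)] arr_mem[OF arr_zero[OF Xo E'o]]
      unfolding zero_object_def by auto
    then have "f = \<nu> \<cdot> \<zero>\<^bsub>Hom D X V\<^esub>" using comp_zero_right[OF Xo \<nu>] by simp
    then show ?case using radical_zero[OF Xo Vo] by blast
  next
    case (step X A B)
    have AT: "A \<in> T" and BT: "B \<in> T" using T_direct_sum[OF step.hyps(1)] step.prems(1) by blast+
    obtain i j a b where "biproduct (full_subcat D C) X A B i j a b"
      using step.hyps(1) by (auto simp: is_direct_sum_def)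
    then have bi: "biproduct D X A B i j a b" by (rule biproduct_full_subcat) (use C_Obj in blast)
    note Bi = biproductD[OF bi]
    note f = step.prems(2)
    have fi: "arr D A E' (f \<cdot> i)" and fj: "arr D B E' (f \<cdot> j)" using arr_comp f Bi by blast+
    have "e \<cdot> (f \<cdot> i) = f \<cdot> i" "p' \<cdot> (f \<cdot> i) = \<zero>\<^bsub>Hom D A L\<^esub>"
      using assoc[OF Bi(1) f e(1)] assoc[OF Bi(1) f k'(2)] step.prems(3,4) comp_zero_left[OF Lo Bi(1)] by simp_all
    then obtain r where r: "r \<in> cat_radical D A V" "f \<cdot> i = \<nu> \<cdot> r"
      using radical_factorization[OF X ap ap' V \<nu> gen AT step.hyps(2) rad[OF AT step.hyps(2) fi]] by blast
    have "e \<cdot> (f \<cdot> j) = f \<cdot> j" "p' \<cdot> (f \<cdot> j) = \<zero>\<^bsub>Hom D B L\<^esub>"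
      using assoc[OF Bi(2) f e(1)] assoc[OF Bi(2) f k'(2)] step.prems(3,4) comp_zero_left[OF Lo Bi(2)] by simp_all
    then obtain s where s: "s \<in> cat_radical D B V" "f \<cdot> j = \<nu> \<cdot> s"
      using step.IH[OF BT fj] by blast
    have Xo: "X \<in> Obj D" and Vo: "V \<in> Obj D" using T_Obj step.prems V by blast+
    have ra: "r \<cdot> a \<in> cat_radical D X V" and sb: "s \<cdot> b \<in> cat_radical D X V"
      using radical_comp_right[OF r(1) Bi(3) Vo] radical_comp_right[OF s(1) Bi(4) Vo] .
    have r': "arr D A V r" and s': "arr D B V s" using radical_arr r s T_Obj AT BT Vo by blast+
    have "f = (f \<cdot> i) \<cdot> a \<oplus>\<^bsub>Hom D X E'\<^esub> (f \<cdot> j) \<cdot> b" by (rule biproduct_codecompose[OF bi f])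
    also have "\<dots> = \<nu> \<cdot> (r \<cdot> a \<oplus>\<^bsub>Hom D X V\<^esub> s \<cdot> b)"
      unfolding r(2) s(2) assoc[OF Bi(3) r' \<nu>] assoc[OF Bi(4) s' \<nu>]
      using comp_add_right[OF arr_comp[OF Bi(3) r'] arr_comp[OF Bi(4) s'] \<nu>] by simp
    finally show ?case using radical_add[OF ra sb Xo Vo] by blast
  qed
  have dec: "finite_direct_sum (full_subcat D C) (\<lambda>Z. local_ring (End_ring D Z)) V"
    using ks T_C[OF V] by (simp add: krull_schmidt_def)
  \<comment> \<open>Factoring \<open>e \<nu>\<close> itself gives \<open>e \<nu> = \<nu> r\<close>.
    Multiplication by \<open>e\<close> turns this into \<open>e \<nu> = (e \<nu>) r\<close>, and
    \<open>1 - r\<close> can be cancelled.\<close>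
  have e\<nu>: "arr D V E' (e \<cdot> \<nu>)" by (rule arr_comp[OF \<nu> e(1)])
  have "e \<cdot> (e \<cdot> \<nu>) = e \<cdot> \<nu>" "p' \<cdot> (e \<cdot> \<nu>) = \<zero>\<^bsub>Hom D V L\<^esub>"
    using assoc[OF \<nu> e(1) e(1)] assoc[OF \<nu> e(1) k'(2)] e p\<nu> by simp_all
  then obtain r where r: "r \<in> cat_radical D V V" "e \<cdot> \<nu> = \<nu> \<cdot> r" using fac[OF dec V e\<nu>] by blast
  have ra: "arr D V V r" using radical_arr[OF r(1)] T_Obj[OF V] by blast
  have "e \<cdot> \<nu> = (e \<cdot> \<nu>) \<cdot> r"
    using assoc[OF ra \<nu> e(1)] r(2) \<open>e \<cdot> (e \<cdot> \<nu>) = e \<cdot> \<nu>\<close> by simp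
  then have e\<nu>0: "e \<cdot> \<nu> = \<zero>\<^bsub>Hom D V E'\<^esub>" using radical_endo_cancel[OF r(1) T_Obj[OF V] e\<nu>] by blast
  have kill: "e \<cdot> n = \<zero>\<^bsub>Hom D W E'\<^esub>" if W: "W \<in> T" and n: "arr D W E' n" "p' \<cdot> n = \<zero>\<^bsub>Hom D W L\<^esub>" for W n
  proof -
    obtain n' where n': "arr D W V n'" "n = \<nu> \<cdot> n'" using gen[OF W n] by blast
    then show ?thesis using assoc[OF n'(1) \<nu> e(1)] e\<nu>0 comp_zero_left[OF E'o n'(1)] by simp
  qed
  obtain \<Omega> P \<kappa> \<pi> where P: "P \<in> T" "conflation D C \<Omega> P L \<kappa> \<pi>"
    by (rule projective_cover_T[OF approximationD(1)[OF ap]]) (rule that)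
  note kP = kernelD[OF conflationD(4)[OF P(2)]] and cP = cokernelD[OF conflationD(5)[OF P(2)]]
  \<comment> \<open>\<open>s \<kappa>\<close> starts at \<open>\<Omega>\<close>, which need not lie
    in \<open>T\<close>, whereas \<open>kill\<close> concerns sources in \<open>T\<close>. The
    deflation \<open>\<pi>'\<close> supplies such a source and, being epi, can be cancelled
    afterwards.\<close>
  obtain \<Omega>' P' \<kappa>' \<pi>' where P': "P' \<in> T" "conflation D C \<Omega>' P' \<Omega> \<kappa>' \<pi>'"
    by (rule projective_cover_T[OF conflationD(1)[OF P(2)]]) (rule that)
  note cP' = cokernelD[OF conflationD(5)[OF P'(2)]]
  obtain s where s: "arr D P E' s" "p' \<cdot> s = \<pi>" using A'(6)[OF P(1) kP(2)] by blast
  have sk: "arr D \<Omega> E' (s \<cdot> \<kappa>)" by (rule arr_comp[OF kP(1) s(1)])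
  have es: "arr D P E' (e \<cdot> s)" by (rule arr_comp[OF s(1) e(1)])
  have esk: "arr D \<Omega> E' (e \<cdot> (s \<cdot> \<kappa>))" by (rule arr_comp[OF sk e(1)])
  have \<Omega>o: "\<Omega> \<in> Obj D" and P'o: "P' \<in> Obj D" using cP'(2) by (simp_all add: arr_def)
  have "p' \<cdot> ((s \<cdot> \<kappa>) \<cdot> \<pi>') = \<zero>\<^bsub>Hom D P' L\<^esub>"
    using assoc[OF cP'(2) sk k'(2)] assoc[OF kP(1) s(1) k'(2)] s(2) kP(3) comp_zero_left[OF Lo cP'(2)] by simp
  then have "e \<cdot> ((s \<cdot> \<kappa>) \<cdot> \<pi>') = \<zero>\<^bsub>Hom D P' E'\<^esub>" using kill[OF P'(1) arr_comp[OF cP'(2) sk]] by blast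
  then have "(e \<cdot> (s \<cdot> \<kappa>)) \<cdot> \<pi>' = \<zero>\<^bsub>Hom D \<Omega> E'\<^esub> \<cdot> \<pi>'"
    using assoc[OF cP'(2) sk e(1)] comp_zero_left[OF E'o cP'(2)] by simp
  then have "e \<cdot> (s \<cdot> \<kappa>) = \<zero>\<^bsub>Hom D \<Omega> E'\<^esub>" using cP'(5)[OF esk arr_zero[OF \<Omega>o E'o]] by blast
  then have "(e \<cdot> s) \<cdot> \<kappa> = \<zero>\<^bsub>Hom D \<Omega> E'\<^esub>" using assoc[OF kP(1) s(1) e(1)] by simp
  \<comment> \<open>\<open>e s\<close> vanishes on the kernel of \<open>\<pi>\<close> and so
    descends to \<open>L\<close>; from \<open>p' e = p'\<close> the induced map is a
    section.\<close>
  then obtain t where t: "arr D L E' t" "t \<cdot> \<pi> = e \<cdot> s" using cP(4)[OF es] by blast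
  have pt: "arr D L L (p' \<cdot> t)" by (rule arr_comp[OF t(1) k'(2)])
  have "(p' \<cdot> t) \<cdot> \<pi> = Idn D L \<cdot> \<pi>"
    using assoc[OF kP(2) t(1) k'(2)] t(2) assoc[OF s(1) e(1) k'(2)] e(3) s(2) idl[OF kP(2)] by simp
  then have "p' \<cdot> t = Idn D L" using cP(5)[OF pt arr_id[OF Lo]] by blast
  then show ?thesis using t(1) by blast
qed

text \<open>So \<open>R\<^sub>X\<close> has projective dimension at most one, for every \<open>X \<in> C\<close>.\<close>

lemma kernel_of_approximation_mem:
  assumes X: "X \<in> C" and ap: "approximation L E X l p" shows "L \<in> T"
proof -
  obtain L' E' l' p' where ap': "approximation L' E' L l' p'"
    by (rule approximation_exists[OF approximationD(1)[OF ap]]) (rule that)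
  note A = approximationD[OF ap']
  obtain t where "arr D L E' t" "p' \<cdot> t = Idn D L" using approximation_of_kernel_splits[OF X ap ap'] by blast
  then have "is_direct_sum (full_subcat D C) E' L L'" using split_conflation[OF _ A(4)] C_Obj by blast
  then show ?thesis using T_direct_sum A(2) by blast
qed

end

section \<open>Vanishing of extensions\<close>

text \<open>The class of the given conflation must be the zero class, which by construction consists
  of split extensions, and a conflation belongs to its own class.\<close>

lemma ext1_vanishes_split:
  assumes v: "Ext1_vanishes D C X Y" and D: "category D" and CD: "C \<subseteq> Obj D"
    and con: "conflation D C Y E X i p"
  shows "\<exists>s \<in> Mor D X E. p \<cdot>\<^bsub>D\<^esub> s = Idn D X"
proof -
  interpret category D by fact
  have ext: "(E, i, p) \<in> extensions D C X Y" using con by (simp add: extensions_def)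
  have o: "E \<in> Obj D" "X \<in> Obj D" "Y \<in> Obj D" and m: "i \<in> Mor D Y E" "p \<in> Mor D E X"
    using con by (auto simp: conflation_def short_exact_def is_kernel_def)
  have "((E, i, p), (E, i, p)) \<in> ext_equiv D C X Y"
    using ext id_closed[OF o(1)] id_left[OF o(1,1) id_closed[OF o(1)]] id_left[OF o(3,1) m(1)] id_right[OF o(1,2) m(2)]
    unfolding ext_equiv_def by auto
  then have self: "(E, i, p) \<in> ext_equiv D C X Y `` {(E, i, p)}" by blast
  have "ext_equiv D C X Y `` {(E, i, p)} \<in> carrier (Ext1 D C X Y)"
    using ext by (simp add: Ext1_def Let_def quotientI)
  then have "ext_equiv D C X Y `` {(E, i, p)} = \<zero>\<^bsub>Ext1 D C X Y\<^esub>"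
    using v by (simp add: Ext1_vanishes_def)
  with self show ?thesis by (simp add: Ext1_def Let_def)
qed

text \<open>The dual of a zero space has only one element: a functional sends zero to zero and is
  extensional. The bijection \<open>\<Phi> X Y\<close> transports this to
  \<open>Ext1 D C X Y\<close>.\<close>

lemma two_calabi_yau_vanishes:
  assumes cy: "two_calabi_yau K D C" and X: "X \<in> C" and Y: "Y \<in> C" and v: "Ext1_vanishes D C Y X"
  shows "Ext1_vanishes D C X Y"
proof -
  let ?V = "Ext1 D C X Y" and ?W = "Ext1 D C Y X"
  obtain \<Phi> where "\<forall>X \<in> C. \<forall>Y \<in> C. linear_map K (Ext1 D C X Y) (dual_space K (Ext1 D C Y X)) (\<Phi> X Y) \<and>
      bij_betw (\<Phi> X Y) (carrier (Ext1 D C X Y)) (carrier (dual_space K (Ext1 D C Y X)))"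
    using cy unfolding two_calabi_yau_def by (elim conjE exE) (rule that)
  then have \<Phi>: "linear_map K (Ext1 D C X Y) (dual_space K (Ext1 D C Y X)) (\<Phi> X Y)"
    and bij: "bij_betw (\<Phi> X Y) (carrier (Ext1 D C X Y)) (carrier (dual_space K (Ext1 D C Y X)))"
    if "X \<in> C" "Y \<in> C" for X Y
    using that by simp_all
  interpret V: vectorspace K ?V using linear_mapD(5)[OF \<Phi>[OF X Y]] .
  interpret W: vectorspace K ?W using linear_mapD(5)[OF \<Phi>[OF Y X]] .
  have W0: "carrier ?W = {\<zero>\<^bsub>?W\<^esub>}" using v by (simp add: Ext1_vanishes_def)
  have uniq: "\<phi> = \<psi>" if \<phi>: "\<phi> \<in> carrier (dual_space K ?W)" and \<psi>: "\<psi> \<in> carrier (dual_space K ?W)" for \<phi> \<psi>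
  proof -
    have z: "\<chi> \<zero>\<^bsub>?W\<^esub> = \<zero>\<^bsub>K\<^esub>" if "\<chi> \<in> carrier (dual_space K ?W)" for \<chi>
    proof -
      have c: "\<chi> \<zero>\<^bsub>?W\<^esub> \<in> carrier K"
        using that W.M.zero_closed by (auto simp: dual_space_def Let_def)
      have "\<forall>v \<in> carrier ?W. \<forall>w \<in> carrier ?W. \<chi> (v \<oplus>\<^bsub>?W\<^esub> w) = \<chi> v \<oplus>\<^bsub>K\<^esub> \<chi> w"
        using that by (simp add: dual_space_def Let_def)
      then have "\<chi> (\<zero>\<^bsub>?W\<^esub> \<oplus>\<^bsub>?W\<^esub> \<zero>\<^bsub>?W\<^esub>) = \<chi> \<zero>\<^bsub>?W\<^esub> \<oplus>\<^bsub>K\<^esub> \<chi> \<zero>\<^bsub>?W\<^esub>"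
        using W.M.zero_closed by blast
      then show ?thesis using c W.M.l_zero[OF W.M.zero_closed] V.R.add.l_cancel_one by metis
    qed
    have "\<phi> \<in> extensional (carrier ?W)" "\<psi> \<in> extensional (carrier ?W)"
      using \<phi> \<psi> by (auto simp: dual_space_def Let_def PiE_def)
    then show ?thesis using z[OF \<phi>] z[OF \<psi>] W0 by (intro extensionalityI) auto
  qed
  have "\<xi> = \<zero>\<^bsub>?V\<^esub>" if \<xi>: "\<xi> \<in> carrier ?V" for \<xi>
  proof -
    have "\<Phi> X Y \<xi> = \<Phi> X Y \<zero>\<^bsub>?V\<^esub>"
      using uniq bij_betwE[OF bij[OF X Y]] \<xi> V.M.zero_closed by blast
    then show ?thesis using bij_betw_imp_inj_on[OF bij[OF X Y]] \<xi> V.M.zero_closed by (meson inj_onD)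
  qed
  then show ?thesis using V.M.zero_closed unfolding Ext1_vanishes_def by blast
qed

theorem theorem3p2:
  fixes K :: "('k, 'c) ring_scheme"
    and D :: "('k, 'o, 'm) kcat"
    and C T :: "'o set"
  assumes "algebraically_closed K" and "char_zero K"
    and "abelian_category D"
    and "extension_closed_subcat D C"
    and "frobenius D C"
    and "two_calabi_yau K D C"
    and "strongly_almost_finite K (full_subcat D C)"
    and "additive_subcat (full_subcat D C) T"
    and "functorially_finite (full_subcat D C) T"
    and "rigid D C T"
    and "gl_dim K (full_subcat D T) \<le> 3"
    and "\<And>P. exact_projective D C P \<Longrightarrow> exact_injective D C P \<Longrightarrow> P \<in> T"
  shows "cluster_tilting D C T"
proof -
  interpret abelian_category D by fact
  interpret gl_dim_three_subcat D K C T
  proof (intro gl_dim_three_subcat.intro gl_dim_three_subcat_axioms.intro)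
    show "K_linear_category K (full_subcat D C)" "hom_finite K (full_subcat D C)" "krull_schmidt (full_subcat D C)"
      using assms(7) by (simp_all add: strongly_almost_finite_def)
    \<comment> \<open>Projectives are injective in a Frobenius category, so the assumption on
      projective-injective objects reaches every projective.\<close>
    show "P \<in> T" if "exact_projective D C P" for P
      using assms(5,12) that unfolding frobenius_def by blast
  qed (use assms in auto)
  have mem: "X \<in> T" if X: "X \<in> C" and v: "\<And>Y. Y \<in> T \<Longrightarrow> Ext1_vanishes D C X Y" for X
  proof -
    obtain L E l p where ap: "approximation L E X l p" by (rule approximation_exists[OF X]) (rule that)
    note A = approximationD[OF ap]
    have L: "L \<in> T" by (rule kernel_of_approximation_mem[OF X ap])
    have CD: "C \<subseteq> Obj D" using C_Obj by blast
    obtain s where "s \<in> Mor D X E" "p \<cdot>\<^bsub>D\<^esub> s = Idn D X"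
      using ext1_vanishes_split[OF v[OF L] category_axioms CD A(4)] by blast
    then have "is_direct_sum (full_subcat D C) E X L"
      using split_conflation[OF CD A(4)] C_Obj[OF X] T_Obj[OF A(2)] by (simp add: arr_def)
    then show ?thesis using T_direct_sum A(2) by blast
  qed
  have mem': "X \<in> T" if "X \<in> C" "\<And>Y. Y \<in> T \<Longrightarrow> Ext1_vanishes D C Y X" for X
    using mem two_calabi_yau_vanishes[OF assms(6)] that T_C by blast
  show ?thesis
    unfolding cluster_tilting_def
  proof (intro conjI)
    show "functorially_finite (full_subcat D C) T" by fact
    \<comment> \<open>Rigidity gives the inclusion of \<open>T\<close> in both sets;
      \<open>mem'\<close> and \<open>mem\<close> give the converse inclusions.\<close>
    show "T = {X \<in> C. \<forall>Y\<in>T. Ext1_vanishes D C Y X}" "T = {X \<in> C. \<forall>Y\<in>T. Ext1_vanishes D C X Y}"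
      using mem mem' T_C assms(10) unfolding rigid_def by blast+
  qed
qed

end
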